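(* Let $r$ be a natural number. For the problem $\min_{U\in\mathbb{R}^{n\times r}}f_s(UU^T)$, the following statements hold. (1) If $f_s$ satisfies the $\delta$-RIP$_{2r,2r}$ property with $\delta\le1/3$, then there are no spurious second-order critical points. (2) If $f_s$ satisfies the $\delta$-RIP$_{2r,2r}$ property with $\delta<1/2$, then there exists a positive correlation between every second-order critical point and the ground truth: there is a universal function $C:[0,1/2)\to(0,1]$ such that $\langle\tilde U\tilde U^T,M_s^*\rangle\ge C(\delta)\,\|\tilde U\tilde U^T\|_F\,\|M_s^*\|_F$ for every second-order critical point $\tilde U$. (3) If $\delta=1/2$, then there exists a counterexample with spurious second-order critical points: there exist $n$ and a function $f_s$ on $\mathbb{R}^{n\times n}$ satisfying the $\frac12$-RIP$_{2r,2r}$ property for which the problem has a spurious second-order critical point. (4) If $r=1$ and $f_s$ satisfies the $\delta$-RIP$_{2,2}$ property with $\delta<1/2$, then there are no spurious second-order critical points.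
   Context: All functions $f_s:\mathbb{R}^{n\times n}\to\mathbb{R}$ are twice continuously differentiable, and (without loss of generality, by replacing $f_s(M)$ with $\frac12[f_s(M)+f_s(M^T)]$) $\nabla f_s(M)$ is assumed symmetric. Standing assumption: $f_s$ has a first-order critical point $M_s^*$ (i.e. $\nabla f_s(M_s^* )=0$) that is symmetric, positive semidefinite and of rank at most $r$; it is called the ground truth. $\delta$-RIP$_{2r,2r}$ (with $\delta\in[0,1)$): $(1-\delta)\|K\|_F^2\le[\nabla^2f_s(M)](K,K)\le(1+\delta)\|K\|_F^2$ for all $M,K\in\mathbb{R}^{n\times n}$ of rank at most $2r$. A second-order critical point of an unconstrained problem is a point where the gradient of the objective vanishes and its Hessian is positive semidefinite; it is spurious if it is not a global minimizer. $\langle X,Y\rangle=\mathrm{tr}(X^TY)$. *)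

theory Defs
  imports Complex_Main "Jordan_Normal_Form.DL_Rank"
begin

text \<open>
  The dimensions of the matrices are quantified over, also existentially and below the quantifier
  over the correlation constant, so they cannot be types: a function on the real m-by-n matrices
  is a function on \<^typ>\<open>real mat\<close> of which only the values on \<^term>\<open>carrier_mat m n\<close> matter.
\<close>

definition mat_trace :: "real mat \<Rightarrow> real" where
  "mat_trace A = (\<Sum>i<dim_row A. A $$ (i, i))"

definition mat_inner :: "real mat \<Rightarrow> real mat \<Rightarrow> real" where
  "mat_inner A B = mat_trace (A\<^sup>T * B)"

definition frob_norm :: "real mat \<Rightarrow> real" where
  "frob_norm A = sqrt (mat_inner A A)"

abbreviation mat_rank :: "nat \<Rightarrow> real mat \<Rightarrow> nat" where
  "mat_rank n A \<equiv> vec_space.rank n A"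

definition symmetric_matrix :: "real mat \<Rightarrow> bool" where
  "symmetric_matrix A \<longleftrightarrow> A\<^sup>T = A"

definition psd_form :: "nat \<Rightarrow> real mat \<Rightarrow> bool" where
  "psd_form n A \<longleftrightarrow> (\<forall>v\<in>carrier_vec n. 0 \<le> v \<bullet> (A *\<^sub>v v))"


subsection \<open>Differential calculus on matrices\<close>

text \<open>The derivatives are Frechet derivatives with respect to the Frobenius norm.\<close>

definition has_grad ::
  "nat \<Rightarrow> nat \<Rightarrow> (real mat \<Rightarrow> real) \<Rightarrow> real mat \<Rightarrow> real mat \<Rightarrow> bool" where
  "has_grad m n f X G \<longleftrightarrow> G \<in> carrier_mat m n \<and>
     (\<forall>\<epsilon>>0. \<exists>d>0. \<forall>K\<in>carrier_mat m n. frob_norm K < d \<longrightarrow>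
        \<bar>f (X + K) - f X - mat_inner G K\<bar> \<le> \<epsilon> * frob_norm K)"

definition grad :: "nat \<Rightarrow> nat \<Rightarrow> (real mat \<Rightarrow> real) \<Rightarrow> real mat \<Rightarrow> real mat" where
  "grad m n f X = (THE G. has_grad m n f X G)"

definition linear_on_mats :: "nat \<Rightarrow> nat \<Rightarrow> (real mat \<Rightarrow> real mat) \<Rightarrow> bool" where
  "linear_on_mats m n H \<longleftrightarrow>
     (\<forall>A\<in>carrier_mat m n. H A \<in> carrier_mat m n) \<and>
     (\<forall>A\<in>carrier_mat m n. \<forall>B\<in>carrier_mat m n. H (A + B) = H A + H B) \<and>
     (\<forall>c. \<forall>A\<in>carrier_mat m n. H (c \<cdot>\<^sub>m A) = c \<cdot>\<^sub>m H A)"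

text \<open>The Hessian operator at X is the derivative of the gradient map at X.\<close>

definition has_hess_op ::
  "nat \<Rightarrow> nat \<Rightarrow> (real mat \<Rightarrow> real) \<Rightarrow> real mat \<Rightarrow> (real mat \<Rightarrow> real mat) \<Rightarrow> bool" where
  "has_hess_op m n f X H \<longleftrightarrow> linear_on_mats m n H \<and>
     (\<forall>\<epsilon>>0. \<exists>d>0. \<forall>K\<in>carrier_mat m n. frob_norm K < d \<longrightarrow>
        frob_norm (grad m n f (X + K) - grad m n f X - H K) \<le> \<epsilon> * frob_norm K)"

text \<open>
  The bilinear form of the second derivative at X. The operator is determined only on
  \<^term>\<open>carrier_mat m n\<close>, hence the choice operator instead of a definite description.
\<close>

definition hess ::
  "nat \<Rightarrow> nat \<Rightarrow> (real mat \<Rightarrow> real) \<Rightarrow> real mat \<Rightarrow> real mat \<Rightarrow> real mat \<Rightarrow> real" where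
  "hess m n f X K L = mat_inner ((SOME H. has_hess_op m n f X H) K) L"

text \<open>
  Continuity of the second derivative is required for each pair of directions, which in finite
  dimension is the same as continuity in operator norm.
\<close>

definition twice_cont_diff :: "nat \<Rightarrow> nat \<Rightarrow> (real mat \<Rightarrow> real) \<Rightarrow> bool" where
  "twice_cont_diff m n f \<longleftrightarrow>
     (\<forall>X\<in>carrier_mat m n. \<exists>G. has_grad m n f X G) \<and>
     (\<forall>X\<in>carrier_mat m n. \<exists>H. has_hess_op m n f X H) \<and>
     (\<forall>K\<in>carrier_mat m n. \<forall>L\<in>carrier_mat m n. \<forall>X\<in>carrier_mat m n. \<forall>\<epsilon>>0. \<exists>d>0.
        \<forall>Y\<in>carrier_mat m n. frob_norm (Y - X) < d \<longrightarrow>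
          \<bar>hess m n f Y K L - hess m n f X K L\<bar> < \<epsilon>)"

lemma mat_inner_eq_sum:
  assumes "A \<in> carrier_mat m n" "B \<in> carrier_mat m n"
  shows "mat_inner A B = (\<Sum>j<n. \<Sum>i<m. A $$ (i, j) * B $$ (i, j))"
proof -
  have "(A\<^sup>T * B) $$ (j, j) = (\<Sum>i<m. A $$ (i, j) * B $$ (i, j))" if "j < n" for j
    using assms that by (auto simp: scalar_prod_def atLeast0LessThan intro!: sum.cong)
  then show ?thesis
    using assms by (simp add: mat_inner_def mat_trace_def)
qed

lemma mat_inner_self_eq_0_iff:
  assumes "A \<in> carrier_mat m n"
  shows "mat_inner A A = 0 \<longleftrightarrow> A = 0\<^sub>m m n"
proof
  assume "mat_inner A A = 0"
  then have "(\<Sum>j<n. \<Sum>i<m. A $$ (i, j) * A $$ (i, j)) = 0"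
    using mat_inner_eq_sum[OF assms assms] by simp
  then have "\<forall>j<n. \<forall>i<m. A $$ (i, j) = 0"
    by (simp add: sum_nonneg_eq_0_iff sum_nonneg)
  then show "A = 0\<^sub>m m n" using assms by (intro eq_matI) auto
next
  assume "A = 0\<^sub>m m n"
  then show "mat_inner A A = 0" using mat_inner_eq_sum[OF assms assms] by simp
qed

lemma mat_inner_self_nonneg: "A \<in> carrier_mat m n \<Longrightarrow> 0 \<le> mat_inner A A"
  by (simp add: mat_inner_eq_sum sum_nonneg)

lemma frob_norm_smult:
  assumes "A \<in> carrier_mat m n"
  shows "frob_norm (c \<cdot>\<^sub>m A) = \<bar>c\<bar> * frob_norm A"
proof -
  have "mat_inner (c \<cdot>\<^sub>m A) (c \<cdot>\<^sub>m A) = c\<^sup>2 * mat_inner A A"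
    using assms by (simp add: mat_inner_eq_sum[where m = m and n = n] sum_distrib_left
        power2_eq_square mult.assoc mult.left_commute)
  then show ?thesis by (simp add: frob_norm_def real_sqrt_mult)
qed

lemma has_grad_unique:
  assumes G: "has_grad m n f X G" and G': "has_grad m n f X G'"
  shows "G = G'"
proof (rule ccontr)
  assume ne: "G \<noteq> G'"
  have c: "G \<in> carrier_mat m n" "G' \<in> carrier_mat m n" using G G' by (auto simp: has_grad_def)
  define D where "D = G - G'"
  have D: "D \<in> carrier_mat m n" using c by (simp add: D_def minus_carrier_mat)
  have "D \<noteq> 0\<^sub>m m n"
  proof
    assume "D = 0\<^sub>m m n"
    then have "D $$ (i, j) = 0" if "i < m" "j < n" for i j using that by simp
    then have "G = G'" using c by (intro eq_matI) (auto simp: D_def)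
    with ne show False by simp
  qed
  then have pos: "frob_norm D > 0"
    using mat_inner_self_eq_0_iff[OF D] mat_inner_self_nonneg[OF D] by (simp add: frob_norm_def)
  define e where "e = frob_norm D / 4"
  have e: "e > 0" using pos by (simp add: e_def)
  obtain d1 where d1: "d1 > 0" "\<And>K. K \<in> carrier_mat m n \<Longrightarrow> frob_norm K < d1 \<Longrightarrow>
      \<bar>f (X + K) - f X - mat_inner G K\<bar> \<le> e * frob_norm K"
    using G e unfolding has_grad_def by blast
  obtain d2 where d2: "d2 > 0" "\<And>K. K \<in> carrier_mat m n \<Longrightarrow> frob_norm K < d2 \<Longrightarrow>
      \<bar>f (X + K) - f X - mat_inner G' K\<bar> \<le> e * frob_norm K"
    using G' e unfolding has_grad_def by blast
  define t where "t = min d1 d2 / (2 * frob_norm D)"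
  have t: "t > 0" using d1 d2 pos by (simp add: t_def)
  let ?K = "t \<cdot>\<^sub>m D"
  have K: "?K \<in> carrier_mat m n" using D by simp
  have nK: "frob_norm ?K = t * frob_norm D" using frob_norm_smult[OF D] t by simp
  have "t * frob_norm D = min d1 d2 / 2" using pos by (simp add: t_def)
  then have "frob_norm ?K < d1" "frob_norm ?K < d2" using nK d1 d2 by auto
  then have le: "\<bar>mat_inner G ?K - mat_inner G' ?K\<bar> \<le> 2 * (e * frob_norm ?K)"
    using d1(2)[OF K] d2(2)[OF K] by linarith
  have "mat_inner G ?K - mat_inner G' ?K = t * mat_inner D D"
    unfolding mat_inner_eq_sum[OF c(1) K] mat_inner_eq_sum[OF c(2) K] mat_inner_eq_sum[OF D D]
      sum_distrib_left sum_subtractf[symmetric]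
    using c by (intro sum.cong refl) (auto simp: D_def algebra_simps)
  also have "\<dots> = t * (frob_norm D * frob_norm D)"
    using mat_inner_self_nonneg[OF D] by (simp add: frob_norm_def)
  finally have "t * (frob_norm D * frob_norm D) \<le> (t * (frob_norm D * frob_norm D)) / 2"
    using le nK t pos by (simp add: e_def)
  moreover have "t * (frob_norm D * frob_norm D) > 0" using t pos by simp
  ultimately show False by linarith
qed

lemma grad_eqI: "has_grad m n f X G \<Longrightarrow> grad m n f X = G"
  unfolding grad_def using has_grad_unique by blast


subsection \<open>The optimization problem\<close>

text \<open>
  The gradient is symmetric at symmetric arguments, which is what replacing f(M) by
  (f(M) + f(M^T))/2 achieves. Symmetry at all square matrices would make the second derivative
  vanish on antisymmetric directions, which contradicts the restricted isometry property
  for dimension at least 2.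
\<close>

definition admissible_objective :: "nat \<Rightarrow> (real mat \<Rightarrow> real) \<Rightarrow> bool" where
  "admissible_objective n f \<longleftrightarrow> twice_cont_diff n n f \<and>
     (\<forall>M\<in>carrier_mat n n. symmetric_matrix M \<longrightarrow> symmetric_matrix (grad n n f M))"

definition ground_truth :: "nat \<Rightarrow> nat \<Rightarrow> (real mat \<Rightarrow> real) \<Rightarrow> real mat \<Rightarrow> bool" where
  "ground_truth n r f Ms \<longleftrightarrow> Ms \<in> carrier_mat n n \<and> grad n n f Ms = 0\<^sub>m n n \<and>
     symmetric_matrix Ms \<and> psd_form n Ms \<and> mat_rank n Ms \<le> r"

definition RIP :: "nat \<Rightarrow> nat \<Rightarrow> nat \<Rightarrow> real \<Rightarrow> (real mat \<Rightarrow> real) \<Rightarrow> bool" where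
  "RIP n p q \<delta> f \<longleftrightarrow> 0 \<le> \<delta> \<and> \<delta> < 1 \<and>
     (\<forall>M\<in>carrier_mat n n. \<forall>K\<in>carrier_mat n n. mat_rank n M \<le> p \<longrightarrow> mat_rank n K \<le> q \<longrightarrow>
        (1 - \<delta>) * (frob_norm K)\<^sup>2 \<le> hess n n f M K K \<and>
        hess n n f M K K \<le> (1 + \<delta>) * (frob_norm K)\<^sup>2)"

definition factored :: "(real mat \<Rightarrow> real) \<Rightarrow> real mat \<Rightarrow> real" where
  "factored f U = f (U * U\<^sup>T)"

definition second_order_critical ::
  "nat \<Rightarrow> nat \<Rightarrow> (real mat \<Rightarrow> real) \<Rightarrow> real mat \<Rightarrow> bool" where
  "second_order_critical m n g U \<longleftrightarrow> U \<in> carrier_mat m n \<and> grad m n g U = 0\<^sub>m m n \<and>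
     (\<forall>V\<in>carrier_mat m n. 0 \<le> hess m n g U V V)"

definition spurious :: "nat \<Rightarrow> nat \<Rightarrow> (real mat \<Rightarrow> real) \<Rightarrow> real mat \<Rightarrow> bool" where
  "spurious m n g U \<longleftrightarrow> second_order_critical m n g U \<and>
     \<not> (\<forall>V\<in>carrier_mat m n. g U \<le> g V)"

end

theory Submission
  imports Defs
begin

text \<open>
  Let M = U U^T be a second-order critical point, Ms = Z Z^T the ground truth, K = M - Ms,
  G = grad f M and g = <G, K> = - <G, Ms>. By the mean value theorem and polarization, RIP says that
  <G, L> differs from <K, L> by at most \<delta> |K| |L| for every L built from the columns of U and Z.
  Taking L = y - K with y a multiple of a projection of Ms away from U gives
  (1 - \<delta>^2) |K|^2 + |y|^2 <= 2 g. On the other side, curvature in the directions u v^T, where v is a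
  smallest right singular vector of U (singular value \<sigma>) and u is orthogonal to the columns of U,
  gives g <= (1 + \<delta>) \<sigma>^2 |Y|^2, with Y the part of Z orthogonal to U. For rank one and for the
  correlation bound both combine to a quadratic inequality in |M| and |Ms| whose discriminant is
  negative for \<delta> < 1/2. For general rank, Z is rotated such that its component
  along U becomes symmetric; then |K|^2 >= 2 \<sigma>^2 |Y|^2, which contradicts the two inequalities
  for \<delta> <= 1/3.

  At \<delta> = 1/2 the rank-one inequalities are tight for M = e1 e1^T and Ms = 2 e2 e2^T; equality forces
  a Hessian that couples the two diagonal entries, and direct sums of it give all ranks.
\<close>

subsection \<open>The Frobenius inner product\<close>

text \<open>The isometry property only controls matrices of rank at most 2r, so every direction has
  to be written as U A + Z B; hence the recurring decompositions of that form. The multiple y is the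
  one with <G, y> = |y|^2. For it <K, y> = g holds as well, so <G - K, y - K> equals |y - K|^2 and
  the bilinear bound becomes |y - K| \<le> \<delta> |K|. If \<sigma> = 0, splitting Z along U is
  avoided: without orthogonality the curvature bound only loses a factor 2, harmless in front of
  \<sigma>^2 = 0. At \<delta> = 1/3 the bounds (1 - \<delta>) |K|^2 \<le> g \<le> (1 + \<delta>)
  \<sigma>^2 |Y|^2 are still compatible with |K|^2 \<ge> 2 \<sigma>^2 |Y|^2, but only with equality
  throughout; the key inequality excludes this last configuration. Eigenvectors never appear: a
  factor Z comes from symmetric elimination, \<sigma>^2 is an infimum, and the alignment of Z is a
  maximizer of a trace over the orthogonal matrices.\<close>

lemma inner_sum:
  assumes "dim_row A = dim_row B" "dim_col A = dim_col B"
  shows "mat_inner A B = (\<Sum>j<dim_col A. \<Sum>i<dim_row A. A $$ (i, j) * B $$ (i, j))"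
  using assms by (intro mat_inner_eq_sum) auto

lemma inner_commute:
  assumes "dim_row A = dim_row B" "dim_col A = dim_col B"
  shows "mat_inner A B = mat_inner B A"
  using assms by (simp add: inner_sum mult.commute)

lemma inner_add_left:
  assumes "dim_row A = dim_row C" "dim_col A = dim_col C" "dim_row B = dim_row C" "dim_col B = dim_col C"
  shows "mat_inner (A + B) C = mat_inner A C + mat_inner B C"
  using assms by (simp add: inner_sum sum.distrib algebra_simps)

lemma inner_add_right:
  assumes "dim_row A = dim_row C" "dim_col A = dim_col C" "dim_row B = dim_row C" "dim_col B = dim_col C"
  shows "mat_inner C (A + B) = mat_inner C A + mat_inner C B"
  using assms by (simp add: inner_sum sum.distrib algebra_simps)

lemma inner_minus_left:
  assumes "dim_row A = dim_row C" "dim_col A = dim_col C" "dim_row B = dim_row C" "dim_col B = dim_col C"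
  shows "mat_inner (A - B) C = mat_inner A C - mat_inner B C"
  using assms by (simp add: inner_sum sum_subtractf algebra_simps)

lemma inner_minus_right:
  assumes "dim_row A = dim_row C" "dim_col A = dim_col C" "dim_row B = dim_row C" "dim_col B = dim_col C"
  shows "mat_inner C (A - B) = mat_inner C A - mat_inner C B"
  using assms by (simp add: inner_sum sum_subtractf algebra_simps)

lemma inner_smult_left:
  assumes "dim_row A = dim_row B" "dim_col A = dim_col B"
  shows "mat_inner (c \<cdot>\<^sub>m A) B = c * mat_inner A B"
  using assms by (simp add: inner_sum sum_distrib_left mult.assoc)

lemma inner_smult_right:
  assumes "dim_row A = dim_row B" "dim_col A = dim_col B"
  shows "mat_inner A (c \<cdot>\<^sub>m B) = c * mat_inner A B"
  using assms by (simp add: inner_sum sum_distrib_left algebra_simps)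

lemma inner_uminus_right:
  assumes "dim_row A = dim_row B" "dim_col A = dim_col B"
  shows "mat_inner A (- B) = - mat_inner A B"
  using assms by (simp add: inner_sum sum_negf)

lemma inner_zero_left [simp]:
  "dim_row A = m \<Longrightarrow> dim_col A = n \<Longrightarrow> mat_inner (0\<^sub>m m n) A = 0"
  by (simp add: inner_sum)

lemma inner_zero_right [simp]:
  "dim_row A = m \<Longrightarrow> dim_col A = n \<Longrightarrow> mat_inner A (0\<^sub>m m n) = 0"
  by (simp add: inner_sum)

lemma inner_transpose:
  assumes "dim_row A = dim_row B" "dim_col A = dim_col B"
  shows "mat_inner A\<^sup>T B\<^sup>T = mat_inner A B"
  using assms by (simp add: inner_sum) (rule sum.swap)

lemmas inner_linear = inner_add_left inner_add_right inner_minus_left inner_minus_right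
  inner_smult_left inner_smult_right inner_uminus_right

lemma mult_assoc_dim:
  assumes "dim_col A = dim_row B" "dim_col B = dim_row C"
  shows "A * B * C = A * (B * (C :: real mat))"
  using assms by (intro assoc_mult_mat[of A "dim_row A" "dim_col A" B "dim_col B" C "dim_col C"]) auto

lemma transpose_mult_dim:
  assumes "dim_col A = dim_row B"
  shows "(A * B)\<^sup>T = B\<^sup>T * (A :: real mat)\<^sup>T"
  using assms by (intro transpose_mult[of A "dim_row A" "dim_col A" B "dim_col B"]) auto

lemma inner_mult_left:
  assumes "dim_col A = dim_row B" "dim_row C = dim_row A" "dim_col C = dim_col B"
  shows "mat_inner (A * B) C = mat_inner B (A\<^sup>T * C)"
  using assms unfolding mat_inner_def
  by (simp add: transpose_mult_dim mult_assoc_dim)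

lemma inner_mult_right:
  assumes "dim_col A = dim_row B" "dim_row C = dim_row A" "dim_col C = dim_col B"
  shows "mat_inner (A * B) C = mat_inner A (C * B\<^sup>T)"
proof -
  have "mat_inner (A * B) C = mat_inner (B\<^sup>T * A\<^sup>T) C\<^sup>T"
    using assms inner_transpose[of "A * B" C] by (simp add: transpose_mult_dim)
  also have "\<dots> = mat_inner A\<^sup>T (B * C\<^sup>T)" using assms by (subst inner_mult_left) auto
  also have "\<dots> = mat_inner A\<^sup>T (C * B\<^sup>T)\<^sup>T"
    using assms by (simp add: transpose_mult_dim)
  also have "\<dots> = mat_inner A (C * B\<^sup>T)" using assms by (intro inner_transpose) auto
  finally show ?thesis .
qed

lemma inner_self_nonneg [simp]: "0 \<le> mat_inner A A"
  by (rule mat_inner_self_nonneg[of A "dim_row A" "dim_col A"]) simp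

lemma frob_norm_sq: "(frob_norm A)\<^sup>2 = mat_inner A A"
  by (simp add: frob_norm_def)

lemma frob_norm_sq_sum: "(frob_norm A)\<^sup>2 = (\<Sum>j<dim_col A. \<Sum>i<dim_row A. (A $$ (i, j))\<^sup>2)"
  unfolding frob_norm_sq by (simp add: inner_sum) (simp add: power2_eq_square)

lemma frob_norm_nonneg [simp]: "0 \<le> frob_norm A"
  by (simp add: frob_norm_def)

lemma norm_smult [simp]: "frob_norm (c \<cdot>\<^sub>m A) = \<bar>c\<bar> * frob_norm A"
  by (rule frob_norm_smult[of A "dim_row A" "dim_col A"]) simp

lemma frob_norm_zero [simp]: "frob_norm (0\<^sub>m m n) = 0"
  by (simp add: frob_norm_def)

lemma norm_transpose [simp]: "frob_norm A\<^sup>T = frob_norm A"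
  by (simp add: frob_norm_def inner_transpose)

lemma norm_eq_0D: "frob_norm A = 0 \<Longrightarrow> A \<in> carrier_mat m n \<Longrightarrow> A = 0\<^sub>m m n"
  using mat_inner_self_eq_0_iff[of A m n] by (simp add: frob_norm_def)

lemma inner_Cauchy_Schwarz:
  assumes "dim_row A = dim_row B" "dim_col A = dim_col B"
  shows "\<bar>mat_inner A B\<bar> \<le> frob_norm A * frob_norm B"
proof -
  define a b c where "a = mat_inner A A" and "b = mat_inner A B" and "c = mat_inner B B"
  have comm: "mat_inner B A = b" using inner_commute[OF assms] by (simp add: b_def)
  have q: "0 \<le> x\<^sup>2 * a - 2 * x * y * b + y\<^sup>2 * c" for x y
  proof -
    have "0 \<le> mat_inner (x \<cdot>\<^sub>m A - y \<cdot>\<^sub>m B) (x \<cdot>\<^sub>m A - y \<cdot>\<^sub>m B)" by simp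
    also have "\<dots> = x\<^sup>2 * a - 2 * x * y * b + y\<^sup>2 * c"
      using assms comm by (simp add: inner_linear a_def b_def c_def power2_eq_square algebra_simps)
    finally show ?thesis .
  qed
  have ac: "0 \<le> a" "0 \<le> c" by (simp_all add: a_def c_def)
  \<comment> \<open>The nonnegative form is evaluated at (b, a) or (c, b), which leaves a or c times
    the discriminant; if a = c = 0, the point (b, 1) gives -2 b^2.\<close>
  have "b\<^sup>2 \<le> a * c"
  proof (cases "a = 0 \<and> c = 0")
    case True
    with q[of b 1] have "0 \<le> - 2 * b\<^sup>2" by (simp add: power2_eq_square)
    with True show ?thesis by simp
  next
    case False
    with ac have "0 < a \<or> 0 < c" by linarith
    then show ?thesis
    proof
      assume "0 < a"
      moreover have "0 \<le> a * (a * c - b\<^sup>2)"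
        using q[of b a] by (simp add: power2_eq_square algebra_simps)
      ultimately show ?thesis by (simp add: zero_le_mult_iff)
    next
      assume "0 < c"
      moreover have "0 \<le> c * (a * c - b\<^sup>2)"
        using q[of c b] by (simp add: power2_eq_square algebra_simps)
      ultimately show ?thesis by (simp add: zero_le_mult_iff)
    qed
  qed
  then have "sqrt (b\<^sup>2) \<le> sqrt (a * c)" by (rule real_sqrt_le_mono)
  then show ?thesis by (simp add: real_sqrt_mult frob_norm_def a_def b_def c_def)
qed

lemma norm_triangle:
  assumes "dim_row A = dim_row B" "dim_col A = dim_col B"
  shows "frob_norm (A + B) \<le> frob_norm A + frob_norm B"
proof (rule power2_le_imp_le)
  have "(frob_norm (A + B))\<^sup>2 = mat_inner A A + 2 * mat_inner A B + mat_inner B B"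
    using assms inner_commute[OF assms] by (simp add: frob_norm_sq inner_linear)
  also have "\<dots> \<le> (frob_norm A + frob_norm B)\<^sup>2"
    using inner_Cauchy_Schwarz[OF assms] by (simp add: frob_norm_sq[symmetric] power2_sum)
  finally show "(frob_norm (A + B))\<^sup>2 \<le> (frob_norm A + frob_norm B)\<^sup>2" .
qed simp

lemma abs_entry_le_norm:
  assumes "i < dim_row A" "j < dim_col A"
  shows "\<bar>A $$ (i, j)\<bar> \<le> frob_norm A"
proof -
  have "(A $$ (i, j))\<^sup>2 \<le> (\<Sum>i<dim_row A. A $$ (i, j) * A $$ (i, j))"
    using member_le_sum[of i "{..<dim_row A}" "\<lambda>i. A $$ (i, j) * A $$ (i, j)"] assms
    by (simp add: power2_eq_square)
  also have "\<dots> \<le> (\<Sum>j<dim_col A. \<Sum>i<dim_row A. A $$ (i, j) * A $$ (i, j))"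
    using member_le_sum[of j "{..<dim_col A}" "\<lambda>j. \<Sum>i<dim_row A. A $$ (i, j) * A $$ (i, j)"] assms
    by (simp add: sum_nonneg)
  also have "\<dots> = (frob_norm A)\<^sup>2" by (simp add: frob_norm_sq inner_sum)
  finally show ?thesis by (intro abs_le_square_iff[THEN iffD2, of _ "frob_norm A", simplified]) 
qed

text \<open>Columns are n-by-1 matrices rather than vectors, so that one inner product and one norm
  serve for columns, rank-one products and whole matrices.\<close>

definition col_mat :: "real mat \<Rightarrow> nat \<Rightarrow> real mat" where
  "col_mat A j = mat (dim_row A) 1 (\<lambda>(i, _). A $$ (i, j))"

lemma col_mat_dim [simp]: "dim_row (col_mat A j) = dim_row A" "dim_col (col_mat A j) = 1"
  by (simp_all add: col_mat_def)

lemma inner_eq_sum_cols: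
  assumes "dim_row A = dim_row B" "dim_col A = dim_col B"
  shows "mat_inner A B = (\<Sum>j<dim_col A. mat_inner (col_mat A j) (col_mat B j))"
  using assms by (simp add: inner_sum) (simp add: col_mat_def)

lemma mult_col_mat:
  assumes "dim_col A = dim_row B" "j < dim_col B"
  shows "A * col_mat B j = col_mat (A * B) j"
  using assms by (intro eq_matI) (auto simp: col_mat_def scalar_prod_def)

text \<open>Each entry of the product is the inner product of a row of A and a column of B; squared
  Cauchy-Schwarz, summed over all entries, separates into the two squared norms.\<close>

lemma norm_mult:
  assumes "dim_col A = dim_row B"
  shows "frob_norm (A * B) \<le> frob_norm A * frob_norm B"
proof (rule power2_le_imp_le)
  have *: "((A * B) $$ (i, j))\<^sup>2 \<le> (\<Sum>k<dim_col A. (A $$ (i, k))\<^sup>2) * (\<Sum>k<dim_col A. (B $$ (k, j))\<^sup>2)"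
    if "i < dim_row A" "j < dim_col B" for i j
  proof -
    let ?x = "col_mat A\<^sup>T i" and ?y = "col_mat B j"
    have "(A * B) $$ (i, j) = mat_inner ?x ?y"
      using that assms by (simp add: inner_sum col_mat_def scalar_prod_def atLeast0LessThan)
    then have "\<bar>(A * B) $$ (i, j)\<bar> \<le> frob_norm ?x * frob_norm ?y"
      using inner_Cauchy_Schwarz[of ?x ?y] assms by simp
    then have "((A * B) $$ (i, j))\<^sup>2 \<le> (frob_norm ?x)\<^sup>2 * (frob_norm ?y)\<^sup>2"
      by (metis abs_ge_zero power2_abs power_mono power_mult_distrib)
    then show ?thesis
      using that assms by (simp add: frob_norm_sq_sum col_mat_def)
  qed
  have "(frob_norm (A * B))\<^sup>2 = (\<Sum>j<dim_col B. \<Sum>i<dim_row A. ((A * B) $$ (i, j))\<^sup>2)"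
    by (simp add: frob_norm_sq_sum)
  also have "\<dots> \<le> (\<Sum>j<dim_col B. \<Sum>i<dim_row A.
      (\<Sum>k<dim_col A. (A $$ (i, k))\<^sup>2) * (\<Sum>k<dim_col A. (B $$ (k, j))\<^sup>2))"
    using * by (intro sum_mono) auto
  also have "\<dots> = (\<Sum>i<dim_row A. \<Sum>k<dim_col A. (A $$ (i, k))\<^sup>2) * (\<Sum>j<dim_col B. \<Sum>k<dim_col A. (B $$ (k, j))\<^sup>2)"
    by (simp only: sum_distrib_left[symmetric] sum_distrib_right[symmetric])
  also have "(\<Sum>i<dim_row A. \<Sum>k<dim_col A. (A $$ (i, k))\<^sup>2) = (frob_norm A)\<^sup>2"
    by (subst sum.swap) (simp add: frob_norm_sq_sum)
  also have "(\<Sum>j<dim_col B. \<Sum>k<dim_col A. (B $$ (k, j))\<^sup>2) = (frob_norm B)\<^sup>2"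
    using assms by (simp add: frob_norm_sq_sum)
  finally show "(frob_norm (A * B))\<^sup>2 \<le> (frob_norm A * frob_norm B)\<^sup>2"
    by (simp add: power_mult_distrib)
qed simp

text \<open>Both squares are the trace of A A^T A A^T up to cyclic rotation. This moves norms of
  n-by-n matrices to r-by-r Gram matrices.\<close>

lemma norm_mult_self_transpose: "frob_norm (A * A\<^sup>T) = frob_norm (A\<^sup>T * A)"
proof -
  have "mat_inner (A * A\<^sup>T) (A * A\<^sup>T) = mat_inner A\<^sup>T (A\<^sup>T * (A * A\<^sup>T))"
    by (subst inner_mult_left) auto
  also have "\<dots> = mat_inner A\<^sup>T (A\<^sup>T * A * A\<^sup>T)" by (simp add: mult_assoc_dim)
  also have "\<dots> = mat_inner (A\<^sup>T * A * A\<^sup>T) A\<^sup>T" by (rule inner_commute) auto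
  also have "\<dots> = mat_inner (A\<^sup>T * A) (A\<^sup>T * A)" by (subst inner_mult_right) auto
  finally show ?thesis by (simp add: frob_norm_def)
qed

subsection \<open>Rank and factorization\<close>

context vec_space begin

text \<open>The columns of the product lie in the column space of A, which is spanned by k
  vectors.\<close>

lemma rank_mult_le:
  assumes A: "A \<in> carrier_mat n k" and B: "B \<in> carrier_mat k nc"
  shows "rank (A * B) \<le> k"
proof -
  have AB: "A * B \<in> carrier_mat n nc" using A B by simp
  have "set (cols (A * B)) \<subseteq> span (set (cols A))"
  proof
    fix x assume "x \<in> set (cols (A * B))"
    then obtain j where j: "j < nc" "x = col (A * B) j"
      using AB by (auto simp: cols_def)
    then have "x = A *\<^sub>v col B j" by (simp only: col_mult2[OF A B j(1)])
    moreover have "col B j \<in> carrier_vec k" using B by auto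
    ultimately have "x \<in> col_space A" using A by (auto simp: col_space_eq[OF A])
    then show "x \<in> span (set (cols A))" by (simp add: col_space_def)
  qed
  moreover have cA: "set (cols A) \<subseteq> carrier_vec n" using A cols_dim by blast
  ultimately have sub: "span (set (cols (A * B))) \<subseteq> span (set (cols A))"
    using span_is_submodule span_is_subset by simp
  have cAB: "set (cols (A * B)) \<subseteq> carrier_vec n" using AB cols_dim by blast
  have sA: "subspace class_ring (span (set (cols A))) V"
    and sAB: "subspace class_ring (span (set (cols (A * B)))) V"
    using cA cAB span_is_subspace by auto
  have "rank (A * B) \<le> rank A"
    unfolding rank_def
    using vectorspace.subspace_dim[OF subspace_is_vs[OF sA] nested_subspaces[OF sA sAB sub]]
      fin_dim_span_cols[OF A] fin_dim_span_cols[OF AB] by simp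
  then show ?thesis using rank_le_nc[OF A] by simp
qed

text \<open>A v lies in the column space of A but, not being orthogonal to v, outside that of B.\<close>
lemma rank_less_of_orthogonal_cols:
  assumes A: "A \<in> carrier_mat n n" and v: "v \<in> carrier_vec n"
    and B: "B \<in> carrier_mat n n"
    and cols: "set (cols B) \<subseteq> col_space A"
    and orth: "\<And>j. j < n \<Longrightarrow> v \<bullet> col B j = 0" and pos: "v \<bullet> (A *\<^sub>v v) \<noteq> 0"
  shows "rank B < rank A"
proof -
  have cA: "set (cols A) \<subseteq> carrier_vec n" using A cols_dim by blast
  have cB: "set (cols B) \<subseteq> carrier_vec n" using B cols_dim by blast
  obtain S where S: "maximal S (\<lambda>T. T \<subseteq> set (cols B) \<and> lin_indpt T)"
    using maximal_exists[of "(\<lambda>T. T \<subseteq> set (cols B) \<and> lin_indpt T)" "card (set (cols B))" "{}"]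
    by (meson List.finite_set card_mono empty_iff empty_subsetI finite_lin_indpt2 rev_finite_subset)
  have rB: "rank B = card S" by (rule rank_card_indpt[OF B S])
  have SB: "S \<subseteq> set (cols B)" and li: "lin_indpt S" using S by (auto simp: maximal_def)
  have cS: "S \<subseteq> carrier_vec n" using SB cB by blast
  have fS: "finite S" using SB finite_subset by blast
  have "\<forall>x\<in>S. v \<bullet> x = 0" using SB orth B by (auto simp: cols_def)
  then have spanS: "v \<bullet> x = 0" if "x \<in> span S" for x
  proof -
    from that obtain a where a: "x = lincomb a S"
      using fS cS finite_span by auto
    have "v \<bullet> lincomb a S = (\<Sum>y\<in>S. a y * (v \<bullet> y))"
    proof -
      have "v \<bullet> lincomb a S = (\<Sum>i<n. v $ i * (\<Sum>y\<in>S. a y * y $ i))"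
        using v cS lincomb_index[OF _ cS] lincomb_dim[OF fS cS]
        by (auto simp: scalar_prod_def atLeast0LessThan intro!: sum.cong)
      also have "\<dots> = (\<Sum>y\<in>S. \<Sum>i<n. a y * (v $ i * y $ i))"
        by (subst sum.swap) (simp add: sum_distrib_left algebra_simps)
      also have "\<dots> = (\<Sum>y\<in>S. a y * (v \<bullet> y))"
        using v cS by (intro sum.cong refl)
          (auto simp: scalar_prod_def sum_distrib_left atLeast0LessThan dest!: subsetD intro!: sum.cong)
      finally show ?thesis .
    qed
    with a \<open>\<forall>x\<in>S. v \<bullet> x = 0\<close> show ?thesis by simp
  qed
  let ?w = "A *\<^sub>v v"
  have w: "?w \<in> carrier_vec n" using A v by auto
  have wA: "?w \<in> span (set (cols A))"
    using A v by (auto simp: col_space_eq[OF A] col_space_def[symmetric])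
  have wS: "?w \<notin> span S" using spanS pos by blast
  then have wS': "?w \<notin> S" using cS span_mem by auto
  have li': "lin_indpt (S \<union> {?w})"
    using lin_dep_iff_in_span[OF _ li _ wS'] cS w wS by auto
  have sub: "S \<union> {?w} \<subseteq> span (set (cols A))" using SB cols wA by (auto simp: col_space_def)
  have sA: "subspace class_ring (span (set (cols A))) V" using cA span_is_subspace by auto
  have subm: "submodule class_ring (span (set (cols A))) V" using cA span_is_submodule by auto
  have "module.lin_indpt class_ring (span_vs (set (cols A))) (S \<union> {?w})"
    using span_li_not_depend(2)[OF sub subm] li' by simp
  then have "card (S \<union> {?w}) \<le> vectorspace.dim class_ring (span_vs (set (cols A)))"
    using vectorspace.li_le_dim(2)[OF subspace_is_vs[OF sA] fin_dim_span_cols[OF A]] sub by simp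
  then show ?thesis using rB fS wS' by (simp add: rank_def)
qed

end

lemma sym_scalar_prod:
  fixes M :: "real mat"
  assumes M: "M \<in> carrier_mat n n" and sym: "M\<^sup>T = M" and x: "x \<in> carrier_vec n" and y: "y \<in> carrier_vec n"
  shows "x \<bullet> (M *\<^sub>v y) = (M *\<^sub>v x) \<bullet> y"
  using transpose_vec_mult_scalar[OF M y x] sym
    comm_scalar_prod[of y n "M *\<^sub>v x"] comm_scalar_prod[of x n "M *\<^sub>v y"] M x y by simp

lemma mat_unit_vec_col:
  fixes M :: "real mat"
  assumes "M \<in> carrier_mat m n" "j < n"
  shows "M *\<^sub>v unit_vec n j = col M j"
  using assms by (intro eq_vecI) (auto simp: scalar_prod_right_unit)

text \<open>Polarization at sums of two unit vectors recovers the symmetrized entries.\<close>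

lemma quadform_zero_imp_zero:
  fixes M :: "real mat"
  assumes M: "M \<in> carrier_mat n n" and sym: "M\<^sup>T = M"
    and z: "\<And>v. v \<in> carrier_vec n \<Longrightarrow> v \<bullet> (M *\<^sub>v v) = 0"
  shows "M = 0\<^sub>m n n"
proof (rule eq_matI)
  fix i j assume "i < dim_row (0\<^sub>m n n :: real mat)" "j < dim_col (0\<^sub>m n n :: real mat)"
  then have ij: "i < n" "j < n" by auto
  let ?x = "unit_vec n i :: real vec" and ?y = "unit_vec n j :: real vec"
  have "(?x + ?y) \<bullet> (M *\<^sub>v (?x + ?y)) = 0" by (rule z) simp
  then have "?x \<bullet> (M *\<^sub>v ?x) + ?x \<bullet> (M *\<^sub>v ?y) + (?y \<bullet> (M *\<^sub>v ?x) + ?y \<bullet> (M *\<^sub>v ?y)) = 0"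
    using M by (simp add: mult_add_distrib_mat_vec[of _ n n] add_scalar_prod_distrib[of _ n]
        scalar_prod_add_distrib[of _ n])
  then have "?x \<bullet> (M *\<^sub>v ?y) + ?y \<bullet> (M *\<^sub>v ?x) = 0" using z[of ?x] z[of ?y] by simp
  moreover have "?x \<bullet> (M *\<^sub>v ?y) = M $$ (i, j)" "?y \<bullet> (M *\<^sub>v ?x) = M $$ (j, i)"
    using ij M by (auto simp: scalar_prod_left_unit[of _ n] scalar_prod_right_unit)
  moreover have "M $$ (j, i) = M $$ (i, j)" using sym M ij by (metis carrier_matD index_transpose_mat(1))
  ultimately show "M $$ (i, j) = 0\<^sub>m n n $$ (i, j)" using ij by simp
qed (use M in auto)

text \<open>Symmetric elimination instead of a spectral decomposition: with w = M v and c = v . w >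
  0, the matrix M - w w^T / c is again symmetric and positive semidefinite, and it annihilates v, so
  its rank is smaller. Each round contributes one column w / sqrt c, and the rank bound limits the
  number of rounds to r.\<close>

lemma psd_factorization:
  fixes M :: "real mat"
  assumes "M \<in> carrier_mat n n" "M\<^sup>T = M" "psd_form n M" "mat_rank n M \<le> r"
  shows "\<exists>Z\<in>carrier_mat n r. M = Z * Z\<^sup>T"
  using assms
proof (induction r arbitrary: M rule: less_induct)
  case (less r)
  note M = less.prems(1) and sym = less.prems(2)
  show ?case
  proof (cases "\<forall>v\<in>carrier_vec n. v \<bullet> (M *\<^sub>v v) = 0")
    case True
    then have "M = 0\<^sub>m n n" using quadform_zero_imp_zero[OF M sym] by blast
    then have "M = 0\<^sub>m n r * (0\<^sub>m n r)\<^sup>T" by simp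
    then show ?thesis by (intro bexI[of _ "0\<^sub>m n r"]) auto
  next
    case False
    then obtain v where v: "v \<in> carrier_vec n" "v \<bullet> (M *\<^sub>v v) \<noteq> 0" by blast
    define c where "c = v \<bullet> (M *\<^sub>v v)"
    define w where "w = M *\<^sub>v v"
    have c: "c > 0" using less.prems(3) v by (force simp: psd_form_def c_def)
    have w: "w \<in> carrier_vec n" using M v by (auto simp: w_def)
    have wv: "w \<bullet> v = c" "v \<bullet> w = c"
      using comm_scalar_prod[OF w v(1)] by (auto simp: c_def w_def)
    define M' where "M' = mat n n (\<lambda>(i, j). M $$ (i, j) - w $ i * w $ j / c)"
    have M': "M' \<in> carrier_mat n n" by (simp add: M'_def)
    have M_sym: "M $$ (i, j) = M $$ (j, i)" if "i < n" "j < n" for i j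
      using sym M that by (metis carrier_matD index_transpose_mat(1))
    have sym': "M'\<^sup>T = M'" using M_sym by (intro eq_matI) (auto simp: M'_def)
    have M'x: "M' *\<^sub>v x = M *\<^sub>v x - (w \<bullet> x / c) \<cdot>\<^sub>v w" if x: "x \<in> carrier_vec n" for x
      using M x w by (intro eq_vecI)
        (auto simp: M'_def scalar_prod_def sum_subtractf sum_divide_distrib sum_distrib_right sum_distrib_left algebra_simps)
    have psd': "psd_form n M'"
      unfolding psd_form_def
    proof
      fix x :: "real vec" assume x: "x \<in> carrier_vec n"
      define a where "a = w \<bullet> x"
      have xw: "x \<bullet> w = a" using comm_scalar_prod[OF w x] by (simp add: a_def)
      have vMx: "v \<bullet> (M *\<^sub>v x) = a" using sym_scalar_prod[OF M sym v(1) x] by (simp add: a_def w_def)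
      have Mx: "M *\<^sub>v x \<in> carrier_vec n" using M x by simp
      \<comment> \<open>Completing the square: the form of M' at x is the form of M at x shifted
        along v to its minimum.\<close>
      let ?y = "x - (a / c) \<cdot>\<^sub>v v"
      have y: "?y \<in> carrier_vec n" using x v by simp
      have "M *\<^sub>v ?y = M *\<^sub>v x - (a / c) \<cdot>\<^sub>v w"
        using M x v by (simp add: mult_minus_distrib_mat_vec[of _ n n] mult_mat_vec[of _ n n] w_def)
      then have "?y \<bullet> (M *\<^sub>v ?y) = x \<bullet> (M *\<^sub>v x) - (a / c) * a - (a / c) * (a - (a / c) * c)"
        using x v w Mx xw vMx wv
        by (simp add: minus_scalar_prod_distrib[of _ n] scalar_prod_minus_distrib[of _ n] algebra_simps)
      also have "\<dots> = x \<bullet> (M *\<^sub>v x) - (a / c) * a" using c by simp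
      also have "\<dots> = x \<bullet> (M' *\<^sub>v x)"
        using x w Mx xw by (simp add: M'x a_def[symmetric] scalar_prod_minus_distrib[of _ n])
      finally show "0 \<le> x \<bullet> (M' *\<^sub>v x)" using less.prems(3) y by (metis psd_form_def)
    qed
    interpret vec_space "TYPE(real)" n .
    have rank': "rank M' < rank M"
    proof (rule rank_less_of_orthogonal_cols[OF M v(1) M' _ _ v(2)])
      show "set (cols M') \<subseteq> col_space M"
      proof
        fix x assume "x \<in> set (cols M')"
        then obtain j where j: "j < n" "x = col M' j" using M' by (auto simp: cols_def)
        have "x = M' *\<^sub>v unit_vec n j" using mat_unit_vec_col[OF M' j(1)] j by simp
        also have "\<dots> = M *\<^sub>v (unit_vec n j - (w \<bullet> unit_vec n j / c) \<cdot>\<^sub>v v)"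
          using M v by (simp add: M'x mult_minus_distrib_mat_vec[of _ n n] mult_mat_vec[of _ n n] w_def)
        finally show "x \<in> col_space M" using M v by (auto simp: col_space_eq[OF M])
      qed
      fix j assume j: "j < n"
      \<comment> \<open>M' v = w - (c / c) w = 0, and by symmetry v is then orthogonal to every
        column of M'.\<close>
      have "v \<bullet> col M' j = v \<bullet> (M' *\<^sub>v unit_vec n j)" using mat_unit_vec_col[OF M' j] by simp
      also have "\<dots> = (M' *\<^sub>v v) \<bullet> unit_vec n j" using sym_scalar_prod[OF M' sym' v(1)] by simp
      also have "M' *\<^sub>v v = 0\<^sub>v n" using w v c by (simp add: M'x wv w_def[symmetric])
      finally show "v \<bullet> col M' j = 0" using j by simp
    qed
    with less.prems(4) have "r \<noteq> 0" "rank M' \<le> r - 1" by auto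
    then obtain s where r: "r = Suc s" by (cases r) auto
    obtain Z' where Z': "Z' \<in> carrier_mat n s" "M' = Z' * Z'\<^sup>T"
      using less.IH[of s M'] M' sym' psd' \<open>rank M' \<le> r - 1\<close> r by auto
    define Z where "Z = mat n r (\<lambda>(i, j). if j < s then Z' $$ (i, j) else w $ i / sqrt c)"
    have "M = Z * Z\<^sup>T"
    proof (rule eq_matI)
      fix i j assume "i < dim_row (Z * Z\<^sup>T)" "j < dim_col (Z * Z\<^sup>T)"
      then have ij: "i < n" "j < n" by (auto simp: Z_def)
      have "(Z * Z\<^sup>T) $$ (i, j) = (\<Sum>k<s. Z' $$ (i, k) * Z' $$ (j, k)) + w $ i / sqrt c * (w $ j / sqrt c)"
        using ij by (simp add: Z_def scalar_prod_def atLeast0LessThan r)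
      also have "(\<Sum>k<s. Z' $$ (i, k) * Z' $$ (j, k)) = (Z' * Z'\<^sup>T) $$ (i, j)"
        using ij Z'(1) by (simp add: scalar_prod_def atLeast0LessThan)
      also have "\<dots> = M $$ (i, j) - w $ i * w $ j / c"
        unfolding Z'(2)[symmetric] using ij by (simp add: M'_def)
      finally show "M $$ (i, j) = (Z * Z\<^sup>T) $$ (i, j)" using c by simp
    qed (use M in \<open>auto simp: Z_def\<close>)
    then show ?thesis by (intro bexI[of _ Z]) (auto simp: Z_def)
  qed
qed

text \<open>Supplies the rank hypotheses of the isometry property: U and Z contribute at most r
  each.\<close>

lemma rank_two_factors_le:
  fixes U Z :: "real mat"
  assumes "U \<in> carrier_mat n r" "Z \<in> carrier_mat n r" "A \<in> carrier_mat r n" "B \<in> carrier_mat r n"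
  shows "mat_rank n (U * A + Z * B) \<le> 2 * r"
  using vec_space.rank_subadditive[of "U * A" n n "Z * B"] vec_space.rank_mult_le[of U n r A n]
    vec_space.rank_mult_le[of Z n r B n] assms by simp

text \<open>Y Y^T is the sum of the rank-one matrices of its columns; a curvature bound for single
  columns can therefore be summed.\<close>

lemma inner_self_transpose_eq_sum:
  fixes A Y :: "real mat"
  assumes A: "A \<in> carrier_mat n n" and Y: "Y \<in> carrier_mat n k"
  shows "mat_inner A (Y * Y\<^sup>T) = (\<Sum>j<k. mat_inner A (col_mat Y j * (col_mat Y j)\<^sup>T))"
proof -
  have *: "mat_inner A (X * X\<^sup>T) = mat_inner (A * X) X" if "X \<in> carrier_mat n l" for X l
    using inner_mult_right[of A X X] inner_mult_right[of X "X\<^sup>T" A] A that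
      inner_commute[of A "X * X\<^sup>T"] inner_commute[of X "A * X"] by simp
  have "mat_inner (A * Y) Y = (\<Sum>j<k. mat_inner (col_mat (A * Y) j) (col_mat Y j))"
    using A Y by (subst inner_eq_sum_cols) auto
  also have "\<dots> = (\<Sum>j<k. mat_inner A (col_mat Y j * (col_mat Y j)\<^sup>T))"
  proof (intro sum.cong refl)
    fix j assume "j \<in> {..<k}"
    moreover have "col_mat Y j \<in> carrier_mat n 1" using Y by (intro carrier_matI) auto
    ultimately show "mat_inner (col_mat (A * Y) j) (col_mat Y j) = mat_inner A (col_mat Y j * (col_mat Y j)\<^sup>T)"
      using A Y by (simp add: * mult_col_mat)
  qed
  finally show ?thesis by (simp add: *[OF Y])
qed

lemma norm_mult_ge:
  fixes A :: "real mat"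
  assumes A: "A \<in> carrier_mat m n" and Y: "Y \<in> carrier_mat n k"
    and le: "\<And>x. x \<in> carrier_mat n 1 \<Longrightarrow> c * mat_inner x x \<le> mat_inner (A * x) (A * x)"
  shows "c * mat_inner Y Y \<le> mat_inner (A * Y) (A * Y)"
proof -
  have "c * mat_inner Y Y = (\<Sum>j<k. c * mat_inner (col_mat Y j) (col_mat Y j))"
    using Y by (subst inner_eq_sum_cols) (auto simp: sum_distrib_left)
  also have "\<dots> \<le> (\<Sum>j<k. mat_inner (A * col_mat Y j) (A * col_mat Y j))"
    using Y by (intro sum_mono le carrier_matI) auto
  also have "\<dots> = mat_inner (A * Y) (A * Y)"
    using A Y by (subst inner_eq_sum_cols) (auto simp: mult_col_mat)
  finally show ?thesis .
qed

subsection \<open>Differentiation along lines\<close>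

lemma hess_op_ex:
  assumes "twice_cont_diff m n f" "X \<in> carrier_mat m n"
  shows "has_hess_op m n f X (SOME H. has_hess_op m n f X H)"
proof -
  have "\<exists>H. has_hess_op m n f X H" using assms by (simp add: twice_cont_diff_def)
  then show ?thesis by (rule someI_ex)
qed

lemma has_grad_grad:
  assumes "twice_cont_diff m n f" "X \<in> carrier_mat m n"
  shows "has_grad m n f X (grad m n f X)"
  using assms grad_eqI by (fastforce simp: twice_cont_diff_def)

lemma grad_carrier:
  assumes "twice_cont_diff m n f" "X \<in> carrier_mat m n"
  shows "grad m n f X \<in> carrier_mat m n"
  using has_grad_grad[OF assms] by (simp add: has_grad_def)

text \<open>Here b plays the norm of the direction of a line. It may be zero, hence the scaling by b
  + 1.\<close>

lemma DERIV_of_small_remainder: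
  fixes \<phi> :: "real \<Rightarrow> real"
  assumes "\<And>\<epsilon>. \<epsilon> > 0 \<Longrightarrow> \<exists>d>0. \<forall>h. \<bar>h\<bar> * b < d \<longrightarrow> \<bar>\<phi> (t + h) - \<phi> t - h * D\<bar> \<le> \<epsilon> * (\<bar>h\<bar> * b)"
    and b: "b \<ge> 0"
  shows "(\<phi> has_real_derivative D) (at t)"
  unfolding DERIV_def LIM_def
proof (intro allI impI)
  fix e :: real assume e: "0 < e"
  have b1: "b + 1 > 0" using b by simp
  obtain d where d: "d > 0" "\<And>h. \<bar>h\<bar> * b < d \<Longrightarrow> \<bar>\<phi> (t + h) - \<phi> t - h * D\<bar> \<le> (e / (b + 1)) * (\<bar>h\<bar> * b)"
    using assms(1)[of "e / (b + 1)"] e b1 by auto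
  show "\<exists>s>0. \<forall>x. x \<noteq> 0 \<and> dist x 0 < s \<longrightarrow> dist ((\<phi> (t + x) - \<phi> t) / x) D < e"
  proof (intro exI[of _ "d / (b + 1)"] conjI allI impI)
    show "d / (b + 1) > 0" using d b1 by simp
    fix h :: real assume h: "h \<noteq> 0 \<and> dist h 0 < d / (b + 1)"
    then have "\<bar>h\<bar> * (b + 1) < d" using b1 by (simp add: pos_less_divide_eq)
    then have "\<bar>h\<bar> * b < d" by (simp add: distrib_left)
    from d(2)[OF this] have "\<bar>\<phi> (t + h) - \<phi> t - h * D\<bar> \<le> \<bar>h\<bar> * (e * b / (b + 1))" by (simp add: algebra_simps)
    moreover have "(\<phi> (t + h) - \<phi> t) / h - D = (\<phi> (t + h) - \<phi> t - h * D) / h"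
      using h by (simp add: field_simps)
    ultimately have "\<bar>(\<phi> (t + h) - \<phi> t) / h - D\<bar> \<le> e * b / (b + 1)"
      using h by (simp add: abs_divide pos_divide_le_eq mult.commute)
    also have "\<dots> < e" using e b1 by (simp add: pos_divide_less_eq)
    finally show "dist ((\<phi> (t + h) - \<phi> t) / h) D < e" by (simp add: dist_real_def)
  qed
qed

lemma line_step:
  fixes X K :: "real mat"
  assumes "X \<in> carrier_mat m n" "K \<in> carrier_mat m n"
  shows "X + (t + h) \<cdot>\<^sub>m K = X + t \<cdot>\<^sub>m K + h \<cdot>\<^sub>m K"
  using assms by (intro eq_matI) (auto simp: algebra_simps)

lemma DERIV_line:
  assumes f: "twice_cont_diff m n f" and X: "X \<in> carrier_mat m n" and K: "K \<in> carrier_mat m n"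
  shows "((\<lambda>t. f (X + t \<cdot>\<^sub>m K)) has_real_derivative mat_inner (grad m n f (X + t \<cdot>\<^sub>m K)) K) (at t)"
proof (rule DERIV_of_small_remainder[where b = "frob_norm K"])
  let ?Y = "X + t \<cdot>\<^sub>m K" and ?G = "grad m n f (X + t \<cdot>\<^sub>m K)"
  have Y: "?Y \<in> carrier_mat m n" using X K by simp
  have G: "?G \<in> carrier_mat m n" by (rule grad_carrier[OF f Y])
  fix e :: real assume "0 < e"
  then obtain d where d: "d > 0" "\<And>L. L \<in> carrier_mat m n \<Longrightarrow> frob_norm L < d \<Longrightarrow>
      \<bar>f (?Y + L) - f ?Y - mat_inner ?G L\<bar> \<le> e * frob_norm L"
    using has_grad_grad[OF f Y] unfolding has_grad_def by blast
  show "\<exists>d>0. \<forall>h. \<bar>h\<bar> * frob_norm K < d \<longrightarrow>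
      \<bar>f (X + (t + h) \<cdot>\<^sub>m K) - f ?Y - h * mat_inner ?G K\<bar> \<le> e * (\<bar>h\<bar> * frob_norm K)"
  proof (intro exI[of _ d] conjI allI impI d)
    fix h assume "\<bar>h\<bar> * frob_norm K < d"
    then have "\<bar>f (?Y + h \<cdot>\<^sub>m K) - f ?Y - mat_inner ?G (h \<cdot>\<^sub>m K)\<bar> \<le> e * frob_norm (h \<cdot>\<^sub>m K)"
      using d(2)[of "h \<cdot>\<^sub>m K"] K by simp
    then show "\<bar>f (X + (t + h) \<cdot>\<^sub>m K) - f ?Y - h * mat_inner ?G K\<bar> \<le> e * (\<bar>h\<bar> * frob_norm K)"
      using K G by (simp add: line_step[OF X K] inner_smult_right)
  qed
qed simp

lemma DERIV_grad_line_op: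
  assumes H: "has_hess_op m n f (X + t \<cdot>\<^sub>m K) H"
    and gc: "\<And>X. X \<in> carrier_mat m n \<Longrightarrow> grad m n f X \<in> carrier_mat m n"
    and X: "X \<in> carrier_mat m n" and K: "K \<in> carrier_mat m n" and L: "L \<in> carrier_mat m n"
  shows "((\<lambda>t. mat_inner (grad m n f (X + t \<cdot>\<^sub>m K)) L) has_real_derivative mat_inner (H K) L) (at t)"
proof (rule DERIV_of_small_remainder[where b = "frob_norm K"])
  let ?Y = "X + t \<cdot>\<^sub>m K"
  let ?g = "grad m n f"
  have Y: "?Y \<in> carrier_mat m n" using X K by simp
  have HK: "H K \<in> carrier_mat m n" "\<And>h. H (h \<cdot>\<^sub>m K) = h \<cdot>\<^sub>m H K"
    using H K by (auto simp: has_hess_op_def linear_on_mats_def)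
  have lin: "mat_inner (?g (?Y + h \<cdot>\<^sub>m K) - ?g ?Y - H (h \<cdot>\<^sub>m K)) L
      = mat_inner (?g (?Y + h \<cdot>\<^sub>m K)) L - mat_inner (?g ?Y) L - h * mat_inner (H K) L" for h
  proof -
    define g1 g2 where "g1 = ?g (?Y + h \<cdot>\<^sub>m K)" and "g2 = ?g ?Y"
    have "g1 \<in> carrier_mat m n" "g2 \<in> carrier_mat m n"
      unfolding g1_def g2_def using Y K by (auto intro!: gc)
    then have "dim_row g1 = m" "dim_col g1 = n" "dim_row g2 = m" "dim_col g2 = n" by auto
    moreover have "dim_row L = m" "dim_col L = n" "dim_row (H K) = m" "dim_col (H K) = n"
      using L HK(1) by auto
    ultimately have "mat_inner (g1 - g2 - h \<cdot>\<^sub>m H K) L = mat_inner g1 L - mat_inner g2 L - h * mat_inner (H K) L"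
      by (simp add: inner_linear)
    then show ?thesis by (simp only: g1_def g2_def HK(2))
  qed
  fix e :: real assume e: "0 < e"
  have l1: "frob_norm L + 1 > 0" by (simp add: add_nonneg_pos)
  with e have "e / (frob_norm L + 1) > 0" by simp
  with H[unfolded has_hess_op_def, THEN conjunct2, rule_format, of "e / (frob_norm L + 1)"]
  obtain d where d: "d > 0" "\<And>N. N \<in> carrier_mat m n \<Longrightarrow> frob_norm N < d \<Longrightarrow>
      frob_norm (?g (?Y + N) - ?g ?Y - H N) \<le> e / (frob_norm L + 1) * frob_norm N" by blast
  show "\<exists>d>0. \<forall>h. \<bar>h\<bar> * frob_norm K < d \<longrightarrow>
      \<bar>mat_inner (?g (X + (t + h) \<cdot>\<^sub>m K)) L - mat_inner (?g ?Y) L - h * mat_inner (H K) L\<bar>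
        \<le> e * (\<bar>h\<bar> * frob_norm K)"
  proof (intro exI[of _ d] conjI allI impI d)
    fix h assume h: "\<bar>h\<bar> * frob_norm K < d"
    let ?R = "?g (?Y + h \<cdot>\<^sub>m K) - ?g ?Y - H (h \<cdot>\<^sub>m K)"
    have R: "?R \<in> carrier_mat m n"
      using HK by (simp add: minus_carrier_mat)
    have "\<bar>mat_inner ?R L\<bar> \<le> frob_norm ?R * frob_norm L" using R L by (intro inner_Cauchy_Schwarz) auto
    also have "\<dots> \<le> (e / (frob_norm L + 1) * frob_norm (h \<cdot>\<^sub>m K)) * frob_norm L"
      using d(2)[of "h \<cdot>\<^sub>m K"] K h by (intro mult_right_mono) auto
    also have "\<dots> = e * (\<bar>h\<bar> * frob_norm K) * (frob_norm L / (frob_norm L + 1))" by simp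
    also have "\<dots> \<le> e * (\<bar>h\<bar> * frob_norm K)"
      using e l1 by (intro mult_left_le) auto
    finally show "\<bar>mat_inner (?g (X + (t + h) \<cdot>\<^sub>m K)) L - mat_inner (?g ?Y) L - h * mat_inner (H K) L\<bar>
        \<le> e * (\<bar>h\<bar> * frob_norm K)"
      unfolding lin line_step[OF X K] .
  qed
qed simp

lemma DERIV_grad_line:
  assumes f: "twice_cont_diff m n f" and X: "X \<in> carrier_mat m n"
    and K: "K \<in> carrier_mat m n" and L: "L \<in> carrier_mat m n"
  shows "((\<lambda>t. mat_inner (grad m n f (X + t \<cdot>\<^sub>m K)) L) has_real_derivative hess m n f (X + t \<cdot>\<^sub>m K) K L) (at t)"
  unfolding hess_def by (intro DERIV_grad_line_op hess_op_ex grad_carrier[OF f] assms) (use X K in auto)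

lemma add_smult_zero_mat: "X \<in> carrier_mat m n \<Longrightarrow> K \<in> carrier_mat m n \<Longrightarrow> X + 0 \<cdot>\<^sub>m K = (X :: real mat)"
  by (intro eq_matI) auto

text \<open>The operator inside \<open>hess\<close> is an arbitrary choice. Any other one gives the
  same value, because both values are the derivative at 0 of one real function on the line through X
  in direction K.\<close>

lemma hess_eqI:
  assumes gc: "\<And>X. X \<in> carrier_mat m n \<Longrightarrow> grad m n f X \<in> carrier_mat m n"
    and X: "X \<in> carrier_mat m n"
    and H: "has_hess_op m n f X H"
    and K: "K \<in> carrier_mat m n" and L: "L \<in> carrier_mat m n"
  shows "hess m n f X K L = mat_inner (H K) L"
proof -
  have H': "has_hess_op m n f X (SOME H. has_hess_op m n f X H)" using H by (rule someI[where P = "has_hess_op m n f X"])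
  note D = DERIV_grad_line_op[OF _ gc X K L, of 0, unfolded add_smult_zero_mat[OF X K]]
  show ?thesis unfolding hess_def by (rule DERIV_unique[OF D[OF H'] D[OF H]])
qed

lemma hess_bilinear:
  assumes f: "twice_cont_diff m n f" and X: "X \<in> carrier_mat m n"
    and K: "K \<in> carrier_mat m n" and K': "K' \<in> carrier_mat m n" and L: "L \<in> carrier_mat m n"
  shows "hess m n f X (a \<cdot>\<^sub>m K + b \<cdot>\<^sub>m K') L = a * hess m n f X K L + b * hess m n f X K' L"
    and "hess m n f X L (a \<cdot>\<^sub>m K + b \<cdot>\<^sub>m K') = a * hess m n f X L K + b * hess m n f X L K'"
proof -
  define H where "H = (SOME H. has_hess_op m n f X H)"
  have "linear_on_mats m n H" using hess_op_ex[OF f X] by (simp add: H_def has_hess_op_def)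
  then have HK: "H K \<in> carrier_mat m n" "H K' \<in> carrier_mat m n" "H L \<in> carrier_mat m n"
    "H (a \<cdot>\<^sub>m K + b \<cdot>\<^sub>m K') = a \<cdot>\<^sub>m H K + b \<cdot>\<^sub>m H K'"
    using K K' L by (auto simp: linear_on_mats_def)
  show "hess m n f X (a \<cdot>\<^sub>m K + b \<cdot>\<^sub>m K') L = a * hess m n f X K L + b * hess m n f X K' L"
    using HK L by (simp add: hess_def H_def[symmetric] inner_linear)
  show "hess m n f X L (a \<cdot>\<^sub>m K + b \<cdot>\<^sub>m K') = a * hess m n f X L K + b * hess m n f X L K'"
    using HK K K' by (simp add: hess_def H_def[symmetric] inner_linear)
qed

lemma MVT_real:
  fixes \<phi> :: "real \<Rightarrow> real"
  assumes "a < b" "\<And>t. (\<phi> has_real_derivative \<phi>' t) (at t)"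
  obtains t where "a < t" "t < b" "\<phi> b - \<phi> a = (b - a) * \<phi>' t"
  using MVT2[OF assms(1), of \<phi> \<phi>'] assms(2) by blast

text \<open>Both mixed second derivatives are limits of the same second difference quotient.\<close>
lemma second_difference:
  assumes f: "twice_cont_diff m n f" and X: "X \<in> carrier_mat m n"
    and K: "K \<in> carrier_mat m n" and L: "L \<in> carrier_mat m n" and h: "h > 0"
  obtains s t where "0 < s" "s < h" "0 < t" "t < h"
    "f (X + h \<cdot>\<^sub>m K + h \<cdot>\<^sub>m L) - f (X + h \<cdot>\<^sub>m K) - f (X + h \<cdot>\<^sub>m L) + f X
      = h * h * hess m n f (X + s \<cdot>\<^sub>m K + t \<cdot>\<^sub>m L) L K"
proof -
  let ?g = "grad m n f"
  have comm: "X + h \<cdot>\<^sub>m L + s \<cdot>\<^sub>m K = X + s \<cdot>\<^sub>m K + h \<cdot>\<^sub>m L" for s h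
    using X K L by (intro eq_matI) auto
  \<comment> \<open>The mean value theorem is applied first to this difference in the direction K,
    then to the K-component of the gradient in the direction L.\<close>
  define \<psi> where "\<psi> s = f (X + h \<cdot>\<^sub>m L + s \<cdot>\<^sub>m K) - f (X + s \<cdot>\<^sub>m K)" for s
  have "(\<psi> has_real_derivative
      mat_inner (?g (X + h \<cdot>\<^sub>m L + s \<cdot>\<^sub>m K)) K - mat_inner (?g (X + s \<cdot>\<^sub>m K)) K) (at s)" for s
    unfolding \<psi>_def using X K L by (intro derivative_intros DERIV_line f) auto
  from MVT_real[OF h this] obtain s where s: "0 < s" "s < h" "\<psi> h - \<psi> 0 =
      (h - 0) * (mat_inner (?g (X + h \<cdot>\<^sub>m L + s \<cdot>\<^sub>m K)) K - mat_inner (?g (X + s \<cdot>\<^sub>m K)) K)" by blast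
  have Xs: "X + s \<cdot>\<^sub>m K \<in> carrier_mat m n" using X K by simp
  obtain t where t: "0 < t" "t < h"
    "mat_inner (?g (X + s \<cdot>\<^sub>m K + h \<cdot>\<^sub>m L)) K - mat_inner (?g (X + s \<cdot>\<^sub>m K + 0 \<cdot>\<^sub>m L)) K
      = (h - 0) * hess m n f (X + s \<cdot>\<^sub>m K + t \<cdot>\<^sub>m L) L K"
    using MVT_real[OF h DERIV_grad_line[OF f Xs L K]] by blast
  have "\<psi> h - \<psi> 0 = h * h * hess m n f (X + s \<cdot>\<^sub>m K + t \<cdot>\<^sub>m L) L K"
    using s(3) t(3) by (simp add: comm add_smult_zero_mat[OF Xs L])
  moreover have "\<psi> h - \<psi> 0 = f (X + h \<cdot>\<^sub>m K + h \<cdot>\<^sub>m L) - f (X + h \<cdot>\<^sub>m K) - f (X + h \<cdot>\<^sub>m L) + f X"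
    using X K L add_smult_zero_mat[OF X K] add_smult_zero_mat[of "X + h \<cdot>\<^sub>m L" m n K]
    by (simp add: \<psi>_def comm)
  ultimately show ?thesis using that s(1,2) t(1,2) by simp
qed

text \<open>\<open>hess\<close> is the derivative of the gradient, so symmetry has to come from
  continuity: exchanging K and L leaves the second difference unchanged, and the intermediate points
  of both expressions tend to X. Polarization of the isometry property rests on this.\<close>

lemma hess_symmetric:
  assumes f: "twice_cont_diff m n f" and X: "X \<in> carrier_mat m n"
    and K: "K \<in> carrier_mat m n" and L: "L \<in> carrier_mat m n"
  shows "hess m n f X K L = hess m n f X L K"
proof -
  have "\<bar>hess m n f X K L - hess m n f X L K\<bar> \<le> e" if e: "e > 0" for e
  proof -
    have cont: "\<exists>d>0. \<forall>Y\<in>carrier_mat m n. frob_norm (Y - X) < d \<longrightarrow>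
        \<bar>hess m n f Y A B - hess m n f X A B\<bar> < e / 2"
      if "A \<in> carrier_mat m n" "B \<in> carrier_mat m n" for A B
      using f[unfolded twice_cont_diff_def, THEN conjunct2, THEN conjunct2] X e that half_gt_zero by blast
    obtain d1 where d1: "d1 > 0" "\<And>Y. Y \<in> carrier_mat m n \<Longrightarrow> frob_norm (Y - X) < d1 \<Longrightarrow>
        \<bar>hess m n f Y K L - hess m n f X K L\<bar> < e / 2" using cont[OF K L] by blast
    obtain d2 where d2: "d2 > 0" "\<And>Y. Y \<in> carrier_mat m n \<Longrightarrow> frob_norm (Y - X) < d2 \<Longrightarrow>
        \<bar>hess m n f Y L K - hess m n f X L K\<bar> < e / 2" using cont[OF L K] by blast
    \<comment> \<open>With h = min d1 d2 / c all intermediate points are within d1 and d2 of X; the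
      summand 1 keeps c positive and the estimate strict.\<close>
    define c where "c = frob_norm K + frob_norm L + 1"
    have c: "c > 0" by (simp add: c_def add_nonneg_pos)
    define h where "h = min d1 d2 / c"
    have h: "h > 0" using c d1 d2 by (simp add: h_def)
    have hc: "h * c \<le> d1" "h * c \<le> d2" using c by (auto simp: h_def)
    have near: "frob_norm (X + s \<cdot>\<^sub>m A + t \<cdot>\<^sub>m B - X) < h * c"
      if "0 < s" "s < h" "0 < t" "t < h" "A \<in> carrier_mat m n" "B \<in> carrier_mat m n"
        "frob_norm A + frob_norm B = frob_norm K + frob_norm L" for s t A B
    proof -
      have "X + s \<cdot>\<^sub>m A + t \<cdot>\<^sub>m B - X = s \<cdot>\<^sub>m A + t \<cdot>\<^sub>m B"
        using that X by (intro eq_matI) auto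
      then have "frob_norm (X + s \<cdot>\<^sub>m A + t \<cdot>\<^sub>m B - X) \<le> s * frob_norm A + t * frob_norm B"
        using norm_triangle[of "s \<cdot>\<^sub>m A" "t \<cdot>\<^sub>m B"] that by simp
      also have "\<dots> \<le> h * frob_norm A + h * frob_norm B"
        using that by (intro add_mono mult_right_mono) auto
      also have "\<dots> = h * (frob_norm K + frob_norm L)"
        using that by (simp add: distrib_left[symmetric])
      also have "\<dots> < h * c" using h by (simp add: c_def)
      finally show ?thesis .
    qed
    obtain s t where st: "0 < s" "s < h" "0 < t" "t < h"
      "f (X + h \<cdot>\<^sub>m K + h \<cdot>\<^sub>m L) - f (X + h \<cdot>\<^sub>m K) - f (X + h \<cdot>\<^sub>m L) + f X
        = h * h * hess m n f (X + s \<cdot>\<^sub>m K + t \<cdot>\<^sub>m L) L K"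
      using second_difference[OF f X K L h] by blast
    obtain s' t' where st': "0 < s'" "s' < h" "0 < t'" "t' < h"
      "f (X + h \<cdot>\<^sub>m L + h \<cdot>\<^sub>m K) - f (X + h \<cdot>\<^sub>m L) - f (X + h \<cdot>\<^sub>m K) + f X
        = h * h * hess m n f (X + s' \<cdot>\<^sub>m L + t' \<cdot>\<^sub>m K) K L"
      using second_difference[OF f X L K h] by blast
    have "X + h \<cdot>\<^sub>m L + h \<cdot>\<^sub>m K = X + h \<cdot>\<^sub>m K + h \<cdot>\<^sub>m L" using X K L by (intro eq_matI) auto
    with st(5) st'(5) h have eq: "hess m n f (X + s \<cdot>\<^sub>m K + t \<cdot>\<^sub>m L) L K = hess m n f (X + s' \<cdot>\<^sub>m L + t' \<cdot>\<^sub>m K) K L"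
      by (auto simp: algebra_simps)
    have "\<bar>hess m n f (X + s \<cdot>\<^sub>m K + t \<cdot>\<^sub>m L) L K - hess m n f X L K\<bar> < e / 2"
      using near[OF st(1-4) K L] hc X K L by (intro d2) auto
    moreover have "\<bar>hess m n f (X + s' \<cdot>\<^sub>m L + t' \<cdot>\<^sub>m K) K L - hess m n f X K L\<bar> < e / 2"
      using near[OF st'(1-4) L K] hc X K L by (intro d1) auto
    ultimately show ?thesis using eq by linarith
  qed
  then have "\<bar>hess m n f X K L - hess m n f X L K\<bar> \<le> 0" by (rule field_le_epsilon) simp
  then show ?thesis by simp
qed

subsection \<open>The factored objective\<close>

text \<open>R(K) = o(|K|), separated from \<open>has_grad\<close> and \<open>has_hess_op\<close> so
  that the chain and product rules reduce to closure properties of such remainders.\<close>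

definition small_remainder :: "nat \<Rightarrow> nat \<Rightarrow> (real mat \<Rightarrow> real) \<Rightarrow> bool" where
  "small_remainder m n R \<longleftrightarrow>
     (\<forall>\<epsilon>>0. \<exists>d>0. \<forall>K\<in>carrier_mat m n. frob_norm K < d \<longrightarrow> \<bar>R K\<bar> \<le> \<epsilon> * frob_norm K)"

lemma has_grad_iff:
  "has_grad m n f X G \<longleftrightarrow> G \<in> carrier_mat m n \<and>
     small_remainder m n (\<lambda>K. f (X + K) - f X - mat_inner G K)"
  by (simp add: has_grad_def small_remainder_def)

lemma has_hess_op_iff:
  "has_hess_op m n f X H \<longleftrightarrow> linear_on_mats m n H \<and>
     small_remainder m n (\<lambda>K. frob_norm (grad m n f (X + K) - grad m n f X - H K))"
  by (simp add: has_hess_op_def small_remainder_def)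

text \<open>The comparison is asked for on the unit ball only, so estimates may absorb higher powers
  of the norm into lower ones.\<close>

lemma small_remainder_mono:
  assumes R: "small_remainder m n R" and c: "c \<ge> 0"
    and le: "\<And>K. K \<in> carrier_mat m n \<Longrightarrow> frob_norm K < 1 \<Longrightarrow> \<bar>R' K\<bar> \<le> c * \<bar>R K\<bar>"
  shows "small_remainder m n R'"
  unfolding small_remainder_def
proof (intro allI impI)
  fix e :: real assume "e > 0"
  with c have "e / (c + 1) > 0" by simp
  with R obtain d where d: "d > 0" "\<And>K. K \<in> carrier_mat m n \<Longrightarrow> frob_norm K < d \<Longrightarrow> \<bar>R K\<bar> \<le> e / (c + 1) * frob_norm K"
    unfolding small_remainder_def by blast
  show "\<exists>d>0. \<forall>K\<in>carrier_mat m n. frob_norm K < d \<longrightarrow> \<bar>R' K\<bar> \<le> e * frob_norm K"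
  proof (intro exI[of _ "min d 1"] conjI ballI impI)
    show "min d 1 > 0" using d by simp
    fix K assume K: "K \<in> carrier_mat m n" "frob_norm K < min d 1"
    then have "\<bar>R' K\<bar> \<le> c * \<bar>R K\<bar>" by (intro le) auto
    also have "\<dots> \<le> c * (e / (c + 1) * frob_norm K)" using K c by (intro mult_left_mono d) auto
    also have "\<dots> = e * frob_norm K * (c / (c + 1))" by simp
    also have "\<dots> \<le> e * frob_norm K" using \<open>e > 0\<close> c by (intro mult_left_le) auto
    finally show "\<bar>R' K\<bar> \<le> e * frob_norm K" .
  qed
qed

lemma small_remainder_add:
  assumes "small_remainder m n R" "small_remainder m n R'"
  shows "small_remainder m n (\<lambda>K. R K + R' K)"
  unfolding small_remainder_def
proof (intro allI impI)
  fix e :: real assume "e > 0"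
  then have e2: "e / 2 > 0" by simp
  obtain d where d: "d > 0" "\<And>K. K \<in> carrier_mat m n \<Longrightarrow> frob_norm K < d \<Longrightarrow> \<bar>R K\<bar> \<le> e / 2 * frob_norm K"
    using assms(1) e2 unfolding small_remainder_def by blast
  obtain d' where d': "d' > 0" "\<And>K. K \<in> carrier_mat m n \<Longrightarrow> frob_norm K < d' \<Longrightarrow> \<bar>R' K\<bar> \<le> e / 2 * frob_norm K"
    using assms(2) e2 unfolding small_remainder_def by blast
  show "\<exists>d>0. \<forall>K\<in>carrier_mat m n. frob_norm K < d \<longrightarrow> \<bar>R K + R' K\<bar> \<le> e * frob_norm K"
  proof (intro exI[of _ "min d d'"] conjI ballI impI)
    show "min d d' > 0" using d d' by simp
    fix K assume "K \<in> carrier_mat m n" "frob_norm K < min d d'"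
    then show "\<bar>R K + R' K\<bar> \<le> e * frob_norm K" using d(2)[of K] d'(2)[of K] by auto
  qed
qed

lemma small_remainder_quadratic:
  assumes c: "c \<ge> 0"
    and le: "\<And>K. K \<in> carrier_mat m n \<Longrightarrow> frob_norm K < 1 \<Longrightarrow> \<bar>R K\<bar> \<le> c * (frob_norm K)\<^sup>2"
  shows "small_remainder m n R"
proof (rule small_remainder_mono[OF _ c])
  show "small_remainder m n (\<lambda>K. (frob_norm K)\<^sup>2)"
    unfolding small_remainder_def
  proof (intro allI impI exI conjI ballI)
    fix e :: real and K assume "frob_norm K < e"
    then show "\<bar>(frob_norm K)\<^sup>2\<bar> \<le> e * frob_norm K" by (simp add: power2_eq_square mult_right_mono)
  qed
qed (use le in auto)

lemma small_remainder_compose: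
  assumes R: "small_remainder m n R" and c: "c \<ge> 0"
    and carrier: "\<And>K. K \<in> carrier_mat p q \<Longrightarrow> \<psi> K \<in> carrier_mat m n"
    and le: "\<And>K. K \<in> carrier_mat p q \<Longrightarrow> frob_norm K < 1 \<Longrightarrow> frob_norm (\<psi> K) \<le> c * frob_norm K"
  shows "small_remainder p q (\<lambda>K. R (\<psi> K))"
  unfolding small_remainder_def
proof (intro allI impI)
  fix e :: real assume "e > 0"
  with c have "e / (c + 1) > 0" by simp
  with R obtain d where d: "d > 0" "\<And>K. K \<in> carrier_mat m n \<Longrightarrow> frob_norm K < d \<Longrightarrow> \<bar>R K\<bar> \<le> e / (c + 1) * frob_norm K"
    unfolding small_remainder_def by blast
  show "\<exists>d>0. \<forall>K\<in>carrier_mat p q. frob_norm K < d \<longrightarrow> \<bar>R (\<psi> K)\<bar> \<le> e * frob_norm K"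
  proof (intro exI[of _ "min (d / (c + 1)) 1"] conjI ballI impI)
    show "min (d / (c + 1)) 1 > 0" using d c by simp
    fix K assume K: "K \<in> carrier_mat p q" "frob_norm K < min (d / (c + 1)) 1"
    then have *: "frob_norm (\<psi> K) \<le> c * frob_norm K" by (intro le) auto
    also have "\<dots> \<le> (c + 1) * frob_norm K" by (intro mult_right_mono) auto
    finally have n1: "frob_norm (\<psi> K) \<le> (c + 1) * frob_norm K" .
    also have "\<dots> < d" using K c by (simp add: pos_less_divide_eq mult.commute)
    finally have "\<bar>R (\<psi> K)\<bar> \<le> e / (c + 1) * frob_norm (\<psi> K)" using K by (intro d carrier)
    also have "\<dots> \<le> e / (c + 1) * ((c + 1) * frob_norm K)"
      using \<open>e > 0\<close> c n1 by (intro mult_left_mono) auto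
    also have "\<dots> = e * frob_norm K" using c by simp
    finally show "\<bar>R (\<psi> K)\<bar> \<le> e * frob_norm K" .
  qed
qed

lemma linear_on_mats_bounded:
  assumes H: "linear_on_mats m n H"
  obtains c where "c \<ge> 0" "\<And>K. K \<in> carrier_mat m n \<Longrightarrow> frob_norm (H K) \<le> c * frob_norm K"
proof -
  define E :: "nat \<times> nat \<Rightarrow> real mat" where "E p = mat m n (\<lambda>q. if q = p then 1 else 0)" for p
  have E: "E p \<in> carrier_mat m n" for p by (simp add: E_def)
  \<comment> \<open>Induction on the set I of positions where K may be nonzero. The estimate is in
    terms of a common bound b of the entries, which survives the deletion of an entry.\<close>
  have "\<exists>c\<ge>0. \<forall>b. \<forall>K\<in>carrier_mat m n. (\<forall>i<m. \<forall>j<n. (i, j) \<notin> I \<longrightarrow> K $$ (i, j) = 0) \<longrightarrow>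
      (\<forall>i<m. \<forall>j<n. \<bar>K $$ (i, j)\<bar> \<le> b) \<longrightarrow> b \<ge> 0 \<longrightarrow> frob_norm (H K) \<le> c * b"
    if "finite I" "I \<subseteq> {..<m} \<times> {..<n}" for I
    using that
  proof (induction I)
    case empty
    have "H (0 \<cdot>\<^sub>m 0\<^sub>m m n) = 0 \<cdot>\<^sub>m H (0\<^sub>m m n)" 
      using H zero_carrier_mat unfolding linear_on_mats_def by blast
    moreover have "0 \<cdot>\<^sub>m 0\<^sub>m m n = (0\<^sub>m m n :: real mat)" by (intro eq_matI) auto
    ultimately have "frob_norm (H (0\<^sub>m m n)) = 0" by (metis abs_zero mult_zero_left norm_smult)
    moreover have "K = 0\<^sub>m m n" if "K \<in> carrier_mat m n" "\<forall>i<m. \<forall>j<n. K $$ (i, j) = 0" for K :: "real mat"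
      using that by (intro eq_matI) auto
    ultimately show ?case by (intro exI[of _ 0]) auto
  next
    case (insert p I)
    then obtain c where c: "c \<ge> 0" "\<And>b K. K \<in> carrier_mat m n \<Longrightarrow>
        (\<forall>i<m. \<forall>j<n. (i, j) \<notin> I \<longrightarrow> K $$ (i, j) = 0) \<Longrightarrow>
        (\<forall>i<m. \<forall>j<n. \<bar>K $$ (i, j)\<bar> \<le> b) \<Longrightarrow> b \<ge> 0 \<Longrightarrow> frob_norm (H K) \<le> c * b" by auto
    have p: "fst p < m" "snd p < n" using insert.prems by auto
    show ?case
    proof (intro exI[of _ "c + frob_norm (H (E p))"] conjI allI ballI impI)
      fix b :: real and K :: "real mat"
      assume K: "K \<in> carrier_mat m n" "\<forall>i<m. \<forall>j<n. (i, j) \<notin> insert p I \<longrightarrow> K $$ (i, j) = 0"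
        "\<forall>i<m. \<forall>j<n. \<bar>K $$ (i, j)\<bar> \<le> b" "b \<ge> 0"
      define K' where "K' = mat m n (\<lambda>q. if q = p then 0 else K $$ q)"
      have K': "K' \<in> carrier_mat m n" by (simp add: K'_def)
      have "K = K' + (K $$ p) \<cdot>\<^sub>m E p" using K(1) by (intro eq_matI) (auto simp: K'_def E_def)
      then have "H K = H K' + (K $$ p) \<cdot>\<^sub>m H (E p)"
        using H K' E[of p] by (metis linear_on_mats_def smult_carrier_mat)
      moreover have "H K' \<in> carrier_mat m n" "H (E p) \<in> carrier_mat m n"
        using H K' E by (auto simp: linear_on_mats_def)
      ultimately have "frob_norm (H K) \<le> frob_norm (H K') + \<bar>K $$ p\<bar> * frob_norm (H (E p))"
        using norm_triangle[of "H K'" "(K $$ p) \<cdot>\<^sub>m H (E p)"] by simp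
      also have "frob_norm (H K') \<le> c * b"
        using K K' by (intro c) (auto simp: K'_def)
      also have "\<bar>K $$ p\<bar> * frob_norm (H (E p)) \<le> b * frob_norm (H (E p))"
        using K(3) p by (intro mult_right_mono) (cases p; auto)+
      finally show "frob_norm (H K) \<le> (c + frob_norm (H (E p))) * b" by (simp add: algebra_simps)
    qed (use c in auto)
  qed
  from this[of "{..<m} \<times> {..<n}"] obtain c where c: "c \<ge> 0" "\<And>b K. K \<in> carrier_mat m n \<Longrightarrow>
      (\<forall>i<m. \<forall>j<n. \<bar>K $$ (i, j)\<bar> \<le> b) \<Longrightarrow> b \<ge> 0 \<Longrightarrow> frob_norm (H K) \<le> c * b" by auto
  show ?thesis
  proof (rule that[OF c(1)])
    fix K :: "real mat" assume K: "K \<in> carrier_mat m n"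
    have "\<bar>K $$ (i, j)\<bar> \<le> frob_norm K" if "i < m" "j < n" for i j
      using abs_entry_le_norm[of i K j] K that by simp
    then show "frob_norm (H K) \<le> c * frob_norm K" using K by (intro c) auto
  qed
qed

section \<open>The symmetrized product: derivative of U U^T in the direction V\<close>

definition outer_sym :: "real mat \<Rightarrow> real mat \<Rightarrow> real mat" where
  "outer_sym U V = U * V\<^sup>T + V * U\<^sup>T"

lemma outer_sym_carrier [simp]:
  "U \<in> carrier_mat n r \<Longrightarrow> V \<in> carrier_mat n r \<Longrightarrow> outer_sym U V \<in> carrier_mat n n"
  by (simp add: outer_sym_def)

lemma outer_sym_dim [simp]:
  "dim_row (outer_sym U V) = dim_row V" "dim_col (outer_sym U V) = dim_row U"
  by (simp_all add: outer_sym_def)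

lemma outer_sym_transpose:
  assumes "U \<in> carrier_mat n r" "V \<in> carrier_mat n r"
  shows "(outer_sym U V)\<^sup>T = outer_sym U V"
proof -
  have "(outer_sym U V)\<^sup>T = V * U\<^sup>T + U * V\<^sup>T"
    using assms by (simp add: outer_sym_def transpose_add[of _ n n] transpose_mult_dim)
  then show ?thesis using assms by (simp add: outer_sym_def comm_add_mat[of _ n n])
qed

lemma self_transpose_symmetric: "(V * V\<^sup>T)\<^sup>T = V * (V :: real mat)\<^sup>T"
  by (simp add: transpose_mult_dim)

lemma add_mult_self_transpose:
  assumes U: "U \<in> carrier_mat n r" and V: "V \<in> carrier_mat n r"
  shows "(U + V) * (U + V)\<^sup>T = U * U\<^sup>T + (outer_sym U V + V * V\<^sup>T)"
proof -
  have "(U + V) * (U + V)\<^sup>T = U * U\<^sup>T + U * V\<^sup>T + (V * U\<^sup>T + V * V\<^sup>T)"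
    using U V by (simp add: transpose_add[of _ n r] add_mult_distrib_mat[of _ n r _ _ n]
        mult_add_distrib_mat[of _ n r _ n])
      (intro eq_matI; auto)
  then show ?thesis using U V unfolding outer_sym_def by (auto intro!: eq_matI)
qed

text \<open>On symmetric A the map A to 2 A U is adjoint to the derivative of U U^T; this is the
  source of the gradient 2 G U.\<close>

lemma inner_sym_outer:
  assumes A: "A \<in> carrier_mat n n" and sym: "A\<^sup>T = A" and U: "U \<in> carrier_mat n r" and V: "V \<in> carrier_mat n r"
  shows "mat_inner A (outer_sym U V) = mat_inner (2 \<cdot>\<^sub>m (A * U)) V"
proof -
  have 1: "mat_inner (V * U\<^sup>T) A = mat_inner V (A * U)"
    using A U V by (subst inner_mult_right) auto
  have 2: "mat_inner (U * V\<^sup>T) A = mat_inner V (A * U)"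
    using inner_transpose[of "V * U\<^sup>T" A] A U V 1 sym by (simp add: transpose_mult_dim)
  have "mat_inner A (outer_sym U V) = mat_inner (outer_sym U V) A"
    using A U V by (intro inner_commute) auto
  also have "\<dots> = 2 * mat_inner V (A * U)"
    unfolding outer_sym_def using 1 2 A U V by (simp add: inner_add_left)
  also have "mat_inner V (A * U) = mat_inner (A * U) V"
    using A U V by (intro inner_commute) auto
  finally show ?thesis using A U V by (simp add: inner_smult_left)
qed

lemma norm_outer_sym:
  assumes "U \<in> carrier_mat n r" "V \<in> carrier_mat n r"
  shows "frob_norm (outer_sym U V) \<le> 2 * frob_norm U * frob_norm V"
  using norm_triangle[of "U * V\<^sup>T" "V * U\<^sup>T"] norm_mult[of U "V\<^sup>T"] norm_mult[of V "U\<^sup>T"] assms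
  by (simp add: outer_sym_def algebra_simps)

lemma norm_self_transpose: "frob_norm (V * V\<^sup>T) \<le> (frob_norm V)\<^sup>2"
  using norm_mult[of V "V\<^sup>T"] by (simp add: power2_eq_square)

lemma norm_outer_increment:
  assumes U: "U \<in> carrier_mat n r" and V: "V \<in> carrier_mat n r" and V1: "frob_norm V < 1"
  shows "frob_norm (outer_sym U V + V * V\<^sup>T) \<le> (2 * frob_norm U + 1) * frob_norm V"
proof -
  have "frob_norm (outer_sym U V + V * V\<^sup>T) \<le> frob_norm (outer_sym U V) + frob_norm (V * V\<^sup>T)"
    using U V by (intro norm_triangle) auto
  also have "\<dots> \<le> 2 * frob_norm U * frob_norm V + (frob_norm V)\<^sup>2"
    using norm_outer_sym[OF U V] norm_self_transpose[of V] by linarith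
  also have "(frob_norm V)\<^sup>2 \<le> frob_norm V"
    using V1 by (simp add: power2_eq_square mult_left_le)
  finally show ?thesis by (simp add: algebra_simps)
qed

section \<open>Gradient and Hessian of the factored objective\<close>

context
  fixes n r :: nat and f :: "real mat \<Rightarrow> real"
  assumes adm: "admissible_objective n f"
begin

lemma adm_tcd: "twice_cont_diff n n f"
  using adm by (simp add: admissible_objective_def)

lemma grad_symmetric:
  assumes "M \<in> carrier_mat n n" "M\<^sup>T = M"
  shows "(grad n n f M)\<^sup>T = grad n n f M"
  using adm assms by (simp add: admissible_objective_def symmetric_matrix_def)

lemma has_grad_factored:
  assumes U: "U \<in> carrier_mat n r"
  shows "has_grad n r (factored f) U (2 \<cdot>\<^sub>m (grad n n f (U * U\<^sup>T) * U))"
proof -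
  define G where "G = grad n n f (U * U\<^sup>T)"
  have M: "U * U\<^sup>T \<in> carrier_mat n n" using U by simp
  have G: "G \<in> carrier_mat n n" unfolding G_def by (rule grad_carrier[OF adm_tcd M])
  have Gs: "G\<^sup>T = G" unfolding G_def by (rule grad_symmetric[OF M self_transpose_symmetric])
  define \<psi> where "\<psi> V = outer_sym U V + V * V\<^sup>T" for V
  define R where "R K = f (U * U\<^sup>T + K) - f (U * U\<^sup>T) - mat_inner G K" for K
  have R: "small_remainder n n R"
    using has_grad_grad[OF adm_tcd M] unfolding has_grad_iff R_def G_def by blast
  \<comment> \<open>The remainder of f along the increment of U U^T, plus the second-order part of
    that increment paired with G.\<close>
  have "small_remainder n r (\<lambda>V. R (\<psi> V) + mat_inner G (V * V\<^sup>T))"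
  proof (rule small_remainder_add)
    show "small_remainder n r (\<lambda>V. R (\<psi> V))"
      using norm_outer_increment[OF U] U
      by (intro small_remainder_compose[OF R, of "2 * frob_norm U + 1"]) (auto simp: \<psi>_def)
    show "small_remainder n r (\<lambda>V. mat_inner G (V * V\<^sup>T))"
    proof (rule small_remainder_quadratic)
      fix V :: "real mat" assume V: "V \<in> carrier_mat n r"
      have "\<bar>mat_inner G (V * V\<^sup>T)\<bar> \<le> frob_norm G * frob_norm (V * V\<^sup>T)"
        using V G by (intro inner_Cauchy_Schwarz) auto
      also have "\<dots> \<le> frob_norm G * (frob_norm V)\<^sup>2" by (intro mult_left_mono norm_self_transpose) simp
      finally show "\<bar>mat_inner G (V * V\<^sup>T)\<bar> \<le> frob_norm G * (frob_norm V)\<^sup>2" .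
    qed simp
  qed
  then have "small_remainder n r (\<lambda>V. factored f (U + V) - factored f U - mat_inner (2 \<cdot>\<^sub>m (G * U)) V)"
  proof (rule small_remainder_mono[of _ _ _ 1])
    fix V :: "real mat" assume V: "V \<in> carrier_mat n r"
    have "mat_inner G (\<psi> V) = mat_inner (2 \<cdot>\<^sub>m (G * U)) V + mat_inner G (V * V\<^sup>T)"
      unfolding \<psi>_def using inner_sym_outer[OF G Gs U V] U V G by (simp add: inner_add_right)
    then have "R (\<psi> V) + mat_inner G (V * V\<^sup>T) = factored f (U + V) - factored f U - mat_inner (2 \<cdot>\<^sub>m (G * U)) V"
      by (simp add: R_def factored_def add_mult_self_transpose[OF U V] \<psi>_def)
    then show "\<bar>factored f (U + V) - factored f U - mat_inner (2 \<cdot>\<^sub>m (G * U)) V\<bar>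
        \<le> 1 * \<bar>R (\<psi> V) + mat_inner G (V * V\<^sup>T)\<bar>" by simp
  qed simp
  then show ?thesis using G U by (simp add: has_grad_iff G_def)
qed

lemma grad_factored:
  "U \<in> carrier_mat n r \<Longrightarrow> grad n r (factored f) U = 2 \<cdot>\<^sub>m (grad n n f (U * U\<^sup>T) * U)"
  by (rule grad_eqI[OF has_grad_factored])

text \<open>Product rule for the gradient 2 (grad f)(U U^T) U: the first factor varies through H
  along \<open>outer_sym U V\<close>, the second one through V.\<close>

lemma has_hess_op_factored:
  assumes U: "U \<in> carrier_mat n r" and H: "has_hess_op n n f (U * U\<^sup>T) H"
  shows "has_hess_op n r (factored f) U
    (\<lambda>V. 2 \<cdot>\<^sub>m (H (outer_sym U V) * U + grad n n f (U * U\<^sup>T) * V))"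
proof -
  define M where "M = U * U\<^sup>T"
  define G where "G = grad n n f M"
  have M: "M \<in> carrier_mat n n" using U by (simp add: M_def)
  have G: "G \<in> carrier_mat n n" unfolding G_def by (rule grad_carrier[OF adm_tcd M])
  have lin: "linear_on_mats n n H" using H by (simp add: has_hess_op_def)
  have Hc: "H A \<in> carrier_mat n n" and Hadd: "H (A + B) = H A + H B" and Hsm: "H (c \<cdot>\<^sub>m A) = c \<cdot>\<^sub>m H A"
    if "A \<in> carrier_mat n n" "B \<in> carrier_mat n n" for A B :: "real mat" and c
    using lin that by (auto simp: linear_on_mats_def)
  obtain c where c: "c \<ge> 0" "\<And>K. K \<in> carrier_mat n n \<Longrightarrow> frob_norm (H K) \<le> c * frob_norm K"
    using linear_on_mats_bounded[OF lin] by blast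
  define T where "T V = 2 \<cdot>\<^sub>m (H (outer_sym U V) * U + G * V)" for V
  have osd: "outer_sym U (A + B) = outer_sym U A + outer_sym U B"
    if "A \<in> carrier_mat n r" "B \<in> carrier_mat n r" for A B :: "real mat"
  proof -
    have "outer_sym U (A + B) = U * A\<^sup>T + U * B\<^sup>T + (A * U\<^sup>T + B * U\<^sup>T)"
      using U that by (simp add: outer_sym_def transpose_add[of _ n r] add_mult_distrib_mat[of _ n r _ _ n]
          mult_add_distrib_mat[of _ n r _ n])
    then show ?thesis using U that unfolding outer_sym_def by (auto intro!: eq_matI)
  qed
  have oss: "outer_sym U (a \<cdot>\<^sub>m A) = a \<cdot>\<^sub>m outer_sym U A" if "A \<in> carrier_mat n r" for A :: "real mat" and a
  proof -
    have "(a \<cdot>\<^sub>m A)\<^sup>T = a \<cdot>\<^sub>m A\<^sup>T" by (intro eq_matI) auto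
    then show ?thesis
      using U that by (simp add: outer_sym_def mult_smult_distrib[of _ n r _ n]
          mult_smult_assoc_mat[of _ n r _ n] add_smult_distrib_left_mat[of _ n n])
  qed
  have "linear_on_mats n r T"
    unfolding linear_on_mats_def
  proof (intro conjI ballI allI)
    fix A :: "real mat" assume A: "A \<in> carrier_mat n r"
    then have OA: "outer_sym U A \<in> carrier_mat n n" using U by simp
    show "T A \<in> carrier_mat n r" using A U G Hc[OF OA OA] by (simp add: T_def)
    show "T (a \<cdot>\<^sub>m A) = a \<cdot>\<^sub>m T A" for a
    proof -
      have "T (a \<cdot>\<^sub>m A) = 2 \<cdot>\<^sub>m (a \<cdot>\<^sub>m (H (outer_sym U A) * U) + a \<cdot>\<^sub>m (G * A))"
        using A U G Hc[OF OA OA]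
        by (simp add: T_def oss Hsm[OF OA OA] mult_smult_distrib[of _ n n _ r] mult_smult_assoc_mat[of _ n n _ r])
      also have "\<dots> = a \<cdot>\<^sub>m T A"
        using A U G Hc[OF OA OA] unfolding T_def by (intro eq_matI) (auto simp: algebra_simps)
      finally show ?thesis .
    qed
  next
    fix A B :: "real mat" assume A: "A \<in> carrier_mat n r" and B: "B \<in> carrier_mat n r"
    then have OA: "outer_sym U A \<in> carrier_mat n n" and OB: "outer_sym U B \<in> carrier_mat n n" using U by auto
    have "T (A + B) = 2 \<cdot>\<^sub>m ((H (outer_sym U A) * U + H (outer_sym U B) * U) + (G * A + G * B))"
      using A B U G Hc[OF OA OB] Hc[OF OB OA]
      by (simp add: T_def osd Hadd[OF OA OB] mult_add_distrib_mat[of _ n n _ r] add_mult_distrib_mat[of _ n n _ _ r])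
    also have "\<dots> = T A + T B"
      using A B U G Hc[OF OA OB] Hc[OF OB OA] unfolding T_def by (intro eq_matI) (auto simp: algebra_simps)
    finally show "T (A + B) = T A + T B" .
  qed
  moreover have "small_remainder n r
      (\<lambda>V. frob_norm (grad n r (factored f) (U + V) - grad n r (factored f) U - T V))"
  proof -
    define \<psi> where "\<psi> V = outer_sym U V + V * V\<^sup>T" for V
    have \<psi>: "\<psi> V \<in> carrier_mat n n" if "V \<in> carrier_mat n r" for V using U that by (simp add: \<psi>_def)
    define P where "P K = grad n n f (M + K) - G - H K" for K
    have P: "P K \<in> carrier_mat n n" if "K \<in> carrier_mat n n" for K
      using Hc[OF that that] by (simp add: P_def minus_carrier_mat)
    have smallP: "small_remainder n n (\<lambda>K. frob_norm (P K))"
      using H unfolding has_hess_op_iff P_def G_def M_def by blast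
    \<comment> \<open>Collects the terms quadratic in V: 2 |U| comes from \<open>H O1 * V\<close>,
      and |U| + 1 from \<open>H VV * (U + V)\<close>.\<close>
    define Q where "Q V = 2 * c * (3 * frob_norm U + 1) * (frob_norm V)\<^sup>2" for V :: "real mat"
    have "small_remainder n r (\<lambda>V. 2 * (frob_norm U + 1) * frob_norm (P (\<psi> V)) + Q V)"
    proof (rule small_remainder_add)
      have "small_remainder n r (\<lambda>V. frob_norm (P (\<psi> V)))"
        using norm_outer_increment[OF U] U
        by (intro small_remainder_compose[OF smallP, of "2 * frob_norm U + 1"]) (auto simp: \<psi>_def)
      then show "small_remainder n r (\<lambda>V. 2 * (frob_norm U + 1) * frob_norm (P (\<psi> V)))"
        by (rule small_remainder_mono[of _ _ _ "2 * (frob_norm U + 1)"]) (auto simp: abs_mult)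
      show "small_remainder n r Q"
        using c by (intro small_remainder_quadratic[of "2 * c * (3 * frob_norm U + 1)"]) (auto simp: Q_def)
    qed
    then show ?thesis
    proof (rule small_remainder_mono[of _ _ _ 1])
      fix V :: "real mat" assume V: "V \<in> carrier_mat n r" and V1: "frob_norm V < 1"
      define O1 where "O1 = outer_sym U V"
      define VV where "VV = V * V\<^sup>T"
      have O1: "O1 \<in> carrier_mat n n" "VV \<in> carrier_mat n n" using U V by (auto simp: O1_def VV_def)
      note HO = Hc[OF O1(1) O1(1)] and HV = Hc[OF O1(2) O1(2)]
      have UV: "U + V \<in> carrier_mat n r" using U V by simp
      have \<psi>V: "\<psi> V = O1 + VV" by (simp add: \<psi>_def O1_def VV_def)
      define B where "B = P (\<psi> V)"
      have B: "B \<in> carrier_mat n n" unfolding B_def by (rule P[OF \<psi>[OF V]])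
      define G1 where "G1 = grad n n f (M + \<psi> V)"
      have G1: "G1 \<in> carrier_mat n n"
        unfolding G1_def using M \<psi>[OF V] by (intro grad_carrier[OF adm_tcd]) auto
      have Beq: "B = G1 - G - (H O1 + H VV)"
        by (simp add: B_def P_def G1_def \<psi>V Hadd[OF O1])
      have G1eq: "G1 = B + G + H O1 + H VV"
        unfolding Beq using G G1 HO HV by (intro eq_matI) auto
      have e1: "G1 * (U + V) = B * (U + V) + (G * U + G * V) + (H O1 * U + H O1 * V) + H VV * (U + V)"
        unfolding G1eq using B G HO HV U V
        by (simp add: add_mult_distrib_mat[of _ n n _ _ r] mult_add_distrib_mat[of _ n n _ r])
          (intro eq_matI; auto)
      have gU: "grad n r (factored f) U = 2 \<cdot>\<^sub>m (G * U)"
        using grad_factored[OF U] by (simp add: G_def M_def)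
      have gUV: "grad n r (factored f) (U + V) = 2 \<cdot>\<^sub>m (G1 * (U + V))"
        using grad_factored[OF UV] by (simp add: G1_def add_mult_self_transpose[OF U V] M_def \<psi>_def)
      have "grad n r (factored f) (U + V) - grad n r (factored f) U - T V
          = 2 \<cdot>\<^sub>m (B * (U + V) + (H O1 * V + H VV * (U + V)))"
        unfolding gU gUV e1 T_def O1_def[symmetric]
        using B G HO HV U V by (intro eq_matI) (auto simp: algebra_simps)
      then have "frob_norm (grad n r (factored f) (U + V) - grad n r (factored f) U - T V)
          = 2 * frob_norm (B * (U + V) + (H O1 * V + H VV * (U + V)))" by simp
      also have "\<dots> \<le> 2 * (frob_norm (B * (U + V)) + (frob_norm (H O1 * V) + frob_norm (H VV * (U + V))))"
        using norm_triangle[of "B * (U + V)" "H O1 * V + H VV * (U + V)"]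
          norm_triangle[of "H O1 * V" "H VV * (U + V)"] B HO HV U V by simp
      also have "\<dots> \<le> 2 * (frob_norm B * (frob_norm U + 1) + (c * (2 * frob_norm U * frob_norm V) * frob_norm V
          + c * (frob_norm V)\<^sup>2 * (frob_norm U + 1)))"
      proof -
        have nUV: "frob_norm (U + V) \<le> frob_norm U + 1"
          using norm_triangle[of U V] U V V1 by simp
        have "frob_norm (B * (U + V)) \<le> frob_norm B * frob_norm (U + V)"
          using B U V by (intro norm_mult) auto
        also have "\<dots> \<le> frob_norm B * (frob_norm U + 1)" using nUV by (intro mult_left_mono) auto
        finally have 1: "frob_norm (B * (U + V)) \<le> frob_norm B * (frob_norm U + 1)" .
        have "frob_norm (H O1 * V) \<le> frob_norm (H O1) * frob_norm V"
          using HO V by (intro norm_mult) auto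
        also have "\<dots> \<le> c * frob_norm O1 * frob_norm V" using c O1 by (intro mult_right_mono) auto
        also have "\<dots> \<le> c * (2 * frob_norm U * frob_norm V) * frob_norm V"
          using norm_outer_sym[OF U V] c unfolding O1_def by (intro mult_right_mono mult_left_mono) auto
        finally have 2: "frob_norm (H O1 * V) \<le> c * (2 * frob_norm U * frob_norm V) * frob_norm V" .
        have "frob_norm (H VV * (U + V)) \<le> frob_norm (H VV) * frob_norm (U + V)"
          using HV U V by (intro norm_mult) auto
        also have "\<dots> \<le> (c * (frob_norm V)\<^sup>2) * (frob_norm U + 1)"
        proof (intro mult_mono nUV)
          have "frob_norm (H VV) \<le> c * frob_norm VV" using c O1 by simp
          also have "\<dots> \<le> c * (frob_norm V)\<^sup>2"
            using c norm_self_transpose[of V] unfolding VV_def by (intro mult_left_mono) auto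
          finally show "frob_norm (H VV) \<le> c * (frob_norm V)\<^sup>2" .
        qed (use c in auto)
        finally have 3: "frob_norm (H VV * (U + V)) \<le> c * (frob_norm V)\<^sup>2 * (frob_norm U + 1)" .
        show ?thesis by (intro mult_left_mono add_mono 1 2 3) auto
      qed
      also have "\<dots> = 2 * (frob_norm U + 1) * frob_norm B + Q V"
        by (simp add: Q_def algebra_simps power2_eq_square)
      finally show "\<bar>frob_norm (grad n r (factored f) (U + V) - grad n r (factored f) U - T V)\<bar>
          \<le> 1 * \<bar>2 * (frob_norm U + 1) * frob_norm (P (\<psi> V)) + Q V\<bar>" by (simp add: B_def)
    qed simp
  qed
  ultimately show ?thesis by (simp add: has_hess_op_iff T_def[abs_def] G_def M_def)
qed

lemma hess_factored:
  assumes U: "U \<in> carrier_mat n r" and V: "V \<in> carrier_mat n r"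
  shows "hess n r (factored f) U V V
    = hess n n f (U * U\<^sup>T) (outer_sym U V) (outer_sym U V)
      + 2 * mat_inner (grad n n f (U * U\<^sup>T)) (V * V\<^sup>T)"
proof -
  let ?M = "U * U\<^sup>T"
  define H where "H = (SOME H. has_hess_op n n f ?M H)"
  define G where "G = grad n n f ?M"
  define S where "S = outer_sym U V"
  have M: "?M \<in> carrier_mat n n" using U by simp
  have S: "S \<in> carrier_mat n n" using U V by (simp add: S_def)
  have St: "S\<^sup>T = S" unfolding S_def by (rule outer_sym_transpose[OF U V])
  have H: "has_hess_op n n f ?M H" unfolding H_def by (rule hess_op_ex[OF adm_tcd M])
  have HS: "H S \<in> carrier_mat n n" using H S by (simp add: has_hess_op_def linear_on_mats_def)
  have G: "G \<in> carrier_mat n n" unfolding G_def by (rule grad_carrier[OF adm_tcd M])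
  have "grad n r (factored f) X \<in> carrier_mat n r" if "X \<in> carrier_mat n r" for X
    using has_grad_factored[OF that] grad_factored[OF that] by (simp add: has_grad_def)
  from hess_eqI[OF this U has_hess_op_factored[OF U H] V V]
  have "hess n r (factored f) U V V = 2 * (mat_inner (H S * U) V + mat_inner (G * V) V)"
    using HS G U V by (simp add: G_def[symmetric] S_def[symmetric] inner_smult_left inner_add_left)
  moreover have "mat_inner (G * V) V = mat_inner G (V * V\<^sup>T)"
    using G V by (subst inner_mult_right) auto
  moreover have "2 * mat_inner (H S * U) V = mat_inner (H S) S"
  proof -
    \<comment> \<open>Along the line M + t S all arguments are symmetric, hence so are the
      gradients, and their derivative H S inherits this. Symmetry of H S then turns the pairing of H
      S * U with V into a pairing with S.\<close>
    have HSt: "(H S)\<^sup>T = H S"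
    proof (rule eq_matI)
      have *: "mat_inner (H S) L = mat_inner (H S) L\<^sup>T" if L: "L \<in> carrier_mat n n" for L
      proof -
        have eq: "mat_inner (grad n n f (?M + t \<cdot>\<^sub>m S)) L = mat_inner (grad n n f (?M + t \<cdot>\<^sub>m S)) L\<^sup>T" for t
        proof -
          have MS: "?M + t \<cdot>\<^sub>m S \<in> carrier_mat n n" using M S by simp
          have "(t \<cdot>\<^sub>m S)\<^sup>T = t \<cdot>\<^sub>m S\<^sup>T" by (intro eq_matI) auto
          then have "(?M + t \<cdot>\<^sub>m S)\<^sup>T = ?M + t \<cdot>\<^sub>m S"
            using M S by (simp add: transpose_add[of _ n n] self_transpose_symmetric St)
          then show ?thesis
            using inner_transpose[of "grad n n f (?M + t \<cdot>\<^sub>m S)" L] grad_symmetric[OF MS] grad_carrier[OF adm_tcd MS] L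
            by simp
        qed
        have LT: "L\<^sup>T \<in> carrier_mat n n" using L by simp
        have H0: "has_hess_op n n f (?M + 0 \<cdot>\<^sub>m S) H" using H by (simp add: add_smult_zero_mat[OF M S])
        show ?thesis
          using DERIV_grad_line_op[OF H0 grad_carrier[OF adm_tcd] M S L]
            DERIV_grad_line_op[OF H0 grad_carrier[OF adm_tcd] M S LT]
          unfolding eq[symmetric] by (rule DERIV_unique)
      qed
      fix i j assume "i < dim_row (H S)" "j < dim_col (H S)"
      then have ij: "i < n" "j < n" using HS by auto
      define L :: "real mat" where "L = mat n n (\<lambda>q. if q = (i, j) then 1 else 0)"
      have L: "L \<in> carrier_mat n n" by (simp add: L_def)
      have "mat_inner (H S) L = (\<Sum>b<n. \<Sum>a<n. if a = i then (if b = j then H S $$ (i, j) else 0) else 0)"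
        unfolding mat_inner_eq_sum[OF HS L] by (intro sum.cong refl) (auto simp: L_def)
      also have "\<dots> = H S $$ (i, j)" using ij by (simp add: sum.delta)
      finally have 1: "mat_inner (H S) L = H S $$ (i, j)" .
      have LT: "L\<^sup>T \<in> carrier_mat n n" by (simp add: L_def)
      have "mat_inner (H S) L\<^sup>T = (\<Sum>b<n. \<Sum>a<n. if a = j then (if b = i then H S $$ (j, i) else 0) else 0)"
        unfolding mat_inner_eq_sum[OF HS LT] by (intro sum.cong refl) (auto simp: L_def)
      also have "\<dots> = H S $$ (j, i)" using ij by (simp add: sum.delta)
      finally show "(H S)\<^sup>T $$ (i, j) = H S $$ (i, j)" using 1 *[OF L] ij HS by simp
    qed (use HS in auto)
    show ?thesis
      using inner_sym_outer[OF HS HSt U V] HS U V by (simp add: S_def[symmetric] inner_smult_left)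
  qed
  ultimately show ?thesis by (simp add: hess_def H_def[symmetric] S_def[symmetric] G_def[symmetric])
qed

end

subsection \<open>Critical points and the ground truth\<close>

text \<open>Weighted polarization: the error e between second derivative and inner product is
  evaluated at b K + a L and b K - a L, where a = |K| and b = |L| equalize the two summands.
  Subtracting isolates \<open>e K L\<close>, and the inner product terms of the two bounds
  cancel.\<close>

lemma RIP_bilinear:
  assumes f: "twice_cont_diff n n f" and rip: "RIP n p q \<delta> f"
    and M: "M \<in> carrier_mat n n" "mat_rank n M \<le> p"
    and K: "K \<in> carrier_mat n n" and L: "L \<in> carrier_mat n n"
    and rank: "\<And>x y. mat_rank n (x \<cdot>\<^sub>m K + y \<cdot>\<^sub>m L) \<le> q"
  shows "\<bar>hess n n f M K L - mat_inner K L\<bar> \<le> \<delta> * frob_norm K * frob_norm L"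
proof -
  let ?h = "hess n n f M"
  define e where "e A B = ?h A B - mat_inner A B" for A B
  have d: "0 \<le> \<delta>" using rip by (simp add: RIP_def)
  have bound: "\<bar>x\<^sup>2 * e K K + 2 * x * y * e K L + y\<^sup>2 * e L L\<bar>
      \<le> \<delta> * (x\<^sup>2 * mat_inner K K + 2 * x * y * mat_inner K L + y\<^sup>2 * mat_inner L L)" for x y
  proof -
    let ?A = "x \<cdot>\<^sub>m K + y \<cdot>\<^sub>m L"
    have A: "?A \<in> carrier_mat n n" using K L by simp
    have i: "mat_inner ?A ?A = x\<^sup>2 * mat_inner K K + 2 * x * y * mat_inner K L + y\<^sup>2 * mat_inner L L"
      using K L inner_commute[of L K] by (simp add: inner_linear power2_eq_square algebra_simps)
    have h: "?h ?A ?A = x\<^sup>2 * ?h K K + 2 * x * y * ?h K L + y\<^sup>2 * ?h L L"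
      using hess_symmetric[OF f M(1) L K]
      by (simp add: hess_bilinear(1)[OF f M(1) K L A] hess_bilinear(2)[OF f M(1) K L K]
          hess_bilinear(2)[OF f M(1) K L L] power2_eq_square algebra_simps)
    have "\<bar>?h ?A ?A - mat_inner ?A ?A\<bar> \<le> \<delta> * mat_inner ?A ?A"
    proof -
      have "(1 - \<delta>) * mat_inner ?A ?A \<le> ?h ?A ?A" "?h ?A ?A \<le> (1 + \<delta>) * mat_inner ?A ?A"
        using rip M A rank[of x y] unfolding RIP_def frob_norm_sq by blast+
      then show ?thesis by (simp add: abs_le_iff algebra_simps)
    qed
    then show ?thesis unfolding i h e_def by (simp add: algebra_simps)
  qed
  show ?thesis
  proof (cases "frob_norm K = 0 \<or> frob_norm L = 0")
    case True
    then consider "K = 0\<^sub>m n n" | "L = 0\<^sub>m n n" using norm_eq_0D K L by blast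
    then have "e K L = 0"
    proof cases
      case 1
      have "0\<^sub>m n n = 0 \<cdot>\<^sub>m K + 0 \<cdot>\<^sub>m K" using K by (intro eq_matI) auto
      then show ?thesis using hess_bilinear(1)[OF f M(1) K K L, of 0 0] L by (simp add: e_def 1)
    next
      case 2
      have "0\<^sub>m n n = 0 \<cdot>\<^sub>m L + 0 \<cdot>\<^sub>m L" using L by (intro eq_matI) auto
      then show ?thesis using hess_bilinear(2)[OF f M(1) L L K, of 0 0] K by (simp add: e_def 2)
    qed
    then show ?thesis using True d by (auto simp: e_def)
  next
    case False
    define a b where "a = frob_norm K" and "b = frob_norm L"
    have ab: "a > 0" "b > 0" using False frob_norm_nonneg[of K] frob_norm_nonneg[of L]
      unfolding a_def b_def by linarith+
    have sq: "mat_inner K K = a\<^sup>2" "mat_inner L L = b\<^sup>2" by (simp_all add: a_def b_def frob_norm_sq)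
    define P Q W N where "P = b\<^sup>2 * e K K + a\<^sup>2 * e L L" and "Q = a * b * e K L"
      and "W = a * b * mat_inner K L" and "N = a\<^sup>2 * b\<^sup>2"
    have "\<bar>P + 2 * Q\<bar> \<le> \<delta> * (2 * N + 2 * W)"
      using bound[of b a] by (simp add: sq P_def Q_def W_def N_def algebra_simps)
    moreover have "\<bar>P - 2 * Q\<bar> \<le> \<delta> * (2 * N - 2 * W)"
      using bound[of b "- a"] by (simp add: sq P_def Q_def W_def N_def algebra_simps)
    ultimately have "4 * \<bar>Q\<bar> \<le> \<delta> * (2 * N + 2 * W) + \<delta> * (2 * N - 2 * W)" by linarith
    also have "\<dots> = 4 * (\<delta> * N)" by (simp add: algebra_simps)
    finally have "(a * b) * \<bar>e K L\<bar> \<le> (a * b) * (\<delta> * a * b)"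
      using ab by (simp add: Q_def N_def abs_mult power2_eq_square algebra_simps)
    then have "\<bar>e K L\<bar> \<le> \<delta> * a * b" using ab by simp
    then show ?thesis by (simp add: e_def a_def b_def)
  qed
qed

text \<open>Since X is critical, the L-component of the gradient at X + K is the second derivative
  at an intermediate point of the segment in the directions K and L. Hence the rank condition along
  the line.\<close>

lemma grad_difference_bound:
  assumes f: "twice_cont_diff n n f" and rip: "RIP n p q \<delta> f"
    and X: "X \<in> carrier_mat n n" and crit: "grad n n f X = 0\<^sub>m n n"
    and K: "K \<in> carrier_mat n n" and L: "L \<in> carrier_mat n n"
    and rankM: "\<And>t. mat_rank n (X + t \<cdot>\<^sub>m K) \<le> p"
    and rank: "\<And>x y. mat_rank n (x \<cdot>\<^sub>m K + y \<cdot>\<^sub>m L) \<le> q"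
  shows "\<bar>mat_inner (grad n n f (X + K)) L - mat_inner K L\<bar> \<le> \<delta> * frob_norm K * frob_norm L"
proof -
  obtain t where "mat_inner (grad n n f (X + 1 \<cdot>\<^sub>m K)) L - mat_inner (grad n n f (X + 0 \<cdot>\<^sub>m K)) L
      = (1 - 0) * hess n n f (X + t \<cdot>\<^sub>m K) K L"
    using MVT_real[OF _ DERIV_grad_line[OF f X K L], of 0 1, simplified] by (simp del: diff_0_right) blast
  moreover have "1 \<cdot>\<^sub>m K = K" by (intro eq_matI) auto
  ultimately have "mat_inner (grad n n f (X + K)) L = hess n n f (X + t \<cdot>\<^sub>m K) K L"
    using L by (simp add: add_smult_zero_mat[OF X K] crit)
  then show ?thesis
    using RIP_bilinear[OF f rip _ rankM K L rank, of t] X K by simp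
qed

text \<open>The ground truth is represented by a factor Z, because the general-rank case uses this
  context a second time with Z Q in place of Z for an orthogonal Q.\<close>

locale critical_pair =
  fixes n r :: nat and f :: "real mat \<Rightarrow> real" and Z U :: "real mat" and \<delta> :: real
  assumes adm: "admissible_objective n f"
    and Z: "Z \<in> carrier_mat n r"
    and grad_Ms: "grad n n f (Z * Z\<^sup>T) = 0\<^sub>m n n"
    and rip: "RIP n (2 * r) (2 * r) \<delta> f"
    and soc: "second_order_critical n r (factored f) U"
begin

definition M where "M = U * U\<^sup>T"
definition Ms where "Ms = Z * Z\<^sup>T"
definition K where "K = M - Ms"
definition G where "G = grad n n f M"
definition g where "g = - mat_inner G Ms"

lemma f: "twice_cont_diff n n f" using adm by (simp add: admissible_objective_def)

lemma U: "U \<in> carrier_mat n r" using soc by (simp add: second_order_critical_def)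

lemma delta: "0 \<le> \<delta>" "\<delta> < 1" using rip by (auto simp: RIP_def)

lemma M: "M \<in> carrier_mat n n" and Ms: "Ms \<in> carrier_mat n n" and K: "K \<in> carrier_mat n n"
  using U Z by (auto simp: M_def Ms_def K_def minus_carrier_mat)

lemma G: "G \<in> carrier_mat n n" unfolding G_def by (rule grad_carrier[OF f M])

lemma dims [simp]:
  "dim_row U = n" "dim_col U = r" "dim_row Z = n" "dim_col Z = r" "dim_row M = n" "dim_col M = n"
  "dim_row Ms = n" "dim_col Ms = n" "dim_row K = n" "dim_col K = n" "dim_row G = n" "dim_col G = n"
  using U Z M Ms K G by auto

lemma G_sym: "G\<^sup>T = G"
  unfolding G_def by (rule grad_symmetric[OF adm M]) (simp add: M_def self_transpose_symmetric)

lemma GU: "G * U = 0\<^sub>m n r"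
proof (rule eq_matI)
  have "2 \<cdot>\<^sub>m (G * U) = 0\<^sub>m n r"
    using soc grad_factored[OF adm U] by (simp add: second_order_critical_def G_def M_def)
  fix i j assume "i < dim_row (0\<^sub>m n r :: real mat)" "j < dim_col (0\<^sub>m n r :: real mat)"
  then have ij: "i < n" "j < r" by auto
  have "(2 \<cdot>\<^sub>m (G * U)) $$ (i, j) = 0"
    unfolding \<open>2 \<cdot>\<^sub>m (G * U) = 0\<^sub>m n r\<close> using ij by simp
  then show "(G * U) $$ (i, j) = 0\<^sub>m n r $$ (i, j)" using ij by simp
qed (auto)

lemma inner_G_U:
  assumes "A \<in> carrier_mat r n"
  shows "mat_inner G (U * A) = 0"
proof -
  have "mat_inner G (U * A) = mat_inner (U * A) G" using assms by (intro inner_commute) auto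
  also have "\<dots> = mat_inner A (U\<^sup>T * G)" using assms by (subst inner_mult_left) auto
  also have "U\<^sup>T * G = (G * U)\<^sup>T" by (simp add: transpose_mult_dim G_sym)
  also have "\<dots> = 0\<^sub>m r n" by (simp add: GU)
  finally show ?thesis using assms by simp
qed

lemma inner_G_U':
  assumes "A \<in> carrier_mat n r"
  shows "mat_inner G (A * U\<^sup>T) = 0"
  using inner_transpose[of G "A * U\<^sup>T"] inner_G_U[of "A\<^sup>T"] assms by (simp add: G_sym transpose_mult_dim)

lemma inner_G_M: "mat_inner G M = 0" using inner_G_U[of "U\<^sup>T"] U by (simp add: M_def)

lemma inner_G_K: "mat_inner G K = g" by (simp add: K_def g_def inner_minus_right inner_G_M)

text \<open>All test directions below have the form U A + Z B; their combinations with K keep this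
  form.\<close>

lemma U_Z_span_closed:
  assumes "A \<in> carrier_mat r n" "B \<in> carrier_mat r n"
  shows "mat_rank n (x \<cdot>\<^sub>m K + y \<cdot>\<^sub>m (U * A + Z * B)) \<le> 2 * r"
proof -
  have "x \<cdot>\<^sub>m K + y \<cdot>\<^sub>m (U * A + Z * B) = U * (x \<cdot>\<^sub>m U\<^sup>T + y \<cdot>\<^sub>m A) + Z * ((- x) \<cdot>\<^sub>m Z\<^sup>T + y \<cdot>\<^sub>m B)"
    using U Z assms unfolding K_def M_def Ms_def
    by (simp add: mult_add_distrib_mat[of _ n r _ n] mult_smult_distrib[of _ n r _ n])
      (intro eq_matI; auto simp: algebra_simps)
  also have "mat_rank n \<dots> \<le> 2 * r" using U Z assms by (intro rank_two_factors_le) auto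
  finally show ?thesis .
qed

lemma rank_segment: "mat_rank n (Ms + t \<cdot>\<^sub>m K) \<le> 2 * r"
proof -
  have "Ms + t \<cdot>\<^sub>m K = U * (t \<cdot>\<^sub>m U\<^sup>T) + Z * ((1 - t) \<cdot>\<^sub>m Z\<^sup>T)"
    using U Z unfolding K_def M_def Ms_def
    by (simp add: mult_smult_distrib[of _ n r _ n]) (intro eq_matI; auto simp: algebra_simps)
  also have "mat_rank n \<dots> \<le> 2 * r" using U Z by (intro rank_two_factors_le) auto
  finally show ?thesis .
qed

lemma G_K_bound:
  assumes "A \<in> carrier_mat r n" "B \<in> carrier_mat r n"
  defines "L \<equiv> U * A + Z * B"
  shows "\<bar>mat_inner G L - mat_inner K L\<bar> \<le> \<delta> * frob_norm K * frob_norm L"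
proof -
  have "Ms + K = M" unfolding K_def using M Ms by (intro eq_matI) auto
  moreover have "L \<in> carrier_mat n n" unfolding L_def using U Z assms(1,2) by simp
  ultimately show ?thesis
    using grad_difference_bound[OF f rip Ms _ K _ rank_segment, of L] grad_Ms
      U_Z_span_closed[OF assms(1,2)] by (simp add: G_def L_def Ms_def)
qed

definition S where "S = mat_inner K K"

lemma K_form: "K = U * U\<^sup>T + Z * ((- 1) \<cdot>\<^sub>m Z\<^sup>T)"
  using U Z unfolding K_def M_def Ms_def
  by (simp add: mult_smult_distrib[of _ n r _ n]) (intro eq_matI; auto)

lemma S_nonneg: "0 \<le> S" by (simp add: S_def)

lemma norm_K: "frob_norm K = sqrt S" by (simp add: S_def frob_norm_def)

text \<open>The case L = K, strong monotonicity of the gradient. It makes g the quantity to bound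
  from above: g \<le> 0 already forces M = Ms.\<close>

lemma S_le_g: "(1 - \<delta>) * S \<le> g"
proof -
  have "\<bar>mat_inner G K - mat_inner K K\<bar> \<le> \<delta> * frob_norm K * frob_norm K"
    using G_K_bound[of "U\<^sup>T" "(- 1) \<cdot>\<^sub>m Z\<^sup>T"] U Z unfolding K_form[symmetric] by simp
  also have "\<dots> = \<delta> * S" using S_nonneg by (simp add: norm_K)
  finally show ?thesis by (simp add: inner_G_K S_def[symmetric] algebra_simps)
qed

lemma S_pos_imp: "g \<le> 0 \<Longrightarrow> S = 0"
  using S_le_g S_nonneg delta by (smt (verit) mult_pos_pos)

lemma S_zeroD: "S = 0 \<Longrightarrow> M = Ms"
proof -
  assume "S = 0"
  then have "K = 0\<^sub>m n n" using norm_eq_0D[OF _ K] by (simp add: norm_K)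
  then have "K $$ (i, j) = 0" if "i < n" "j < n" for i j using that by simp
  then show "M = Ms" unfolding K_def by (intro eq_matI) auto
qed

text \<open>The gradient is compared with K along the direction y - K.\<close>
lemma key_inequality:
  assumes AB: "A \<in> carrier_mat r n" "B \<in> carrier_mat r n" and y: "y = U * A + Z * B"
    and Gy: "mat_inner G y = mat_inner y y" and Ky: "mat_inner K y = g"
  shows "(1 - \<delta>\<^sup>2) * S + mat_inner y y \<le> 2 * g"
proof -
  define L where "L = y - K"
  have yc: "y \<in> carrier_mat n n" using AB U Z y by simp
  have Lf: "L = U * (A - U\<^sup>T) + Z * (B + Z\<^sup>T)"
    unfolding L_def y K_form using AB U Z
    by (simp add: mult_add_distrib_mat[of _ n r _ n] mult_minus_distrib_mat[of _ n r _ n]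
        mult_smult_distrib[of _ n r _ n]) (intro eq_matI; auto)
  have Kyc: "mat_inner y K = g" using Ky yc inner_commute[of y K] by simp
  have LL: "mat_inner L L = mat_inner y y - 2 * g + S"
    using yc Ky Kyc by (simp add: L_def inner_linear S_def)
  have "mat_inner G L - mat_inner K L = mat_inner L L"
    unfolding LL using yc Gy Ky by (simp add: L_def inner_minus_right inner_G_K S_def)
  then have "mat_inner L L \<le> \<delta> * frob_norm K * frob_norm L"
    using G_K_bound[of "A - U\<^sup>T" "B + Z\<^sup>T"] AB U Z unfolding Lf[symmetric]
    by (simp add: minus_carrier_mat)
  then have le: "frob_norm L * frob_norm L \<le> (\<delta> * frob_norm K) * frob_norm L"
    by (simp add: power2_eq_square[symmetric] frob_norm_sq)
  have "frob_norm L \<le> \<delta> * frob_norm K"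
  proof (cases "frob_norm L = 0")
    case False
    then have "frob_norm L > 0" using frob_norm_nonneg[of L] by linarith
    with le show ?thesis by simp
  qed (use delta in simp)
  then have "(frob_norm L)\<^sup>2 \<le> (\<delta> * frob_norm K)\<^sup>2" by (intro power_mono) auto
  then have "mat_inner L L \<le> \<delta>\<^sup>2 * S"
    by (simp add: frob_norm_sq power_mult_distrib norm_K S_nonneg)
  then show ?thesis using LL by (simp add: algebra_simps)
qed

section \<open>The squared least singular value of U and the curvature bound for g\<close>

definition sig2 :: real where
  "sig2 = Inf {mat_inner (U * v) (U * v) | v. v \<in> carrier_mat r 1 \<and> mat_inner v v = 1}"

lemma sig2_le:
  assumes v: "v \<in> carrier_mat r 1"
  shows "sig2 * mat_inner v v \<le> mat_inner (U * v) (U * v)"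
proof (cases "mat_inner v v = 0")
  case False
  define c where "c = frob_norm v"
  have c: "c > 0" "c\<^sup>2 = mat_inner v v"
    using False inner_self_nonneg[of v] by (auto simp: c_def frob_norm_sq frob_norm_def simp del: inner_self_nonneg)
  define w where "w = (1 / c) \<cdot>\<^sub>m v"
  have w: "w \<in> carrier_mat r 1" "mat_inner w w = 1"
    using v c by (auto simp: w_def inner_linear power2_eq_square)
  have "sig2 \<le> mat_inner (U * w) (U * w)"
    unfolding sig2_def using w by (intro cInf_lower bdd_belowI[of _ 0]) auto
  also have "U * w = (1 / c) \<cdot>\<^sub>m (U * v)"
    using U v by (simp add: w_def mult_smult_distrib[of _ n r _ 1])
  finally have "sig2 \<le> mat_inner (U * v) (U * v) / c\<^sup>2"
    using v by (simp add: inner_linear power2_eq_square)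
  moreover have "mat_inner v v > 0" using c by (metis zero_less_power)
  ultimately show ?thesis unfolding c(2) by (simp add: pos_le_divide_eq)
qed simp

lemma sig2_nonneg:
  assumes "r \<ge> 1" shows "0 \<le> sig2"
  unfolding sig2_def
proof (rule cInf_greatest)
  define e :: "real mat" where "e = mat r 1 (\<lambda>(i, j). if i = 0 then 1 else 0)"
  have "mat_inner e e = 1" "e \<in> carrier_mat r 1"
    using assms by (auto simp: e_def inner_sum if_distrib[of "\<lambda>x. x * _"] sum.delta cong: if_cong)
  then show "{mat_inner (U * v) (U * v) |v. v \<in> carrier_mat r 1 \<and> mat_inner v v = 1} \<noteq> {}" by blast
qed auto

text \<open>Near-minimizers stand in for a least singular vector; their error is absorbed in
  \<open>curvature_column\<close>.\<close>

lemma sig2_approx: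
  assumes "r \<ge> 1" "e > 0"
  obtains v where "v \<in> carrier_mat r 1" "mat_inner v v = 1" "mat_inner (U * v) (U * v) < sig2 + e"
proof -
  define v0 :: "real mat" where "v0 = mat r 1 (\<lambda>(i, j). if i = 0 then 1 else 0)"
  have "mat_inner v0 v0 = 1" "v0 \<in> carrier_mat r 1"
    using assms by (auto simp: v0_def inner_sum if_distrib[of "\<lambda>x. x * _"] sum.delta cong: if_cong)
  then have "{mat_inner (U * v) (U * v) |v. v \<in> carrier_mat r 1 \<and> mat_inner v v = 1} \<noteq> {}" by blast
  from cInf_lessD[OF this, of "sig2 + e"] show ?thesis
    using assms that by (auto simp: sig2_def)
qed

text \<open>
  Second-order criticality in the direction u v^T, where v is nearly a smallest right singular
  vector of U.
\<close>
lemma curvature_column: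
  assumes r: "r \<ge> 1" and u: "u \<in> carrier_mat n 1"
    and c: "c = 2 \<or> c = 1 \<and> U\<^sup>T * u = 0\<^sub>m r 1"
  shows "- c * (1 + \<delta>) * sig2 * mat_inner u u \<le> mat_inner G (u * u\<^sup>T)"
proof (rule field_le_epsilon)
  fix e :: real assume "e > 0"
  define uu where "uu = mat_inner u u"
  \<comment> \<open>Chosen such that the total error caused by the near-minimizer is at most e; the
    summand 1 covers u = 0.\<close>
  define e' where "e' = e / (c * (1 + \<delta>) * uu + 1)"
  have uu0: "uu \<ge> 0" by (simp add: uu_def)
  have c0: "c > 0" using c by auto
  have den: "c * (1 + \<delta>) * uu + 1 > 0" using delta uu0 c0 by (simp add: add_nonneg_pos)
  then have "e' > 0" using \<open>e > 0\<close> by (simp add: e'_def)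
  from sig2_approx[OF r this] obtain v where v: "v \<in> carrier_mat r 1" "mat_inner v v = 1"
    "mat_inner (U * v) (U * v) < sig2 + e'" by blast
  define V where "V = u * v\<^sup>T"
  have V: "V \<in> carrier_mat n r" using u v by (simp add: V_def)
  have vv: "v\<^sup>T * v = 1\<^sub>m 1"
  proof (rule eq_matI)
    fix i j assume "i < dim_row (1\<^sub>m 1 :: real mat)" "j < dim_col (1\<^sub>m 1 :: real mat)"
    then show "(v\<^sup>T * v) $$ (i, j) = 1\<^sub>m 1 $$ (i, j)"
      using v by (simp add: inner_sum scalar_prod_def atLeast0LessThan)
  qed (use v in auto)
  have VV: "V * V\<^sup>T = u * u\<^sup>T"
  proof -
    have "V * V\<^sup>T = u * ((v\<^sup>T * v) * u\<^sup>T)"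
      using u v by (simp add: V_def transpose_mult_dim mult_assoc_dim)
    then show ?thesis using u by (simp add: vv)
  qed
  define w where "w = U * v"
  have w: "w \<in> carrier_mat n 1" using U v by (simp add: w_def)
  have UV: "U * V\<^sup>T = w * u\<^sup>T" using U u v by (simp add: V_def w_def transpose_mult_dim mult_assoc_dim)
  have VUt: "V * U\<^sup>T = u * w\<^sup>T"
    using U u v by (simp add: V_def w_def transpose_mult_dim mult_assoc_dim)
  have n1: "mat_inner (w * u\<^sup>T) (w * u\<^sup>T) = mat_inner w w * uu"
  proof -
    have wu: "mat_inner (a * b\<^sup>T) (a * b\<^sup>T) = mat_inner a a * mat_inner b b"
      if "a \<in> carrier_mat n 1" "b \<in> carrier_mat n 1" for a b :: "real mat"
      using that by (simp add: inner_sum scalar_prod_def sum_product algebra_simps) (rule sum.swap)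
    show ?thesis using wu[OF w u] by (simp add: uu_def)
  qed
  have n2: "mat_inner (u * w\<^sup>T) (u * w\<^sup>T) = mat_inner w w * uu"
    using inner_transpose[of "w * u\<^sup>T" "w * u\<^sup>T"] n1 u w by (simp add: transpose_mult_dim)
  \<comment> \<open>The variation is w u^T + u w^T with w = U v, two terms of equal norm. They are
    orthogonal if u is orthogonal to the columns of U, which gives c = 1; otherwise the triangle
    inequality gives c = 2.\<close>
  have nS: "(frob_norm (outer_sym U V))\<^sup>2 \<le> 2 * c * (mat_inner w w * uu)"
    using c
  proof
    assume c2: "c = 2"
    have "frob_norm (outer_sym U V) \<le> frob_norm (w * u\<^sup>T) + frob_norm (u * w\<^sup>T)"
      unfolding outer_sym_def UV VUt using u w by (intro norm_triangle) auto
    also have "\<dots> = 2 * sqrt (mat_inner w w * uu)" by (simp add: frob_norm_def n1 n2)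
    finally have "(frob_norm (outer_sym U V))\<^sup>2 \<le> (2 * sqrt (mat_inner w w * uu))\<^sup>2"
      by (intro power_mono) auto
    then show ?thesis using uu0 by (simp add: c2 power_mult_distrib)
  next
    assume c1: "c = 1 \<and> U\<^sup>T * u = 0\<^sub>m r 1"
    have uw: "u\<^sup>T * w = 0\<^sub>m 1 1"
    proof -
      have "u\<^sup>T * w = (U\<^sup>T * u)\<^sup>T * v" using U u v by (simp add: w_def transpose_mult_dim mult_assoc_dim)
      then show ?thesis using v by (simp add: c1)
    qed
    have "mat_inner (u * w\<^sup>T) (w * u\<^sup>T) = mat_inner (w\<^sup>T) (u\<^sup>T * (w * u\<^sup>T))" using u w by (subst inner_mult_left) auto
    also have "u\<^sup>T * (w * u\<^sup>T) = (u\<^sup>T * w) * u\<^sup>T" using u w by (simp add: mult_assoc_dim)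
    finally have n3: "mat_inner (u * w\<^sup>T) (w * u\<^sup>T) = 0" using u w by (simp add: uw)
    show ?thesis
      unfolding frob_norm_sq outer_sym_def UV VUt
      using c1 n1 n2 n3 inner_commute[of "w * u\<^sup>T" "u * w\<^sup>T"] u w by (simp add: inner_linear)
  qed
  have rankS: "mat_rank n (outer_sym U V) \<le> 2 * r"
    unfolding outer_sym_def using U V by (intro rank_two_factors_le) auto
  have rankM: "mat_rank n M \<le> 2 * r"
  proof -
    have "M = U * U\<^sup>T + U * 0\<^sub>m r n" using U unfolding M_def by simp
    then show ?thesis using rank_two_factors_le[OF U U, of "U\<^sup>T" "0\<^sub>m r n"] U by simp
  qed
  have "0 \<le> hess n r (factored f) U V V" using soc V by (simp add: second_order_critical_def)
  also have "\<dots> = hess n n f M (outer_sym U V) (outer_sym U V) + 2 * mat_inner G (u * u\<^sup>T)"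
    using hess_factored[OF adm U V] by (simp add: M_def G_def VV)
  also have "hess n n f M (outer_sym U V) (outer_sym U V) \<le> (1 + \<delta>) * (frob_norm (outer_sym U V))\<^sup>2"
    using rip M rankM rankS U V by (simp add: RIP_def)
  also have "\<dots> \<le> (1 + \<delta>) * (2 * c * (mat_inner w w * uu))" using delta by (intro mult_left_mono nS) auto
  also have "\<dots> = 2 * (c * (1 + \<delta>) * uu * mat_inner w w)" by simp
  also have "\<dots> \<le> 2 * (c * (1 + \<delta>) * uu * (sig2 + e'))"
    using v(3) delta uu0 c0 unfolding w_def by (intro mult_left_mono) auto
  finally have "0 \<le> c * (1 + \<delta>) * uu * (sig2 + e') + mat_inner G (u * u\<^sup>T)" by simp
  moreover have "c * (1 + \<delta>) * uu * e' \<le> e"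
  proof -
    have "c * (1 + \<delta>) * uu * e' = e * (c * (1 + \<delta>) * uu / (c * (1 + \<delta>) * uu + 1))" by (simp add: e'_def)
    also have "\<dots> \<le> e" using \<open>e > 0\<close> den by (intro mult_left_le) auto
    finally show ?thesis .
  qed
  ultimately show "- c * (1 + \<delta>) * sig2 * mat_inner u u \<le> mat_inner G (u * u\<^sup>T) + e"
    by (simp add: uu_def[symmetric] algebra_simps)
qed

lemma curvature:
  assumes r: "r \<ge> 1" and Y: "Y \<in> carrier_mat n k"
    and c: "c = 2 \<or> c = 1 \<and> U\<^sup>T * Y = 0\<^sub>m r k"
  shows "- c * (1 + \<delta>) * sig2 * mat_inner Y Y \<le> mat_inner G (Y * Y\<^sup>T)"
proof -
  have "- c * (1 + \<delta>) * sig2 * mat_inner Y Y = (\<Sum>j<k. - c * (1 + \<delta>) * sig2 * mat_inner (col_mat Y j) (col_mat Y j))"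
    using Y by (subst inner_eq_sum_cols) (auto simp: sum_distrib_left)
  also have "\<dots> \<le> (\<Sum>j<k. mat_inner G (col_mat Y j * (col_mat Y j)\<^sup>T))"
  proof (intro sum_mono curvature_column[OF r])
    fix j assume j: "j \<in> {..<k}"
    show "col_mat Y j \<in> carrier_mat n 1" using Y by (intro carrier_matI) auto
    have "col_mat (0\<^sub>m r k) j = (0\<^sub>m r 1 :: real mat)" using j by (intro eq_matI) (auto simp: col_mat_def)
    then show "c = 2 \<or> c = 1 \<and> U\<^sup>T * col_mat Y j = 0\<^sub>m r 1"
      using c Y j by (auto simp: mult_col_mat)
  qed
  also have "\<dots> = mat_inner G (Y * Y\<^sup>T)" using inner_self_transpose_eq_sum[OF G Y] by simp
  finally show ?thesis .
qed

text \<open>Criticality makes G orthogonal to every product with U on the left or U^T on the right;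
  in the expansion of Z Z^T only Y Y^T survives.\<close>

lemma g_eq:
  assumes A: "A \<in> carrier_mat r r" and Y: "Y \<in> carrier_mat n r" and ZY: "Z = U * A + Y"
  shows "g = - mat_inner G (Y * Y\<^sup>T)"
proof -
  have UA: "U * A \<in> carrier_mat n r" using U A by simp
  have "Ms = (U * A + Y) * (U * A + Y)\<^sup>T" by (simp only: Ms_def ZY[symmetric])
  also have "\<dots> = (U * A) * (U * A)\<^sup>T + (outer_sym (U * A) Y + Y * Y\<^sup>T)"
    by (rule add_mult_self_transpose[OF UA Y])
  also have "(U * A) * (U * A)\<^sup>T = U * (A * (U * A)\<^sup>T)" using U A by (intro mult_assoc_dim) auto
  also have "outer_sym (U * A) Y = U * (A * Y\<^sup>T) + (Y * A\<^sup>T) * U\<^sup>T"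
    using U A Y by (simp add: outer_sym_def transpose_mult_dim mult_assoc_dim)
  finally have "mat_inner G Ms = mat_inner G (U * (A * (U * A)\<^sup>T))
      + (mat_inner G (U * (A * Y\<^sup>T)) + mat_inner G ((Y * A\<^sup>T) * U\<^sup>T) + mat_inner G (Y * Y\<^sup>T))"
    using U A Y by (simp add: inner_add_right)
  also have "mat_inner G (U * (A * (U * A)\<^sup>T)) = 0" using U A by (intro inner_G_U) auto
  also have "mat_inner G (U * (A * Y\<^sup>T)) = 0" using A Y by (intro inner_G_U) auto
  also have "mat_inner G ((Y * A\<^sup>T) * U\<^sup>T) = 0" using A Y by (intro inner_G_U') auto
  finally have "mat_inner G Ms = mat_inner G (Y * Y\<^sup>T)" by simp
  then show ?thesis by (simp add: g_def)
qed

lemma g_le: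
  assumes r: "r \<ge> 1" and A: "A \<in> carrier_mat r r" and Y: "Y \<in> carrier_mat n r"
    and ZY: "Z = U * A + Y" and orth: "U\<^sup>T * Y = 0\<^sub>m r r"
  shows "g \<le> (1 + \<delta>) * (sig2 * mat_inner Y Y)"
  using curvature[OF r Y, of 1] orth g_eq[OF A Y ZY] by (simp add: algebra_simps)

text \<open>The coarse constant c = 2 applies to Y = Z itself, and the vanishing singular value
  removes the right-hand side.\<close>

lemma g_le_of_sig2_zero:
  assumes r: "r \<ge> 1" and "sig2 = 0"
  shows "g \<le> 0"
  using curvature[OF r Z, of 2] assms by (simp add: g_def Ms_def)

end

text \<open>Cyclicity of the trace; in particular <M, Ms> = |U^T Z|^2 is nonnegative.\<close>

lemma inner_self_products:
  assumes "A \<in> carrier_mat n k" "B \<in> carrier_mat n l"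
  shows "mat_inner (A * A\<^sup>T) (B * B\<^sup>T) = mat_inner (A\<^sup>T * B) (A\<^sup>T * B)"
proof -
  have "mat_inner (A * A\<^sup>T) (B * B\<^sup>T) = mat_inner (A\<^sup>T) (A\<^sup>T * (B * B\<^sup>T))"
    using assms by (subst inner_mult_left) auto
  also have "\<dots> = mat_inner (A\<^sup>T * B * B\<^sup>T) (A\<^sup>T)"
    using assms by (subst inner_commute) (auto simp: mult_assoc_dim)
  also have "\<dots> = mat_inner (A\<^sup>T * B) (A\<^sup>T * B)" using assms by (subst inner_mult_right) auto
  finally show ?thesis .
qed

section \<open>Scalar inequalities for rank one and for the correlation bound\<close>

lemma discriminant_bound:
  fixes \<theta> m k p e :: real
  assumes \<theta>: "0 < \<theta>" "\<theta> \<le> 1" and m: "0 < m" and p: "0 \<le> p" "p \<le> e * m"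
    and le: "\<theta> * (m\<^sup>2 + k\<^sup>2) + p\<^sup>2 \<le> 2 * p * k"
  shows "\<theta>\<^sup>2 \<le> (1 - \<theta>) * e\<^sup>2"
proof -
  \<comment> \<open>Multiplication by \<theta> completes the square in k and leaves the discriminant
    condition in m and p; p \<le> e m then eliminates p, and m cancels.\<close>
  have "\<theta> * (\<theta> * (m\<^sup>2 + k\<^sup>2) + p\<^sup>2 - 2 * p * k) \<le> 0" using le \<theta> by (simp add: mult_le_0_iff)
  moreover have "\<theta> * (\<theta> * (m\<^sup>2 + k\<^sup>2) + p\<^sup>2 - 2 * p * k) = (\<theta> * k - p)\<^sup>2 + \<theta>\<^sup>2 * m\<^sup>2 - (1 - \<theta>) * p\<^sup>2"
    by (simp add: power2_eq_square algebra_simps)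
  ultimately have "\<theta>\<^sup>2 * m\<^sup>2 \<le> (1 - \<theta>) * p\<^sup>2" using zero_le_power2[of "\<theta> * k - p"] by linarith
  also have "\<dots> \<le> (1 - \<theta>) * (e * m)\<^sup>2" using p \<theta> by (intro mult_left_mono power_mono) auto
  finally have "\<theta>\<^sup>2 * m\<^sup>2 \<le> ((1 - \<theta>) * e\<^sup>2) * m\<^sup>2" by (simp add: power_mult_distrib algebra_simps)
  then show ?thesis using m by simp
qed

text \<open>Here m = |U|^2, A and b are the squared norms of the parts of Z along U and orthogonal
  to U, and p = g / b. For given m and b, S is smallest at A = 0 if b \<ge> m and at A = m - b
  otherwise; this gives the two cases.\<close>

lemma rank_one_arithmetic:
  fixes \<delta> m A b p S :: real
  assumes \<delta>: "0 \<le> \<delta>" "\<delta> < 1/2" and m: "0 < m" and A: "0 \<le> A" and b: "0 < b"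
    and S: "S = (m - A)\<^sup>2 + 2 * A * b + b\<^sup>2"
    and p: "0 \<le> p" "p \<le> (1 + \<delta>) * m"
    and le: "(1 - \<delta>\<^sup>2) * S + p\<^sup>2 \<le> 2 * p * b"
  shows False
proof -
  define \<theta> where "\<theta> = 1 - \<delta>\<^sup>2"
  have "\<delta>\<^sup>2 \<le> (1/2)\<^sup>2" using \<delta> by (intro power_mono) auto
  then have \<theta>: "3/4 \<le> \<theta>" "\<theta> \<le> 1" by (auto simp: \<theta>_def power2_eq_square)
  show False
  proof (cases "b \<ge> m")
    case True
    have "S = (m\<^sup>2 + b\<^sup>2) + (A\<^sup>2 + 2 * A * (b - m))" by (simp add: S power2_eq_square algebra_simps)
    then have "m\<^sup>2 + b\<^sup>2 \<le> S" using A True by simp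
    then have "\<theta> * (m\<^sup>2 + b\<^sup>2) \<le> \<theta> * S" using \<theta> by (intro mult_left_mono) auto
    with le have "\<theta> * (m\<^sup>2 + b\<^sup>2) + p\<^sup>2 \<le> 2 * p * b" by (simp add: \<theta>_def)
    \<comment> \<open>As 1 - \<theta> = \<delta>^2 and \<theta> = (1 - \<delta>) (1 + \<delta>), the
      condition collapses to 1 - \<delta> \<le> \<delta>: the origin of the threshold 1/2.\<close>
    then have "\<theta>\<^sup>2 \<le> (1 - \<theta>) * (1 + \<delta>)\<^sup>2" using \<theta> m p by (intro discriminant_bound) auto
    also have "\<dots> = (\<delta> * (1 + \<delta>))\<^sup>2" by (simp add: \<theta>_def power_mult_distrib)
    finally have "\<theta> \<le> \<delta> * (1 + \<delta>)" using \<delta> by (intro power2_le_imp_le[of \<theta>]) auto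
    moreover have "\<theta> = (1 - \<delta>) * (1 + \<delta>)" by (simp add: \<theta>_def power2_eq_square algebra_simps)
    ultimately have "1 - \<delta> \<le> \<delta>" using \<delta> by simp
    with \<delta> show False by simp
  next
    case False
    have "S = 2 * m * b + (A - (m - b))\<^sup>2" by (simp add: S power2_eq_square algebra_simps)
    then have "2 * m * b \<le> S" by simp
    then have "\<theta> * (2 * m * b) \<le> \<theta> * S" using \<theta> by (intro mult_left_mono) auto
    also have "\<dots> \<le> 2 * p * b - p\<^sup>2" using le by (simp add: \<theta>_def)
    \<comment> \<open>The maximum of 2 p b - p^2 over p is b^2, so b would be at least 3/2 m,
      against b < m.\<close>
    also have "\<dots> = b\<^sup>2 - (p - b)\<^sup>2" by (simp add: power2_eq_square algebra_simps)
    also have "\<dots> \<le> b * b" by (simp add: power2_eq_square)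
    finally have "2 * \<theta> * m \<le> b" using b by (simp add: algebra_simps)
    moreover have "2 * (3/4) * m \<le> 2 * \<theta> * m" using \<theta> m by (intro mult_right_mono) auto
    ultimately show False using False m by simp
  qed
qed

text \<open>A correlation of at most C m k leaves S \<ge> (1 - C) (m^2 + k^2). The discriminant
  excess is (1 + \<delta>)^2 times 1 - 2 \<delta> - C (1 - \<delta>) (3 - \<delta>), plus a positive
  square. As (1 - \<delta>) (3 - \<delta>) \<le> 3, the choice C = (1 - 2 \<delta>) / 3 keeps the
  first term nonnegative, and the square makes the contradiction strict.\<close>

lemma correlation_arithmetic:
  fixes \<delta> m k p S q :: real
  assumes \<delta>: "0 \<le> \<delta>" "\<delta> < 1/2" and m: "0 < m" and k: "0 < k"
    and S: "S = m\<^sup>2 - 2 * q + k\<^sup>2" and q: "q \<le> (1 - 2 * \<delta>) / 3 * (m * k)"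
    and p: "0 \<le> p" "p \<le> (1 + \<delta>) * m"
    and le: "(1 - \<delta>\<^sup>2) * S + p\<^sup>2 \<le> 2 * p * k"
  shows False
proof -
  define C where "C = (1 - 2 * \<delta>) / 3"
  define t where "t = 1 - \<delta>\<^sup>2"
  define \<theta> where "\<theta> = t * (1 - C)"
  have C: "0 < C" "C \<le> 1/3" using \<delta> by (auto simp: C_def)
  have t_eq: "t = (1 - \<delta>) * (1 + \<delta>)" by (simp add: t_def power2_eq_square algebra_simps)
  have "\<delta>\<^sup>2 \<le> (1/2)\<^sup>2" using \<delta> by (intro power_mono) auto
  then have t: "0 < t" "t \<le> 1" by (auto simp: t_def power2_eq_square)
  have \<theta>: "0 < \<theta>" "\<theta> \<le> 1" using t C by (auto simp: \<theta>_def mult_le_one)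
  have "2 * (m * k) \<le> m\<^sup>2 + k\<^sup>2" using zero_le_power2[of "m - k"] by (simp add: power2_diff)
  then have "C * (2 * (m * k)) \<le> C * (m\<^sup>2 + k\<^sup>2)" using C by (intro mult_left_mono) auto
  moreover have "q \<le> C * (m * k)" using q by (simp add: C_def)
  ultimately have "(1 - C) * (m\<^sup>2 + k\<^sup>2) \<le> S" by (simp add: S algebra_simps)
  then have "t * ((1 - C) * (m\<^sup>2 + k\<^sup>2)) \<le> t * S" using t by (intro mult_left_mono) auto
  with le have "\<theta> * (m\<^sup>2 + k\<^sup>2) + p\<^sup>2 \<le> 2 * p * k" by (simp add: \<theta>_def t_def mult.assoc)
  then have "\<theta>\<^sup>2 \<le> (1 - \<theta>) * (1 + \<delta>)\<^sup>2" using \<theta> m p by (intro discriminant_bound) auto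
  moreover have "\<theta>\<^sup>2 - (1 - \<theta>) * (1 + \<delta>)\<^sup>2
      = (1 + \<delta>)\<^sup>2 * (1 - 2 * \<delta> - C * ((1 - \<delta>) * (3 - \<delta>))) + t\<^sup>2 * C\<^sup>2"
    by (simp add: \<theta>_def t_eq power2_eq_square algebra_simps)
  moreover have "C * ((1 - \<delta>) * (3 - \<delta>)) \<le> C * 3"
  proof (rule mult_left_mono)
    have "(1 - \<delta>) * (3 - \<delta>) = 3 - \<delta> * (4 - \<delta>)" by (simp add: algebra_simps)
    then show "(1 - \<delta>) * (3 - \<delta>) \<le> 3" using \<delta> by simp
  qed (use C in simp)
  then have "0 \<le> (1 + \<delta>)\<^sup>2 * (1 - 2 * \<delta> - C * ((1 - \<delta>) * (3 - \<delta>)))"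
    by (intro mult_nonneg_nonneg) (auto simp: C_def)
  moreover have "0 < t\<^sup>2 * C\<^sup>2" using t C by simp
  ultimately show False by linarith
qed

section \<open>Minimality of the ground truth and recovery for rank one\<close>

context critical_pair
begin

text \<open>On the segment from Ms to V V^T all ranks are at most 2r, so f is convex there and its
  critical point Ms is a minimum. Absence of spurious points thus reduces to M = Ms.\<close>

lemma ground_truth_minimal:
  assumes V: "V \<in> carrier_mat n r"
  shows "f Ms \<le> f (V * V\<^sup>T)"
proof -
  define D where "D = V * V\<^sup>T - Ms"
  have D: "D \<in> carrier_mat n n" using Ms by (simp add: D_def minus_carrier_mat)
  have seg: "Ms + t \<cdot>\<^sub>m D = Z * ((1 - t) \<cdot>\<^sub>m Z\<^sup>T) + V * (t \<cdot>\<^sub>m V\<^sup>T)"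
    and Deq: "D = Z * ((- 1) \<cdot>\<^sub>m Z\<^sup>T) + V * V\<^sup>T" for t
    unfolding D_def Ms_def using Z V
    by (simp_all add: mult_smult_distrib[of _ n r _ n]) (intro eq_matI; auto simp: algebra_simps)+
  have "mat_rank n D \<le> 2 * r"
    unfolding Deq using Z V by (intro rank_two_factors_le) auto
  moreover have "mat_rank n (Ms + t \<cdot>\<^sub>m D) \<le> 2 * r" for t
    unfolding seg using Z V by (intro rank_two_factors_le) auto
  ultimately have H: "(1 - \<delta>) * (frob_norm D)\<^sup>2 \<le> hess n n f (Ms + t \<cdot>\<^sub>m D) D D" for t
    using rip Ms D by (simp add: RIP_def)
  have "0 \<le> hess n n f (Ms + t \<cdot>\<^sub>m D) D D" for t
    using H[of t] delta by (smt (verit) mult_nonneg_nonneg zero_le_power2)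
  note H = this
  have z: "(0 :: real) < 1" by simp
  obtain t where t: "0 < t" "f (Ms + 1 \<cdot>\<^sub>m D) - f (Ms + 0 \<cdot>\<^sub>m D)
      = (1 - 0) * mat_inner (grad n n f (Ms + t \<cdot>\<^sub>m D)) D"
    using MVT_real[OF _ DERIV_line[OF f Ms D], of 0 1] z by metis
  obtain s where "mat_inner (grad n n f (Ms + t \<cdot>\<^sub>m D)) D - mat_inner (grad n n f (Ms + 0 \<cdot>\<^sub>m D)) D
      = (t - 0) * hess n n f (Ms + s \<cdot>\<^sub>m D) D D"
    using MVT_real[OF t(1) DERIV_grad_line[OF f Ms D D]] by metis
  then have "mat_inner (grad n n f (Ms + t \<cdot>\<^sub>m D)) D = t * hess n n f (Ms + s \<cdot>\<^sub>m D) D D"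
    using grad_Ms D by (simp add: add_smult_zero_mat[OF Ms D]) (simp add: Ms_def)
  then have "0 \<le> mat_inner (grad n n f (Ms + t \<cdot>\<^sub>m D)) D" using H t by simp
  moreover have "Ms + 1 \<cdot>\<^sub>m D = V * V\<^sup>T" unfolding D_def using Ms V by (intro eq_matI) auto
  ultimately show ?thesis using t(2) by (simp add: add_smult_zero_mat[OF Ms D])
qed

lemma not_spurious_if_eq: "M = Ms \<Longrightarrow> \<not> spurious n r (factored f) U"
  using ground_truth_minimal by (auto simp: spurious_def factored_def M_def)

lemma S_expand: "S = mat_inner M M - 2 * mat_inner M Ms + mat_inner Ms Ms"
  using inner_commute[of Ms M] by (simp add: S_def K_def inner_linear)

lemma inner_M_Ms: "mat_inner M Ms = mat_inner (U\<^sup>T * Z) (U\<^sup>T * Z)"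
  unfolding M_def Ms_def using U Z by (rule inner_self_products)

lemma rank_one_recovery:
  assumes r: "r = 1" and d: "\<delta> < 1/2"
  shows "M = Ms"
proof (rule S_zeroD, rule ccontr)
  assume S0: "S \<noteq> 0"
  have gram: "A\<^sup>T * B = mat_inner A B \<cdot>\<^sub>m 1\<^sub>m 1" if "A \<in> carrier_mat n 1" "B \<in> carrier_mat n 1" for A B :: "real mat"
    using that by (intro eq_matI) (auto simp: inner_sum scalar_prod_def atLeast0LessThan)
  have U1: "U \<in> carrier_mat n 1" and Z1: "Z \<in> carrier_mat n 1" using U Z r by auto
  define m where "m = mat_inner U U"
  \<comment> \<open>For U = 0 division by zero gives a = 0, and \<open>am\<close> below still
    holds.\<close>
  define a where "a = mat_inner U Z / m"
  define Y where "Y = Z - a \<cdot>\<^sub>m U"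
  have Y: "Y \<in> carrier_mat n 1" using U1 by (simp add: Y_def minus_carrier_mat)
  define b where "b = mat_inner Y Y"
  have m0: "m \<ge> 0" and b0: "b \<ge> 0" by (simp_all add: m_def b_def)
  have am: "a * m = mat_inner U Z"
  proof (cases "m = 0")
    case True
    then have "frob_norm U = 0" by (simp add: m_def frob_norm_def)
    then have "U = 0\<^sub>m n 1" using norm_eq_0D U1 by blast
    then show ?thesis using Z1 True r by simp
  qed (simp add: a_def)
  have UY: "mat_inner U Y = 0"
    using am by (simp add: Y_def inner_minus_right inner_smult_right m_def)
  have ZY: "Z = U * (a \<cdot>\<^sub>m 1\<^sub>m 1) + Y"
  proof -
    have "U * (a \<cdot>\<^sub>m 1\<^sub>m 1) = a \<cdot>\<^sub>m (U * 1\<^sub>m 1)" using U1 by (intro mult_smult_distrib) auto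
    then have "U * (a \<cdot>\<^sub>m 1\<^sub>m 1) = a \<cdot>\<^sub>m U" by (simp only: right_mult_one_mat[OF U1])
    then show ?thesis unfolding Y_def using U1 Z1 by (auto intro!: eq_matI)
  qed
  have orth: "U\<^sup>T * Y = 0\<^sub>m 1 1"
    using gram[OF U1 Y] UY by (auto intro!: eq_matI)
  \<comment> \<open>With a single column, \<open>sig2\<close> is bounded by the squared norm of that
    column.\<close>
  have "mat_inner (U * 1\<^sub>m 1) (U * 1\<^sub>m 1) = m" by (simp only: right_mult_one_mat[OF U1] m_def)
  then have "sig2 \<le> m" using sig2_le[of "1\<^sub>m 1"] r by (simp add: inner_sum)
  then have "(1 + \<delta>) * (sig2 * b) \<le> (1 + \<delta>) * (m * b)"
    using delta b0 by (intro mult_left_mono mult_right_mono) auto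
  moreover have "g \<le> (1 + \<delta>) * (sig2 * b)"
    using g_le[of "a \<cdot>\<^sub>m 1\<^sub>m 1" Y] r Y ZY orth by (simp add: b_def)
  ultimately have g_le: "g \<le> (1 + \<delta>) * m * b" by simp
  have g0: "g > 0" using S0 S_pos_imp by force
  have b: "b > 0" and m: "m > 0"
    using g_le g0 delta b0 m0 by (auto simp: order.order_iff_strict)
  have GY: "mat_inner G (Y * Y\<^sup>T) = - g"
    using g_eq[of "a \<cdot>\<^sub>m 1\<^sub>m 1" Y] r Y ZY by simp
  have YY: "mat_inner (Y * Y\<^sup>T) (Y * Y\<^sup>T) = b\<^sup>2"
    unfolding inner_self_products[OF Y Y] gram[OF Y Y] by (simp add: inner_sum b_def power2_eq_square)
  have ZYb: "mat_inner Z Y = b"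
  proof -
    have "Z = a \<cdot>\<^sub>m U + Y" unfolding Y_def using U1 Z1 by (auto intro!: eq_matI)
    then have "mat_inner Z Y = mat_inner (a \<cdot>\<^sub>m U + Y) Y" by (rule arg_cong)
    also have "\<dots> = b" using UY Y r by (simp add: inner_linear b_def)
    finally show ?thesis .
  qed
  have KY: "mat_inner K (Y * Y\<^sup>T) = - b\<^sup>2"
  proof -
    have "mat_inner M (Y * Y\<^sup>T) = 0"
      unfolding M_def inner_self_products[OF U1 Y] orth by simp
    moreover have "mat_inner Ms (Y * Y\<^sup>T) = b\<^sup>2"
      unfolding Ms_def inner_self_products[OF Z1 Y] gram[OF Z1 Y]
      using ZYb by (simp add: inner_sum power2_eq_square)
    ultimately show ?thesis using Y by (simp add: K_def inner_minus_left)
  qed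
  \<comment> \<open>Y Y^T pairs with G to - g and with K to - b^2, so this one multiple meets both
    conditions of \<open>key_inequality\<close>. It is an admissible direction because Y Y^T = Z Y^T
    - a U Y^T.\<close>
  define \<tau> where "\<tau> = - (g / b\<^sup>2)"
  define y where "y = \<tau> \<cdot>\<^sub>m (Y * Y\<^sup>T)"
  have yform: "y = U * ((- (\<tau> * a)) \<cdot>\<^sub>m Y\<^sup>T) + Z * (\<tau> \<cdot>\<^sub>m Y\<^sup>T)"
  proof -
    have "U * ((- (\<tau> * a)) \<cdot>\<^sub>m Y\<^sup>T) + Z * (\<tau> \<cdot>\<^sub>m Y\<^sup>T) = \<tau> \<cdot>\<^sub>m ((- a) \<cdot>\<^sub>m (U * Y\<^sup>T) + Z * Y\<^sup>T)"
      using U1 Z1 Y by (simp add: mult_smult_distrib[of _ n 1 _ n])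
        (intro eq_matI; auto simp: algebra_simps)
    also have "(- a) \<cdot>\<^sub>m (U * Y\<^sup>T) + Z * Y\<^sup>T = ((- a) \<cdot>\<^sub>m U + Z) * Y\<^sup>T"
      using U1 Z1 Y by (simp add: add_mult_distrib_mat[of _ n 1 _ _ n] mult_smult_assoc_mat[of _ n 1 _ n])
    also have "(- a) \<cdot>\<^sub>m U + Z = Y" unfolding Y_def using U1 Z1 by (auto intro!: eq_matI)
    finally show ?thesis by (simp add: y_def)
  qed
  have "(1 - \<delta>\<^sup>2) * S + mat_inner y y \<le> 2 * g"
  proof (rule key_inequality[OF _ _ yform])
    show "mat_inner G y = mat_inner y y"
      unfolding y_def using Y b by (simp add: inner_linear GY YY \<tau>_def power2_eq_square)
    show "mat_inner K y = g"
      unfolding y_def using Y b by (simp add: inner_linear KY \<tau>_def)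
  qed (use Y r in auto)
  moreover have "mat_inner y y = (g / b)\<^sup>2"
    unfolding y_def using Y b by (simp add: inner_linear YY \<tau>_def power2_eq_square)
  ultimately have le: "(1 - \<delta>\<^sup>2) * S + (g / b)\<^sup>2 \<le> 2 * (g / b) * b" using b by simp
  have ZZ: "mat_inner Z Z = a\<^sup>2 * m + b"
  proof -
    have "mat_inner Z (Y + a \<cdot>\<^sub>m U) = b + a * mat_inner Z U"
      using Y r by (simp add: inner_linear ZYb)
    also have "Y + a \<cdot>\<^sub>m U = Z" unfolding Y_def using U1 Z1 by (auto intro!: eq_matI)
    also have "mat_inner Z U = a * m" using inner_commute[of Z U] am by simp
    finally show ?thesis by (simp add: power2_eq_square)
  qed
  have "S = (m - a\<^sup>2 * m)\<^sup>2 + 2 * (a\<^sup>2 * m) * b + b\<^sup>2"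
  proof -
    have "mat_inner M M = m\<^sup>2" "mat_inner Ms Ms = (a\<^sup>2 * m + b)\<^sup>2" "mat_inner M Ms = (a * m)\<^sup>2"
      unfolding M_def Ms_def inner_self_products[OF U1 U1] inner_self_products[OF Z1 Z1] inner_self_products[OF U1 Z1]
        gram[OF U1 U1] gram[OF Z1 Z1] gram[OF U1 Z1] am ZZ
      by (simp_all add: inner_sum m_def power2_eq_square)
    then show ?thesis unfolding S_expand by (simp add: power2_eq_square algebra_simps)
  qed
  then show False
    using rank_one_arithmetic[of \<delta> m "a\<^sup>2 * m" b S "g / b"] delta d m b le g0 g_le
    by (simp add: pos_divide_le_eq)
qed

text \<open>The direction is the part N of Ms orthogonal to M in the matrix inner product, with
  \<nu> = |N|^2. It is a combination of U U^T and Z Z^T for every rank; G is orthogonal to M, so <G,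
  N> = - g, and <K, N> = - \<nu>.\<close>

lemma projected_inequality:
  assumes m: "mat_inner M M > 0"
  defines "\<nu> \<equiv> mat_inner Ms Ms - (mat_inner M Ms)\<^sup>2 / mat_inner M M"
  assumes S0: "S \<noteq> 0"
  shows "\<nu> > 0" "(1 - \<delta>\<^sup>2) * S + g\<^sup>2 / \<nu> \<le> 2 * g"
proof -
  define c where "c = mat_inner M Ms / mat_inner M M"
  define N where "N = Ms - c \<cdot>\<^sub>m M"
  have N: "N \<in> carrier_mat n n" using M by (simp add: N_def minus_carrier_mat)
  have MsM: "mat_inner Ms M = mat_inner M Ms" by (rule inner_commute) auto
  have NM: "mat_inner M N = 0" using m by (simp add: N_def inner_linear c_def)
  have NMs: "mat_inner Ms N = \<nu>"
    by (simp add: N_def inner_linear c_def \<nu>_def MsM power2_eq_square)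
  have NN: "mat_inner N N = \<nu>"
  proof -
    have "mat_inner N N = mat_inner Ms N - c * mat_inner M N"
      using N by (simp add: N_def inner_minus_left inner_smult_left)
    then show ?thesis by (simp add: NM NMs)
  qed
  have GN: "mat_inner G N = - g" by (simp add: N_def inner_linear inner_G_M g_def)
  have g0: "g > 0" using S0 S_pos_imp by force
  show \<nu>: "\<nu> > 0"
  proof (rule ccontr)
    assume "\<not> \<nu> > 0"
    then have "mat_inner N N = 0" using NN inner_self_nonneg[of N] by linarith
    then have "N = 0\<^sub>m n n" using norm_eq_0D[OF _ N] by (simp add: frob_norm_def)
    then have "mat_inner G N = 0" by simp
    with GN g0 show False by simp
  qed
  define \<tau> where "\<tau> = - (g / \<nu>)"
  define y where "y = \<tau> \<cdot>\<^sub>m N"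
  have yform: "y = U * ((- (\<tau> * c)) \<cdot>\<^sub>m U\<^sup>T) + Z * (\<tau> \<cdot>\<^sub>m Z\<^sup>T)"
    unfolding y_def N_def M_def Ms_def using U Z
    by (simp add: mult_smult_distrib[of _ n r _ n]) (intro eq_matI; auto simp: algebra_simps)
  have "(1 - \<delta>\<^sup>2) * S + mat_inner y y \<le> 2 * g"
  proof (rule key_inequality[OF _ _ yform])
    show "mat_inner G y = mat_inner y y"
      unfolding y_def using N \<nu> by (simp add: inner_linear GN NN \<tau>_def)
    show "mat_inner K y = g"
      unfolding y_def K_def using N \<nu> by (simp add: inner_linear NM NMs \<tau>_def)
  qed (use U Z in auto)
  moreover have "mat_inner y y = g\<^sup>2 / \<nu>"
    unfolding y_def using N \<nu> by (simp add: inner_linear NN \<tau>_def power2_eq_square)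
  ultimately show "(1 - \<delta>\<^sup>2) * S + g\<^sup>2 / \<nu> \<le> 2 * g" by simp
qed

section \<open>The Gram matrix of U and the correlation bound\<close>

definition T where "T = U\<^sup>T * U"

lemma T: "T \<in> carrier_mat r r" using U by (simp add: T_def)

text \<open>U would map a kernel vector of T to 0, against \<open>sig2 > 0\<close>.\<close>

lemma gram_inverse:
  assumes s: "sig2 > 0"
  obtains Ti where "Ti \<in> carrier_mat r r" "T * Ti = 1\<^sub>m r"
proof -
  have "det T \<noteq> 0"
  proof
    assume "det T = 0"
    then obtain v where v: "v \<in> carrier_vec r" "v \<noteq> 0\<^sub>v r" "T *\<^sub>v v = 0\<^sub>v r"
      using det_0_iff_vec_prod_zero_field[OF T] by blast
    define x :: "real mat" where "x = mat r 1 (\<lambda>(i, _). v $ i)"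
    have x: "x \<in> carrier_mat r 1" by (simp add: x_def)
    have "T * x = 0\<^sub>m r 1"
    proof (rule eq_matI)
      fix i j assume ij: "i < dim_row (0\<^sub>m r 1 :: real mat)" "j < dim_col (0\<^sub>m r 1 :: real mat)"
      have "col x j = v" using v ij by (intro eq_vecI) (auto simp: x_def)
      then have "(T * x) $$ (i, j) = row T i \<bullet> v" using ij T x by simp
      also have "\<dots> = (T *\<^sub>v v) $ i" using ij T by simp
      finally show "(T * x) $$ (i, j) = 0\<^sub>m r 1 $$ (i, j)" using ij v(3) by simp
    qed (use T x in auto)
    moreover have "mat_inner (U * x) (U * x) = mat_inner x (T * x)"
      using U x by (subst inner_mult_left) (auto simp: T_def mult_assoc_dim)
    ultimately have "mat_inner (U * x) (U * x) = 0" using x by simp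
    with sig2_le[OF x] s have "mat_inner x x = 0"
      using inner_self_nonneg[of x] by (simp add: mult_le_0_iff)
    then have "x = 0\<^sub>m r 1" using norm_eq_0D[OF _ x] by (simp add: frob_norm_def)
    then have "x $$ (i, 0) = 0" if "i < r" for i using that by simp
    then have "v = 0\<^sub>v r" using v by (intro eq_vecI) (auto simp: x_def)
    with v show False by simp
  qed
  from det_non_zero_imp_unit[OF T this] show ?thesis
    using that by (auto simp: Units_def ring_mat_def)
qed

text \<open>The squared singular values sum to |U|^2; the bound for single vectors is applied to the
  columns of the identity.\<close>

lemma sig2_le_gram: "sig2 * real r \<le> mat_inner U U"
proof -
  have "sig2 * mat_inner (1\<^sub>m r) (1\<^sub>m r) \<le> mat_inner (U * 1\<^sub>m r) (U * 1\<^sub>m r)"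
    by (rule norm_mult_ge[OF U one_carrier_mat sig2_le])
  moreover have "mat_inner (1\<^sub>m r) (1\<^sub>m r) = real r"
    by (simp add: inner_sum if_distrib[of "\<lambda>x. x * _"] sum.delta cong: if_cong)
  ultimately show ?thesis using U by simp
qed

text \<open>Cauchy-Schwarz for the trace of A^T A against the identity, whose norm is sqrt
  r.\<close>

lemma norm_sq_le_gram:
  assumes "A \<in> carrier_mat n r"
  shows "mat_inner A A \<le> sqrt (real r) * frob_norm (A * A\<^sup>T)"
proof -
  have "mat_inner A A = mat_inner (A * 1\<^sub>m r) A" using assms by simp
  also have "\<dots> = mat_inner (1\<^sub>m r) (A\<^sup>T * A)" using assms by (subst inner_mult_left) auto
  also have "\<dots> \<le> frob_norm (1\<^sub>m r) * frob_norm (A\<^sup>T * A)"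
    using inner_Cauchy_Schwarz[of "1\<^sub>m r" "A\<^sup>T * A"] assms by simp
  also have "frob_norm (1\<^sub>m r) = sqrt (real r)"
    by (simp add: frob_norm_def inner_sum if_distrib[of "\<lambda>x. x * _"] sum.delta cong: if_cong)
  finally show ?thesis by (simp add: norm_mult_self_transpose)
qed

text \<open>The factors sqrt r cancel: sig2 * sqrt r \<le> |M|, whereas |Z|^2 \<le> sqrt r * |Ms|.
  This is why the correlation constant is independent of r.\<close>

lemma g_le_norms:
  assumes r: "r \<ge> 1"
  shows "g \<le> (1 + \<delta>) * frob_norm M * frob_norm Ms"
proof (cases "sig2 = 0")
  case True
  then have "g \<le> 0" using g_le_of_sig2_zero[OF r] by simp
  also have "0 \<le> (1 + \<delta>) * frob_norm M * frob_norm Ms" using delta by simp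
  finally show ?thesis .
next
  case False
  with sig2_nonneg[OF r] have s: "sig2 > 0" by simp
  obtain Ti where Ti: "Ti \<in> carrier_mat r r" "T * Ti = 1\<^sub>m r" by (rule gram_inverse[OF s])
  \<comment> \<open>Least squares coefficients: U A is the orthogonal projection of Z onto the
    column space of U.\<close>
  define A where "A = Ti * (U\<^sup>T * Z)"
  define Y where "Y = Z - U * A"
  have A: "A \<in> carrier_mat r r" using Ti U Z by (simp add: A_def)
  have Y: "Y \<in> carrier_mat n r" using U A by (simp add: Y_def minus_carrier_mat)
  have ZY: "Z = U * A + Y" unfolding Y_def using U A Z by (intro eq_matI) auto
  have "U\<^sup>T * (U * A) = T * Ti * (U\<^sup>T * Z)"
    using Ti(1) U Z by (simp add: A_def T_def mult_assoc_dim)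
  then have UUA: "U\<^sup>T * (U * A) = U\<^sup>T * Z" using U Z by (simp add: Ti(2))
  have orth: "U\<^sup>T * Y = 0\<^sub>m r r"
  proof -
    have "U\<^sup>T * Y = U\<^sup>T * Z - U\<^sup>T * (U * A)"
      unfolding Y_def using U Z A by (intro mult_minus_distrib_mat[of _ r n _ r]) auto
    then show ?thesis using U Z by (simp add: UUA)
  qed
  have YU: "Y\<^sup>T * (U * A) = 0\<^sub>m r r"
  proof -
    have "Y\<^sup>T * (U * A) = (U\<^sup>T * Y)\<^sup>T * A" using U Y A by (simp add: transpose_mult_dim mult_assoc_dim)
    then show ?thesis using A by (simp add: orth)
  qed
  have "mat_inner (U * A) Y = mat_inner A (U\<^sup>T * Y)" using U A Y by (subst inner_mult_left) auto
  then have UAY: "mat_inner (U * A) Y = 0" using A by (simp add: orth)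
  have "mat_inner Z Z = mat_inner (U * A + Y) (U * A + Y)" using ZY by simp
  also have "\<dots> = mat_inner (U * A) (U * A) + mat_inner Y Y"
    using UAY inner_commute[of Y "U * A"] U A Y by (simp add: inner_linear)
  finally have YZ: "mat_inner Y Y \<le> mat_inner Z Z" by simp
  define q where "q = sqrt (real r)"
  have q: "q > 0" "q * q = real r" using r by (auto simp: q_def)
  have "sig2 * q * q \<le> q * frob_norm M"
    using sig2_le_gram norm_sq_le_gram[OF U] q by (simp add: M_def q_def[symmetric] mult.assoc)
  then have sq: "sig2 * q \<le> frob_norm M" using q by simp
  have "g \<le> (1 + \<delta>) * (sig2 * mat_inner Y Y)" by (rule g_le[OF r A Y ZY orth])
  also have "\<dots> \<le> (1 + \<delta>) * (sig2 * mat_inner Z Z)"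
    using YZ s delta by (intro mult_left_mono) auto
  also have "\<dots> \<le> (1 + \<delta>) * (sig2 * (q * frob_norm Ms))"
    using norm_sq_le_gram[OF Z] s delta unfolding Ms_def q_def by (intro mult_left_mono) auto
  also have "\<dots> = (1 + \<delta>) * ((sig2 * q) * frob_norm Ms)" by simp
  also have "\<dots> \<le> (1 + \<delta>) * (frob_norm M * frob_norm Ms)"
    using sq delta by (intro mult_left_mono mult_right_mono) auto
  finally show ?thesis by simp
qed

lemma correlation:
  assumes r: "r \<ge> 1" and d: "\<delta> < 1/2"
  shows "(1 - 2 * \<delta>) / 3 * frob_norm M * frob_norm Ms \<le> mat_inner M Ms"
proof (rule ccontr)
  assume "\<not> ?thesis"
  then have lt: "mat_inner M Ms < (1 - 2 * \<delta>) / 3 * (frob_norm M * frob_norm Ms)" by simp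
  define m k q where "m = frob_norm M" and "k = frob_norm Ms" and "q = mat_inner M Ms"
  have sq: "mat_inner M M = m\<^sup>2" "mat_inner Ms Ms = k\<^sup>2" by (simp_all add: m_def k_def frob_norm_sq)
  have q0: "q \<ge> 0" by (simp add: q_def inner_M_Ms)
  have mk: "m \<ge> 0" "k \<ge> 0" by (simp_all add: m_def k_def)
  \<comment> \<open>The assumed inequality is strict and q \<ge> 0, so neither matrix is
    zero.\<close>
  have "0 < (1 - 2 * \<delta>) / 3 * (m * k)" using lt q0 by (simp add: q_def m_def k_def)
  then have m: "m > 0" and k: "k > 0" using mk by (auto simp: order.order_iff_strict)
  have S0: "S \<noteq> 0"
  proof
    assume "S = 0"
    then have "M = Ms" by (rule S_zeroD)
    then have "q = mat_inner M M" "k = m" by (simp_all add: q_def k_def m_def)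
    then have "q = m\<^sup>2" "k = m" by (simp_all add: sq)
    then have "m * m < (1 - 2 * \<delta>) / 3 * (m * m)"
      using lt by (simp add: q_def[symmetric] m_def[symmetric] k_def[symmetric] power2_eq_square)
    moreover have "(1 - 2 * \<delta>) / 3 * (m * m) \<le> 1 * (m * m)" using delta by (intro mult_right_mono) auto
    ultimately show False by simp
  qed
  have g0: "g > 0" using S0 S_pos_imp by force
  have m2: "mat_inner M M > 0" using m by (simp add: sq)
  define \<nu> where "\<nu> = k\<^sup>2 - q\<^sup>2 / m\<^sup>2"
  have \<nu>: "\<nu> > 0" "(1 - \<delta>\<^sup>2) * S + g\<^sup>2 / \<nu> \<le> 2 * g"
    using projected_inequality[OF m2 S0] unfolding \<nu>_def sq q_def[symmetric] by auto
  \<comment> \<open>Replacing \<nu> by the larger k^2 leaves an inequality in the norms and q alone,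
    with p = g / k.\<close>
  have "g\<^sup>2 / k\<^sup>2 \<le> g\<^sup>2 / \<nu>" using \<nu>(1) k by (intro divide_left_mono mult_pos_pos) (auto simp: \<nu>_def)
  with \<nu> have "(1 - \<delta>\<^sup>2) * S + (g / k)\<^sup>2 \<le> 2 * (g / k) * k" using k by (simp add: power_divide)
  moreover have "g / k \<le> (1 + \<delta>) * m"
    using g_le_norms[OF r] k by (simp add: pos_divide_le_eq m_def k_def)
  ultimately show False
    using correlation_arithmetic[of \<delta> m k S q "g / k"] delta d m k g0 lt
    by (simp add: S_expand sq q_def[symmetric] m_def[symmetric] k_def[symmetric])
qed

text \<open>
  The alignment of Z makes the distance of M and Ms a sum of two nonnegative terms; the second one
  is matched with the curvature bound for g.
\<close>
lemma aligned_recovery: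
  assumes r: "r \<ge> 1" and d: "\<delta> \<le> 1/3" and s: "sig2 > 0"
    and E: "E \<in> carrier_mat n r" "E\<^sup>T * E = 1\<^sub>m r" and L: "L \<in> carrier_mat r r" "U = E * L\<^sup>T"
    and Li: "Li \<in> carrier_mat r r" "L * Li = 1\<^sub>m r" "Li * L = 1\<^sub>m r"
    and sym: "(E\<^sup>T * Z)\<^sup>T = E\<^sup>T * Z"
  shows "M = Ms"
proof (rule S_zeroD, rule ccontr)
  assume S0: "S \<noteq> 0"
  have g0: "g > 0" using S0 S_pos_imp by force
  define X where "X = E\<^sup>T * Z"
  have X: "X \<in> carrier_mat r r" "X\<^sup>T = X" using E Z sym by (auto simp: X_def)
  define Y where "Y = Z - E * X"
  have Y: "Y \<in> carrier_mat n r" using E X by (simp add: Y_def minus_carrier_mat)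
  have EY: "E\<^sup>T * Y = 0\<^sub>m r r"
  proof -
    have "E\<^sup>T * Y = E\<^sup>T * Z - E\<^sup>T * (E * X)"
      unfolding Y_def using E Z X by (intro mult_minus_distrib_mat[of _ r n _ r]) auto
    also have "E\<^sup>T * (E * X) = E\<^sup>T * E * X" using E(1) X by (simp add: mult_assoc_dim)
    also have "\<dots> = X" using X by (simp add: E(2))
    finally show ?thesis using X by (simp add: X_def[symmetric])
  qed
  have UY: "U\<^sup>T * Y = 0\<^sub>m r r"
  proof -
    have "U\<^sup>T * Y = L * (E\<^sup>T * Y)" using E L Y by (simp add: L(2) transpose_mult_dim mult_assoc_dim)
    then show ?thesis using L by (simp add: EY)
  qed
  have LLt: "L\<^sup>T * Li\<^sup>T = 1\<^sub>m r" using L Li by (simp add: transpose_mult_dim[symmetric])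
  have EU: "E = U * Li\<^sup>T"
    using E L Li by (simp add: L(2) mult_assoc_dim LLt)
  have ZY: "Z = U * (Li\<^sup>T * X) + Y"
  proof -
    have "U * (Li\<^sup>T * X) = E * X" using U Li X by (simp add: EU mult_assoc_dim)
    then show ?thesis unfolding Y_def using E X Z by (auto intro!: eq_matI)
  qed
  \<comment> \<open>From here on r-by-r matrices: D has the norm of M, and Q + W is the Gram matrix
    of Z. Symmetry of X lets the same Q = X X occur in both \<open>MMs\<close> and
    \<open>ZZ\<close>.\<close>
  define W where "W = Y\<^sup>T * Y"
  define D where "D = L\<^sup>T * L"
  define Q where "Q = X * X"
  have W: "W \<in> carrier_mat r r" and D: "D \<in> carrier_mat r r" and Q: "Q \<in> carrier_mat r r"
    using Y L X by (auto simp: W_def D_def Q_def)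
  have MM: "mat_inner M M = mat_inner D D"
  proof -
    have "U\<^sup>T * U = L * (E\<^sup>T * E) * L\<^sup>T"
      using E(1) L by (simp add: L(2) transpose_mult_dim mult_assoc_dim)
    also have "\<dots> = L * L\<^sup>T" using L by (simp add: E(2))
    finally have "frob_norm M = frob_norm D"
      using norm_mult_self_transpose[of U] norm_mult_self_transpose[of L] by (simp add: M_def D_def)
    then show ?thesis by (simp add: frob_norm_sq[symmetric])
  qed
  have MMs: "mat_inner M Ms = mat_inner D Q"
  proof -
    have "U\<^sup>T * Z = L * X" using E L Z by (simp add: L(2) X_def transpose_mult_dim mult_assoc_dim)
    moreover have "mat_inner (L\<^sup>T * L\<^sup>T\<^sup>T) (X * X\<^sup>T) = mat_inner (L\<^sup>T\<^sup>T * X) (L\<^sup>T\<^sup>T * X)"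
      using L X by (intro inner_self_products) auto
    ultimately show ?thesis by (simp add: inner_M_Ms D_def Q_def X(2))
  qed
  have ZZ: "Z\<^sup>T * Z = Q + W"
  proof -
    have Zt: "Z = E * X + Y" unfolding Y_def using E X Z by (auto intro!: eq_matI)
    have EX: "E * X \<in> carrier_mat n r" using E X by simp
    have "Z\<^sup>T * Z = (E * X + Y)\<^sup>T * (E * X + Y)" by (simp only: Zt[symmetric])
    also have "(E * X + Y)\<^sup>T = (E * X)\<^sup>T + Y\<^sup>T" by (rule transpose_add[OF EX Y])
    finally have "Z\<^sup>T * Z = ((E * X)\<^sup>T + Y\<^sup>T) * (E * X + Y)" .
    also have "\<dots> = (E * X)\<^sup>T * (E * X) + (E * X)\<^sup>T * Y + (Y\<^sup>T * (E * X) + Y\<^sup>T * Y)"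
      using EX Y by (simp add: add_mult_distrib_mat[of _ r n _ _ r] mult_add_distrib_mat[of _ r n _ r])
        (intro eq_matI; auto)
    also have "(E * X)\<^sup>T * (E * X) = X\<^sup>T * (E\<^sup>T * E * X)" using E(1) X(1) by (simp add: transpose_mult_dim mult_assoc_dim)
    also have "\<dots> = Q" using X by (simp add: E(2) Q_def)
    also have "(E * X)\<^sup>T * Y = X\<^sup>T * (E\<^sup>T * Y)" using E(1) X(1) Y by (simp add: transpose_mult_dim mult_assoc_dim)
    also have "\<dots> = 0\<^sub>m r r" using X by (simp add: EY)
    also have "Y\<^sup>T * (E * X) = (E\<^sup>T * Y)\<^sup>T * X" using E X Y by (simp add: transpose_mult_dim mult_assoc_dim)
    also have "\<dots> = 0\<^sub>m r r" using X by (simp add: EY)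
    finally show ?thesis using Q W by (simp add: W_def)
  qed
  have MsMs: "mat_inner Ms Ms = mat_inner (Q + W) (Q + W)"
    using norm_mult_self_transpose[of Z] by (simp add: Ms_def frob_norm_sq[symmetric] ZZ)
  define R where "R = D - Q - W"
  have R: "R \<in> carrier_mat r r" using W by (simp add: R_def minus_carrier_mat)
  define w where "w = mat_inner D W"
  \<comment> \<open><M, Ms> sees Q but not W, so |K|^2 exceeds |R|^2 by 2 <D, W>.\<close>
  have S_eq: "S = mat_inner R R + 2 * w"
    using W D Q inner_commute[of W D] inner_commute[of Q D] inner_commute[of W Q]
    by (simp add: S_expand MM MMs MsMs R_def w_def inner_linear)
  \<comment> \<open>L inherits the lower bound of U: |x|^2 = <L x, v> for v = Li^T x, and U v = E x
    has the norm of x, which bounds |v|; Cauchy-Schwarz then bounds |L x| from below.\<close>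
  have sigL: "sig2 * mat_inner x x \<le> mat_inner (L * x) (L * x)" if x: "x \<in> carrier_mat r 1" for x
  proof -
    define z where "z = L * x"
    have z: "z \<in> carrier_mat r 1" using L x by (simp add: z_def)
    have xz: "x = Li * z" using L Li x by (simp add: z_def mult_assoc_dim[symmetric])
    define v where "v = Li\<^sup>T * x"
    have v: "v \<in> carrier_mat r 1" using Li x by (simp add: v_def)
    have "U * v = E * x" using U Li x by (simp add: v_def EU mult_assoc_dim)
    moreover have "mat_inner (E * x) (E * x) = mat_inner x x"
      using E x by (subst inner_mult_left) (auto simp: mult_assoc_dim[symmetric] E(2))
    ultimately have v_le: "sig2 * mat_inner v v \<le> mat_inner x x" using sig2_le[OF v] by simp
    have "mat_inner x x = mat_inner (Li * z) x" using xz by simp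
    also have "\<dots> = mat_inner z v" using Li z x by (subst inner_mult_left) (auto simp: v_def)
    also have "\<dots> \<le> frob_norm z * frob_norm v"
      using inner_Cauchy_Schwarz[of z v] z v by simp
    finally have "(mat_inner x x)\<^sup>2 \<le> (frob_norm z * frob_norm v)\<^sup>2" by (intro power_mono) auto
    then have "mat_inner x x * mat_inner x x \<le> mat_inner z z * mat_inner v v"
      by (simp add: power_mult_distrib frob_norm_sq power2_eq_square[of "mat_inner x x"])
    then have "sig2 * (mat_inner x x * mat_inner x x) \<le> sig2 * (mat_inner z z * mat_inner v v)"
      using s by (intro mult_left_mono) auto
    also have "\<dots> = mat_inner z z * (sig2 * mat_inner v v)" by simp
    also have "\<dots> \<le> mat_inner z z * mat_inner x x" by (intro mult_left_mono v_le) simp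
    finally have "(sig2 * mat_inner x x) * mat_inner x x \<le> mat_inner z z * mat_inner x x" by simp
    then show ?thesis
      by (cases "mat_inner x x = 0") (auto simp: z_def mult_le_cancel_right less_le)
  qed
  have w_ge: "sig2 * mat_inner Y Y \<le> w"
  proof -
    have "sig2 * mat_inner Y\<^sup>T Y\<^sup>T \<le> mat_inner (L * Y\<^sup>T) (L * Y\<^sup>T)"
      using Y by (intro norm_mult_ge[OF L(1) _ sigL]) auto
    also have "\<dots> = mat_inner (L\<^sup>T * L\<^sup>T\<^sup>T) (Y\<^sup>T * Y\<^sup>T\<^sup>T)"
      using inner_self_products[of "L\<^sup>T" r r "Y\<^sup>T" n] L Y by simp
    finally show ?thesis by (simp add: w_def D_def W_def inner_transpose)
  qed
  have "g \<le> (1 + \<delta>) * (sig2 * mat_inner Y Y)"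
    using Li X by (intro g_le[OF r _ Y ZY UY]) auto
  also have "\<dots> \<le> (1 + \<delta>) * w" using w_ge delta by (intro mult_left_mono) auto
  finally have g_w: "g \<le> (1 + \<delta>) * w" .
  then have w0: "w > 0" using g0 delta by (smt (verit) mult_nonneg_nonpos)
  have "(1 + \<delta>) * w \<le> (4/3) * w" using d w0 by (intro mult_right_mono) auto
  with g_w have g43: "g \<le> 4/3 * w" by simp
  have "(2/3) * S \<le> (1 - \<delta>) * S" using d S_nonneg by (intro mult_right_mono) auto
  with S_le_g have g23: "2/3 * S \<le> g" by simp
  \<comment> \<open>2/3 S \<le> g \<le> 4/3 w together with S = |R|^2 + 2 w leaves only
    equality.\<close>
  have RR: "mat_inner R R = 0" using S_eq g43 g23 inner_self_nonneg[of R] by linarith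
  then have S_w: "S = 2 * w" by (simp add: S_eq)
  with g43 g23 have g_eq_w: "g = 4/3 * w" by linarith
  have m: "mat_inner M M > 0"
  proof (rule ccontr)
    assume "\<not> ?thesis"
    then have "mat_inner D D = 0" using MM inner_self_nonneg[of M] by linarith
    then have "D = 0\<^sub>m r r" using norm_eq_0D[OF _ D] by (simp add: frob_norm_def)
    then have "w = 0" using W by (simp add: w_def)
    with w0 show False by simp
  qed
  \<comment> \<open>The equality case: the inequality along the part of Ms orthogonal to M forces
    <M, K> = 0, whereas R = 0 gives <M, K> = w > 0.\<close>
  define \<mu> where "\<mu> = mat_inner M M"
  define q where "q = mat_inner M Ms"
  define \<nu> where "\<nu> = mat_inner Ms Ms - q\<^sup>2 / \<mu>"
  have \<nu>: "\<nu> > 0" "(1 - \<delta>\<^sup>2) * S + g\<^sup>2 / \<nu> \<le> 2 * g"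
    using projected_inequality[OF m S0] unfolding \<nu>_def \<mu>_def q_def by auto
  have "\<delta>\<^sup>2 \<le> (1/3)\<^sup>2" using d delta by (intro power_mono) auto
  then have "(8/9) * S \<le> (1 - \<delta>\<^sup>2) * S" using S_nonneg by (intro mult_right_mono) (auto simp: power2_eq_square)
  with \<nu>(2) have "(8/9) * S + g\<^sup>2 / \<nu> \<le> 2 * g" by linarith
  then have "g\<^sup>2 / \<nu> \<le> 8/9 * w" unfolding S_w using g_eq_w by linarith
  then have "16 * (w * w) \<le> 8 * (w * \<nu>)"
    using \<nu>(1) by (simp add: pos_divide_le_eq g_eq_w power2_eq_square)
  then have "S \<le> \<nu>" using w0 S_w by simp
  moreover have "S = \<nu> + (\<mu> - q)\<^sup>2 / \<mu>"
    using m by (simp add: S_expand \<nu>_def \<mu>_def[symmetric] q_def[symmetric] field_simps power2_eq_square)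
  ultimately have "(\<mu> - q)\<^sup>2 / \<mu> \<le> 0" by simp
  then have "\<mu> = q" using m by (simp add: \<mu>_def[symmetric] divide_le_0_iff)
  moreover have "\<mu> - q = mat_inner D R + w"
    using D Q W by (simp add: \<mu>_def q_def MM MMs R_def w_def inner_linear)
  moreover have "mat_inner D R = 0"
    using inner_Cauchy_Schwarz[of D R] D R by (simp add: frob_norm_def RR)
  ultimately show False using w0 by simp
qed

text \<open>Orthonormalizes the columns of U: if T = L L^T, then Li = L^T Ti is the inverse of L,
  and E = U Li^T has Gram matrix Li T Li^T = 1.\<close>

lemma orthonormal_factor:
  assumes s: "sig2 > 0"
  obtains E L Li where "E \<in> carrier_mat n r" "E\<^sup>T * E = 1\<^sub>m r" "L \<in> carrier_mat r r" "U = E * L\<^sup>T"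
    "Li \<in> carrier_mat r r" "L * Li = 1\<^sub>m r" "Li * L = 1\<^sub>m r"
proof -
  have Tt: "T\<^sup>T = T" unfolding T_def by (simp add: transpose_mult_dim)
  have "psd_form r T"
    unfolding psd_form_def
  proof
    fix v :: "real vec" assume v: "v \<in> carrier_vec r"
    have "v \<bullet> (T *\<^sub>v v) = v \<bullet> (U\<^sup>T *\<^sub>v (U *\<^sub>v v))"
      using U v by (simp add: T_def assoc_mult_mat_vec[of _ r n _ r])
    also have "\<dots> = (U *\<^sub>v v) \<bullet> (U *\<^sub>v v)"
      using transpose_vec_mult_scalar[OF U v, of "U *\<^sub>v v"] U v comm_scalar_prod[of v r "U\<^sup>T *\<^sub>v (U *\<^sub>v v)"]
      by simp
    also have "\<dots> \<ge> 0" by (simp add: scalar_prod_def sum_nonneg)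
    finally show "0 \<le> v \<bullet> (T *\<^sub>v v)" .
  qed
  then obtain L where L: "L \<in> carrier_mat r r" "T = L * L\<^sup>T"
    using psd_factorization[OF T Tt _ vec_space.rank_le_nc[OF T]] by blast
  obtain Ti where Ti: "Ti \<in> carrier_mat r r" "T * Ti = 1\<^sub>m r" by (rule gram_inverse[OF s])
  define Li where "Li = L\<^sup>T * Ti"
  have Li: "Li \<in> carrier_mat r r" using L Ti by (simp add: Li_def)
  have "L * Li = L * L\<^sup>T * Ti"
    unfolding Li_def using L(1) Ti(1) by (intro mult_assoc_dim[symmetric]) auto
  then have LLi: "L * Li = 1\<^sub>m r" using Ti(2) by (simp add: L(2)[symmetric])
  then have LiL: "Li * L = 1\<^sub>m r" using mat_mult_left_right_inverse[OF L(1) Li] by simp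
  define E where "E = U * Li\<^sup>T"
  have E: "E \<in> carrier_mat n r" using U Li by (simp add: E_def)
  have "E\<^sup>T * E = Li * (T * Li\<^sup>T)" using U Li by (simp add: E_def T_def transpose_mult_dim mult_assoc_dim)
  also have "\<dots> = (Li * L) * (Li * L)\<^sup>T" using L(1) Li by (simp add: L(2) transpose_mult_dim mult_assoc_dim)
  finally have EE: "E\<^sup>T * E = 1\<^sub>m r" by (simp add: LiL)
  have "E * L\<^sup>T = U * (L * Li)\<^sup>T" using U L(1) Li by (simp add: E_def transpose_mult_dim mult_assoc_dim)
  then have "U = E * L\<^sup>T" using U by (simp add: LLi)
  then show ?thesis by (rule that[OF E EE L(1) _ Li LLi LiL])
qed

end

subsection \<open>Alignment by an orthogonal matrix\<close>

text \<open>Bolzano-Weierstrass, one coordinate at a time by monotone subsequences.\<close>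

lemma finite_bounded_subsequence:
  fixes x :: "nat \<Rightarrow> 'i \<Rightarrow> real"
  assumes "finite I" "\<And>n i. i \<in> I \<Longrightarrow> \<bar>x n i\<bar> \<le> B"
  shows "\<exists>s. strict_mono s \<and> (\<forall>i\<in>I. convergent (\<lambda>n. x (s n) i))"
  using assms
proof (induction I)
  case empty
  show ?case by (intro exI[of _ id]) (auto simp: strict_mono_def)
next
  case (insert i I)
  then obtain s where s: "strict_mono s" "\<forall>j\<in>I. convergent (\<lambda>n. x (s n) j)" by auto
  obtain t where t: "strict_mono t" "monoseq (\<lambda>n. x (s (t n)) i)"
    using seq_monosub[of "\<lambda>n. x (s n) i"] by blast
  have "Bseq (\<lambda>n. x (s (t n)) i)" using insert.prems by (intro BseqI'[of _ B]) auto
  then have "convergent (\<lambda>n. x (s (t n)) i)" using t by (intro Bseq_monoseq_convergent) auto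
  moreover have "convergent (\<lambda>n. x (s (t n)) j)" if "j \<in> I" for j
    using s(2) that convergent_subseq_convergent[OF _ t(1), of "\<lambda>n. x (s n) j"] by (auto simp: o_def)
  ultimately show ?case
    using s(1) t(1) by (intro exI[of _ "\<lambda>n. s (t n)"]) (auto simp: strict_mono_def)
qed

text \<open>Entry functions instead of matrices, because limits are taken entrywise.\<close>

definition orthogonal_entries :: "nat \<Rightarrow> (nat \<Rightarrow> nat \<Rightarrow> real) \<Rightarrow> bool" where
  "orthogonal_entries r Q \<longleftrightarrow>
     (\<forall>k<r. \<forall>k'<r. (\<Sum>l<r. Q k l * Q k' l) = (if k = k' then 1 else 0))"

lemma orthogonal_entries_bound:
  assumes "orthogonal_entries r Q" "k < r" "l < r"
  shows "\<bar>Q k l\<bar> \<le> 1"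
proof -
  have "(Q k l)\<^sup>2 \<le> (\<Sum>l<r. Q k l * Q k l)"
    using member_le_sum[of l "{..<r}" "\<lambda>l. Q k l * Q k l"] assms by (simp add: power2_eq_square)
  also have "\<dots> = 1" using assms by (simp add: orthogonal_entries_def)
  finally show ?thesis by (simp add: abs_square_le_1)
qed

text \<open>Compactness of the orthogonal group: a maximizing sequence has an entrywise convergent
  subsequence, and both orthogonality and the trace pass to the limit.\<close>

lemma trace_maximizer:
  fixes X :: "nat \<Rightarrow> nat \<Rightarrow> real"
  obtains Q where "orthogonal_entries r Q"
    "\<And>P. orthogonal_entries r P \<Longrightarrow> (\<Sum>k<r. \<Sum>l<r. X k l * P l k) \<le> (\<Sum>k<r. \<Sum>l<r. X k l * Q l k)"
proof -
  define \<Phi> where "\<Phi> P = (\<Sum>k<r. \<Sum>l<r. X k l * P l k)" for P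
  define V where "V = \<Phi> ` {P. orthogonal_entries r P}"
  have "orthogonal_entries r (\<lambda>k l. if k = l then 1 else 0)"
    by (auto simp: orthogonal_entries_def if_distrib[of "\<lambda>x. x * _"] sum.delta cong: if_cong)
  then have ne: "V \<noteq> {}" by (auto simp: V_def)
  have le: "\<Phi> P \<le> (\<Sum>k<r. \<Sum>l<r. \<bar>X k l\<bar>)" if P: "orthogonal_entries r P" for P
    unfolding \<Phi>_def
  proof (intro sum_mono)
    fix k l assume "k \<in> {..<r}" "l \<in> {..<r}"
    then have "\<bar>X k l\<bar> * \<bar>P l k\<bar> \<le> \<bar>X k l\<bar> * 1"
      using orthogonal_entries_bound[OF P] by (intro mult_left_mono) auto
    then show "X k l * P l k \<le> \<bar>X k l\<bar>" by (simp add: abs_mult[symmetric])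
  qed
  then have bdd: "bdd_above V" by (auto simp: V_def bdd_above_def)
  have "\<exists>P. orthogonal_entries r P \<and> \<Phi> P > Sup V - inverse (real (Suc n))" for n
  proof -
    have "\<exists>v\<in>V. Sup V - inverse (real (Suc n)) < v"
      using less_cSup_iff[OF ne bdd, of "Sup V - inverse (real (Suc n))"]
      by (simp del: of_nat_Suc)
    then show ?thesis by (auto simp: V_def)
  qed
  then obtain P where P: "\<And>n. orthogonal_entries r (P n)" "\<And>n. \<Phi> (P n) > Sup V - inverse (real (Suc n))"
    by metis
  have bd: "\<bar>P n (fst i) (snd i)\<bar> \<le> 1" if "i \<in> {..<r} \<times> {..<r}" for n i
    using orthogonal_entries_bound[OF P(1)] that by auto
  have "\<exists>s. strict_mono s \<and> (\<forall>i\<in>{..<r} \<times> {..<r}. convergent (\<lambda>n. P (s n) (fst i) (snd i)))"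
    by (rule finite_bounded_subsequence[where x = "\<lambda>n i. P n (fst i) (snd i)" and B = 1]) (simp_all add: bd)
  then obtain s where s: "strict_mono s"
    "\<forall>i\<in>{..<r} \<times> {..<r}. convergent (\<lambda>n. P (s n) (fst i) (snd i))" by (elim exE conjE)
  define Q where "Q k l = lim (\<lambda>n. P (s n) k l)" for k l
  have lim: "(\<lambda>n. P (s n) k l) \<longlonglongrightarrow> Q k l" if "k < r" "l < r" for k l
    unfolding Q_def convergent_LIMSEQ_iff[symmetric] using s(2) that by force
  have Q: "orthogonal_entries r Q"
    unfolding orthogonal_entries_def
  proof (intro allI impI)
    fix k k' assume kk: "k < r" "k' < r"
    have "(\<lambda>n. \<Sum>l<r. P (s n) k l * P (s n) k' l) \<longlonglongrightarrow> (\<Sum>l<r. Q k l * Q k' l)"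
      using kk by (intro tendsto_sum tendsto_mult lim) auto
    moreover have "(\<lambda>n. \<Sum>l<r. P (s n) k l * P (s n) k' l) = (\<lambda>n. if k = k' then 1 else 0)"
      using P(1) kk by (simp add: orthogonal_entries_def)
    ultimately show "(\<Sum>l<r. Q k l * Q k' l) = (if k = k' then 1 else 0)"
      by (simp add: LIMSEQ_const_iff)
  qed
  have L1: "(\<lambda>n. \<Phi> (P (s n))) \<longlonglongrightarrow> \<Phi> Q"
    unfolding \<Phi>_def by (intro tendsto_sum tendsto_mult tendsto_const lim) auto
  have L2: "(\<lambda>n. Sup V - inverse (real (Suc (s n)))) \<longlonglongrightarrow> Sup V - 0"
    using LIMSEQ_subseq_LIMSEQ[OF LIMSEQ_inverse_real_of_nat s(1)]
    by (intro tendsto_diff tendsto_const) (simp add: o_def)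
  have "Sup V - 0 \<le> \<Phi> Q"
    using P(2) by (intro LIMSEQ_le[OF L2 L1]) (auto intro: less_imp_le simp del: of_nat_Suc)
  moreover have "\<Phi> P \<le> Sup V" if "orthogonal_entries r P" for P
    using that bdd by (intro cSup_upper) (auto simp: V_def)
  ultimately show ?thesis using that[OF Q] unfolding \<Phi>_def by force
qed

text \<open>
  At a maximizer Q of tr (X Q) over the orthogonal matrices, the derivative along the plane
  rotations of the columns i and j vanishes.
\<close>
lemma symmetric_after_rotation:
  fixes X :: "real mat"
  assumes X: "X \<in> carrier_mat r r"
  obtains Q where "Q \<in> carrier_mat r r" "Q * Q\<^sup>T = 1\<^sub>m r" "(X * Q)\<^sup>T = X * Q"
proof -
  obtain q where q: "orthogonal_entries r q" and max: "\<And>P. orthogonal_entries r P \<Longrightarrow>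
      (\<Sum>k<r. \<Sum>l<r. X $$ (k, l) * P l k) \<le> (\<Sum>k<r. \<Sum>l<r. X $$ (k, l) * q l k)"
    using trace_maximizer[of r "\<lambda>k l. X $$ (k, l)"] by blast
  define B where "B i j = (\<Sum>l<r. X $$ (i, l) * q l j)" for i j
  have sym: "B i j = B j i" if ij: "i < r" "j < r" "i \<noteq> j" for i j
  proof -
    define \<alpha> \<beta> where "\<alpha> = B i i + B j j" and "\<beta> = B i j - B j i"
    have split: "(\<Sum>l<r. h l) = h i + h j + (\<Sum>l\<in>{..<r} - {i, j}. h l)" for h :: "nat \<Rightarrow> real"
    proof -
      have "{..<r} = insert i (insert j ({..<r} - {i, j}))" using ij by auto
      then have "(\<Sum>l<r. h l) = (\<Sum>l\<in>insert i (insert j ({..<r} - {i, j})). h l)" by simp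
      then show ?thesis using ij(3) by (simp add: add.assoc)
    qed
    have rot: "(c - 1) * \<alpha> - s * \<beta> \<le> 0" if cs: "c\<^sup>2 + s\<^sup>2 = 1" for c s
    proof -
      \<comment> \<open>q with its columns i and j rotated; of the diagonal of X q only the entries
        i and j change.\<close>
      define P where "P k l = (if l = i then c * q k i - s * q k j
        else if l = j then s * q k i + c * q k j else q k l)" for k l
      have "orthogonal_entries r P"
        unfolding orthogonal_entries_def
      proof (intro allI impI)
        fix k k' assume kk: "k < r" "k' < r"
        have "(\<Sum>l<r. P k l * P k' l) = (c * q k i - s * q k j) * (c * q k' i - s * q k' j)
            + (s * q k i + c * q k j) * (s * q k' i + c * q k' j) + (\<Sum>l\<in>{..<r} - {i, j}. q k l * q k' l)"
          using ij(3) by (subst split) (auto simp: P_def intro!: sum.cong)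
        also have "(c * q k i - s * q k j) * (c * q k' i - s * q k' j)
            + (s * q k i + c * q k j) * (s * q k' i + c * q k' j)
            = (c\<^sup>2 + s\<^sup>2) * (q k i * q k' i + q k j * q k' j)"
          by (simp add: power2_eq_square algebra_simps)
        also have "(c\<^sup>2 + s\<^sup>2) * (q k i * q k' i + q k j * q k' j) + (\<Sum>l\<in>{..<r} - {i, j}. q k l * q k' l)
            = (\<Sum>l<r. q k l * q k' l)"
          by (simp add: cs split)
        finally show "(\<Sum>l<r. P k l * P k' l) = (if k = k' then 1 else 0)"
          using q kk by (simp add: orthogonal_entries_def)
      qed
      note max[OF this]
      moreover have "(\<Sum>l<r. X $$ (k, l) * P l k) = (if k = i then c * B i i - s * B i j
          else if k = j then s * B j i + c * B j j else B k k)" for k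
        using ij(3) by (auto simp: P_def B_def sum_distrib_left sum_subtractf sum.distrib algebra_simps)
      moreover have "(\<Sum>k<r. if k = i then c * B i i - s * B i j else if k = j then s * B j i + c * B j j else B k k)
          = (c * B i i - s * B i j) + (s * B j i + c * B j j) + (\<Sum>k\<in>{..<r} - {i, j}. B k k)"
        using ij(3) by (subst split) (auto intro!: sum.cong)
      ultimately have "(c * B i i - s * B i j) + (s * B j i + c * B j j) \<le> B i i + B j j"
        using split[of "\<lambda>k. B k k"] by (simp add: B_def[symmetric])
      then show ?thesis using that by (simp add: \<alpha>_def \<beta>_def algebra_simps)
    qed
    \<comment> \<open>The rotations by the angle x give a function with maximum at 0. The derivative
      of cos vanishes there, so only the asymmetry \<beta> remains.\<close>
    define \<phi> where "\<phi> x = (cos x - 1) * \<alpha> - sin x * \<beta>" for x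
    have "(\<phi> has_real_derivative - \<beta>) (at 0)"
      unfolding \<phi>_def by (auto intro!: derivative_eq_intros)
    moreover have "\<phi> x \<le> \<phi> 0" for x
      unfolding \<phi>_def using rot[of "cos x" "sin x"] by simp
    ultimately have "- \<beta> = 0" using DERIV_local_max[of \<phi> "- \<beta>" 0 1] by simp
    then have "\<beta> = 0" by simp
    then show ?thesis by (simp add: \<beta>_def)
  qed
  define Q where "Q = mat r r (\<lambda>(k, l). q k l)"
  have Q: "Q \<in> carrier_mat r r" by (simp add: Q_def)
  have XQ: "(X * Q) $$ (i, j) = B i j" if "i < r" "j < r" for i j
    using X that by (simp add: Q_def B_def scalar_prod_def atLeast0LessThan)
  show ?thesis
  proof (rule that[OF Q])
    show "Q * Q\<^sup>T = 1\<^sub>m r"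
      using q by (intro eq_matI) (auto simp: Q_def orthogonal_entries_def scalar_prod_def atLeast0LessThan)
    show "(X * Q)\<^sup>T = X * Q"
    proof (rule eq_matI)
      fix i j assume "i < dim_row (X * Q)" "j < dim_col (X * Q)"
      then have ij: "i < r" "j < r" using X Q by auto
      then have "(X * Q)\<^sup>T $$ (i, j) = (X * Q) $$ (j, i)" using X Q by simp
      also have "\<dots> = (X * Q) $$ (i, j)" using XQ ij sym[of i j] by (cases "i = j") auto
      finally show "(X * Q)\<^sup>T $$ (i, j) = (X * Q) $$ (i, j)" .
    qed (use X Q in auto)
  qed
qed

subsection \<open>A spurious critical point at constant 1/2\<close>

lemma sum_reindex_involution:
  assumes "finite I" "\<And>p. p \<in> I \<Longrightarrow> \<pi> p \<in> I" "\<And>p. p \<in> I \<Longrightarrow> \<pi> (\<pi> p) = p"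
  shows "(\<Sum>p\<in>I. h (\<pi> p)) = (\<Sum>p\<in>I. h p)"
  using assms by (intro sum.reindex_bij_witness[of _ \<pi> \<pi>]) auto

lemma inner_sum_pairs:
  assumes "A \<in> carrier_mat m n" "B \<in> carrier_mat m n"
  shows "mat_inner A B = (\<Sum>p\<in>{..<m} \<times> {..<n}. A $$ p * B $$ p)"
proof -
  have "mat_inner A B = (\<Sum>i<m. \<Sum>j<n. A $$ (i, j) * B $$ (i, j))"
    unfolding mat_inner_eq_sum[OF assms] by (rule sum.swap)
  then show ?thesis by (simp add: sum.cartesian_product split_def)
qed

text \<open>
  The quadratic objective with Hessian I + T / 2, where the involution T swaps the two diagonal
  blocks and fixes the off-diagonal ones.
\<close>
context
  fixes r :: nat
begin

definition swap_index :: "nat \<Rightarrow> nat" where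
  "swap_index i = (if i < r then i + r else i - r)"

text \<open>Fixing the off-diagonal blocks gives them eigenvalue 3/2 under \<open>hess_map\<close>,
  the largest that the constant 1/2 permits; the curvature in the escape directions comes from
  there.\<close>

definition swap_entry :: "nat \<times> nat \<Rightarrow> nat \<times> nat" where
  "swap_entry p = (if fst p < r \<longleftrightarrow> snd p < r then (swap_index (fst p), swap_index (snd p)) else p)"

definition swap_blocks :: "real mat \<Rightarrow> real mat" where
  "swap_blocks A = mat (2 * r) (2 * r) (\<lambda>p. A $$ swap_entry p)"

definition hess_map :: "real mat \<Rightarrow> real mat" where
  "hess_map A = A + (1/2) \<cdot>\<^sub>m swap_blocks A"

text \<open>The entries sqrt 2 make the ground truth twice a projection, the factor at which the
  coupling 1/2 cancels the first block of the gradient at the spurious point.\<close>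

definition gt_factor :: "real mat" where
  "gt_factor = mat (2 * r) r (\<lambda>(i, j). if i = j + r then sqrt 2 else 0)"

definition spurious_factor :: "real mat" where
  "spurious_factor = mat (2 * r) r (\<lambda>(i, j). if i = j then 1 else 0)"

definition gt_mat :: "real mat" where
  "gt_mat = gt_factor * gt_factor\<^sup>T"

definition spurious_mat :: "real mat" where
  "spurious_mat = spurious_factor * spurious_factor\<^sup>T"

definition counterexample :: "real mat \<Rightarrow> real" where
  "counterexample X = (1/2) * mat_inner (hess_map (X - gt_mat)) (X - gt_mat)"

section \<open>The involution, a self-adjoint isometry, and the Hessian built from it\<close>

lemma swap_entry_in: "p \<in> {..<2 * r} \<times> {..<2 * r} \<Longrightarrow> swap_entry p \<in> {..<2 * r} \<times> {..<2 * r}"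
  by (auto simp: swap_entry_def swap_index_def)

lemma swap_entry_involution: "p \<in> {..<2 * r} \<times> {..<2 * r} \<Longrightarrow> swap_entry (swap_entry p) = p"
  by (auto simp: swap_entry_def swap_index_def prod_eq_iff)

lemma swap_blocks_carrier [simp]: "swap_blocks A \<in> carrier_mat (2 * r) (2 * r)"
  by (simp add: swap_blocks_def)

lemma swap_blocks_dim [simp]: "dim_row (swap_blocks A) = 2 * r" "dim_col (swap_blocks A) = 2 * r"
  by (simp_all add: swap_blocks_def)

lemma swap_blocks_index: "p \<in> {..<2 * r} \<times> {..<2 * r} \<Longrightarrow> swap_blocks A $$ p = A $$ swap_entry p"
  by (cases p) (auto simp: swap_blocks_def)

lemma inner_swap_blocks:
  assumes A: "A \<in> carrier_mat (2 * r) (2 * r)" and B: "B \<in> carrier_mat (2 * r) (2 * r)"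
  shows "mat_inner (swap_blocks A) B = mat_inner A (swap_blocks B)"
    and "mat_inner (swap_blocks A) (swap_blocks A) = mat_inner A A"
proof -
  let ?I = "{..<2 * r} \<times> {..<2 * r}"
  note pi = sum_reindex_involution[of ?I swap_entry, OF _ swap_entry_in swap_entry_involution]
  have "mat_inner (swap_blocks A) B = (\<Sum>p\<in>?I. A $$ swap_entry p * B $$ p)"
    using A B by (simp add: inner_sum_pairs[of _ "2 * r" "2 * r"] swap_blocks_index)
  also have "\<dots> = (\<Sum>p\<in>?I. A $$ swap_entry p * B $$ swap_entry (swap_entry p))"
    by (intro sum.cong refl) (simp only: swap_entry_involution)
  also have "\<dots> = (\<Sum>p\<in>?I. A $$ p * B $$ swap_entry p)"
    using pi[of "\<lambda>p. A $$ p * B $$ swap_entry p"] by simp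
  also have "\<dots> = mat_inner A (swap_blocks B)"
    using A B by (simp add: inner_sum_pairs[of _ "2 * r" "2 * r"] swap_blocks_index)
  finally show "mat_inner (swap_blocks A) B = mat_inner A (swap_blocks B)" .
  show "mat_inner (swap_blocks A) (swap_blocks A) = mat_inner A A"
    using A pi[of "\<lambda>p. A $$ p * A $$ p"]
    by (simp add: inner_sum_pairs[of _ "2 * r" "2 * r"] swap_blocks_index)
qed

lemma swap_blocks_linear:
  assumes A: "A \<in> carrier_mat (2 * r) (2 * r)" and B: "B \<in> carrier_mat (2 * r) (2 * r)"
  shows "swap_blocks (A + B) = swap_blocks A + swap_blocks B"
    and "swap_blocks (c \<cdot>\<^sub>m A) = c \<cdot>\<^sub>m swap_blocks A"
proof -
  have in': "fst (swap_entry (i, j)) < 2 * r" "snd (swap_entry (i, j)) < 2 * r" if "i < 2 * r" "j < 2 * r" for i j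
    using swap_entry_in[of "(i, j)"] that by (auto simp: mem_Times_iff)
  show "swap_blocks (A + B) = swap_blocks A + swap_blocks B"
  proof (rule eq_matI)
    fix i j assume "i < dim_row (swap_blocks A + swap_blocks B)" "j < dim_col (swap_blocks A + swap_blocks B)"
    then have ij: "i < 2 * r" "j < 2 * r" by auto
    obtain a b where ab: "swap_entry (i, j) = (a, b)" by (cases "swap_entry (i, j)")
    then show "swap_blocks (A + B) $$ (i, j) = (swap_blocks A + swap_blocks B) $$ (i, j)"
      using in'[OF ij] ij A B by (simp add: swap_blocks_index)
  qed auto
  show "swap_blocks (c \<cdot>\<^sub>m A) = c \<cdot>\<^sub>m swap_blocks A"
  proof (rule eq_matI)
    fix i j assume "i < dim_row (c \<cdot>\<^sub>m swap_blocks A)" "j < dim_col (c \<cdot>\<^sub>m swap_blocks A)"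
    then have ij: "i < 2 * r" "j < 2 * r" by auto
    obtain a b where ab: "swap_entry (i, j) = (a, b)" by (cases "swap_entry (i, j)")
    then show "swap_blocks (c \<cdot>\<^sub>m A) $$ (i, j) = (c \<cdot>\<^sub>m swap_blocks A) $$ (i, j)"
      using in'[OF ij] ij A by (simp add: swap_blocks_index)
  qed auto
qed

lemma hess_map_carrier [simp]: "A \<in> carrier_mat (2 * r) (2 * r) \<Longrightarrow> hess_map A \<in> carrier_mat (2 * r) (2 * r)"
  by (simp add: hess_map_def)

lemma hess_map_linear: "linear_on_mats (2 * r) (2 * r) hess_map"
  unfolding linear_on_mats_def
proof (intro conjI ballI allI)
  fix A :: "real mat" assume A: "A \<in> carrier_mat (2 * r) (2 * r)"
  then show "hess_map A \<in> carrier_mat (2 * r) (2 * r)" by simp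
  show "hess_map (c \<cdot>\<^sub>m A) = c \<cdot>\<^sub>m hess_map A" for c
    using A unfolding hess_map_def swap_blocks_linear(2)[OF A A]
    by (intro eq_matI) (auto simp: algebra_simps)
next
  fix A B :: "real mat" assume A: "A \<in> carrier_mat (2 * r) (2 * r)" and B: "B \<in> carrier_mat (2 * r) (2 * r)"
  show "hess_map (A + B) = hess_map A + hess_map B"
    using A B unfolding hess_map_def swap_blocks_linear(1)[OF A B]
    by (intro eq_matI) (auto simp: algebra_simps)
qed

lemma inner_hess_map:
  assumes A: "A \<in> carrier_mat (2 * r) (2 * r)" and B: "B \<in> carrier_mat (2 * r) (2 * r)"
  shows "mat_inner (hess_map A) B = mat_inner A B + (1/2) * mat_inner (swap_blocks A) B"
    and "mat_inner (hess_map A) B = mat_inner (hess_map B) A"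
proof -
  show *: "mat_inner (hess_map A) B = mat_inner A B + (1/2) * mat_inner (swap_blocks A) B"
    using A B by (simp add: hess_map_def inner_linear)
  have "mat_inner (hess_map B) A = mat_inner B A + (1/2) * mat_inner (swap_blocks B) A"
    using A B by (simp add: hess_map_def inner_linear)
  also have "mat_inner (swap_blocks B) A = mat_inner (swap_blocks A) B"
    using inner_swap_blocks(1)[OF B A] inner_commute[of B "swap_blocks A"] B by simp
  also have "mat_inner B A = mat_inner A B" using A B by (intro inner_commute) auto
  finally show "mat_inner (hess_map A) B = mat_inner (hess_map B) A" using * by simp
qed

text \<open>The involution preserves the norm, so by Cauchy-Schwarz half of it changes the squared
  norm by a fraction of at most 1/2, for matrices of any rank.\<close>

lemma hess_map_bounds:
  assumes A: "A \<in> carrier_mat (2 * r) (2 * r)"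
  shows "\<bar>mat_inner (hess_map A) A - (frob_norm A)\<^sup>2\<bar> \<le> (1/2) * (frob_norm A)\<^sup>2"
proof -
  have "frob_norm (swap_blocks A) = frob_norm A"
    using inner_swap_blocks(2)[OF A A] by (simp add: frob_norm_def)
  then have "\<bar>mat_inner (swap_blocks A) A\<bar> \<le> (frob_norm A)\<^sup>2"
    using inner_Cauchy_Schwarz[of "swap_blocks A" A] A by (simp add: power2_eq_square)
  then show ?thesis by (simp add: inner_hess_map(1)[OF A A] frob_norm_sq)
qed

section \<open>Derivatives, admissibility and ground truth of the counterexample\<close>

lemma gt_carrier [simp]: "gt_factor \<in> carrier_mat (2 * r) r"
  by (simp add: gt_factor_def)

lemma spurious_carrier [simp]: "spurious_factor \<in> carrier_mat (2 * r) r"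
  by (simp add: spurious_factor_def)

lemma gt_mat_carrier: "gt_mat \<in> carrier_mat (2 * r) (2 * r)"
  unfolding gt_mat_def by (intro mult_carrier_mat[of _ "2 * r" r]) auto

lemma has_grad_counterexample:
  assumes X: "X \<in> carrier_mat (2 * r) (2 * r)"
  shows "has_grad (2 * r) (2 * r) counterexample X (hess_map (X - gt_mat))"
proof -
  define D where "D = X - gt_mat"
  have D: "D \<in> carrier_mat (2 * r) (2 * r)" using gt_mat_carrier by (simp add: D_def minus_carrier_mat)
  have "small_remainder (2 * r) (2 * r)
      (\<lambda>K. counterexample (X + K) - counterexample X - mat_inner (hess_map D) K)"
  proof (rule small_remainder_quadratic)
    fix K :: "real mat" assume K: "K \<in> carrier_mat (2 * r) (2 * r)"
    have "X + K - gt_mat = D + K" unfolding D_def using X K gt_mat_carrier by (intro eq_matI) auto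
    moreover have "hess_map (D + K) = hess_map D + hess_map K"
      using hess_map_linear D K by (simp add: linear_on_mats_def)
    \<comment> \<open>The objective is quadratic, so the remainder is exactly half the Hessian
      form.\<close>
    ultimately have "counterexample (X + K) - counterexample X - mat_inner (hess_map D) K
        = (1/2) * mat_inner (hess_map K) K"
      using D K inner_hess_map(2)[OF K D] hess_map_carrier[OF D] hess_map_carrier[OF K]
      by (simp add: counterexample_def D_def[symmetric] inner_add_left inner_add_right algebra_simps)
    moreover have "\<bar>mat_inner (hess_map K) K\<bar> \<le> 2 * (frob_norm K)\<^sup>2"
      using hess_map_bounds[OF K] zero_le_power2[of "frob_norm K"] by linarith
    ultimately show "\<bar>counterexample (X + K) - counterexample X - mat_inner (hess_map D) K\<bar>
        \<le> 1 * (frob_norm K)\<^sup>2" by simp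
  qed simp
  then show ?thesis using D by (simp add: has_grad_iff D_def)
qed

lemma grad_counterexample:
  "X \<in> carrier_mat (2 * r) (2 * r) \<Longrightarrow> grad (2 * r) (2 * r) counterexample X = hess_map (X - gt_mat)"
  by (rule grad_eqI[OF has_grad_counterexample])

lemma has_hess_op_counterexample:
  assumes X: "X \<in> carrier_mat (2 * r) (2 * r)"
  shows "has_hess_op (2 * r) (2 * r) counterexample X hess_map"
  unfolding has_hess_op_iff
proof (intro conjI hess_map_linear small_remainder_quadratic)
  fix K :: "real mat" assume K: "K \<in> carrier_mat (2 * r) (2 * r)"
  have D: "X - gt_mat \<in> carrier_mat (2 * r) (2 * r)" using gt_mat_carrier by (simp add: minus_carrier_mat)
  have "X + K - gt_mat = (X - gt_mat) + K" using X K gt_mat_carrier by (intro eq_matI) auto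
  then have "hess_map (X + K - gt_mat) = hess_map (X - gt_mat) + hess_map K"
    using hess_map_linear D K by (simp add: linear_on_mats_def)
  moreover have "hess_map (X - gt_mat) + hess_map K - hess_map (X - gt_mat) - hess_map K = 0\<^sub>m (2 * r) (2 * r)"
    using hess_map_carrier[OF D] hess_map_carrier[OF K] by (intro eq_matI) auto
  ultimately show "\<bar>frob_norm (grad (2 * r) (2 * r) counterexample (X + K)
      - grad (2 * r) (2 * r) counterexample X - hess_map K)\<bar> \<le> 0 * (frob_norm K)\<^sup>2"
    using X K by (simp add: grad_counterexample)
qed simp

lemma hess_counterexample:
  assumes "X \<in> carrier_mat (2 * r) (2 * r)" "K \<in> carrier_mat (2 * r) (2 * r)" "L \<in> carrier_mat (2 * r) (2 * r)"
  shows "hess (2 * r) (2 * r) counterexample X K L = mat_inner (hess_map K) L"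
proof (rule hess_eqI[OF _ assms(1) has_hess_op_counterexample[OF assms(1)] assms(2,3)])
  fix X :: "real mat" assume "X \<in> carrier_mat (2 * r) (2 * r)"
  then show "grad (2 * r) (2 * r) counterexample X \<in> carrier_mat (2 * r) (2 * r)"
    using gt_mat_carrier by (simp add: grad_counterexample minus_carrier_mat)
qed

lemma admissible_counterexample: "admissible_objective (2 * r) counterexample"
  unfolding admissible_objective_def
proof
  show "twice_cont_diff (2 * r) (2 * r) counterexample"
    unfolding twice_cont_diff_def
  proof (intro conjI ballI allI impI)
    fix K L X :: "real mat" and e :: real
    assume "K \<in> carrier_mat (2 * r) (2 * r)" "L \<in> carrier_mat (2 * r) (2 * r)" "X \<in> carrier_mat (2 * r) (2 * r)" "e > 0"
    then show "\<exists>d>0. \<forall>Y\<in>carrier_mat (2 * r) (2 * r). frob_norm (Y - X) < d \<longrightarrow>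
        \<bar>hess (2 * r) (2 * r) counterexample Y K L - hess (2 * r) (2 * r) counterexample X K L\<bar> < e"
      by (intro exI[of _ 1]) (simp add: hess_counterexample)
  qed (use has_grad_counterexample has_hess_op_counterexample in blast)+
  show "\<forall>X\<in>carrier_mat (2 * r) (2 * r). symmetric_matrix X \<longrightarrow>
      symmetric_matrix (grad (2 * r) (2 * r) counterexample X)"
  proof (intro ballI impI)
    fix X :: "real mat" assume X: "X \<in> carrier_mat (2 * r) (2 * r)" and Xs: "symmetric_matrix X"
    define D where "D = X - gt_mat"
    have D: "D \<in> carrier_mat (2 * r) (2 * r)" using gt_mat_carrier by (simp add: D_def minus_carrier_mat)
    have Ds: "D $$ (i, j) = D $$ (j, i)" if "i < 2 * r" "j < 2 * r" for i j
    proof -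
      have "D\<^sup>T = D"
        using X Xs gt_mat_carrier unfolding D_def symmetric_matrix_def
        by (simp add: transpose_minus[of _ "2 * r" "2 * r"] gt_mat_def self_transpose_symmetric)
      then show ?thesis using D that by (metis carrier_matD index_transpose_mat(1))
    qed
    have "(hess_map D)\<^sup>T = hess_map D"
    proof (rule eq_matI)
      fix i j assume "i < dim_row (hess_map D)" "j < dim_col (hess_map D)"
      then have ij: "i < 2 * r" "j < 2 * r" using hess_map_carrier[OF D] by auto
      \<comment> \<open>Swapping the blocks commutes with transposition.\<close>
      have "D $$ swap_entry (j, i) = D $$ swap_entry (i, j)"
        using ij Ds by (auto simp: swap_entry_def swap_index_def)
      then show "(hess_map D)\<^sup>T $$ (i, j) = hess_map D $$ (i, j)"
        using ij D Ds[OF ij] by (simp add: hess_map_def swap_blocks_index)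
    qed (use hess_map_carrier[OF D] in auto)
    then show "symmetric_matrix (grad (2 * r) (2 * r) counterexample X)"
      using X by (simp add: grad_counterexample symmetric_matrix_def D_def)
  qed
qed

lemma RIP_counterexample: "RIP (2 * r) p q (1/2) counterexample"
  unfolding RIP_def
proof (intro conjI ballI impI)
  fix M K :: "real mat" assume M: "M \<in> carrier_mat (2 * r) (2 * r)" and K: "K \<in> carrier_mat (2 * r) (2 * r)"
  show "(1 - 1/2) * (frob_norm K)\<^sup>2 \<le> hess (2 * r) (2 * r) counterexample M K K"
    and "hess (2 * r) (2 * r) counterexample M K K \<le> (1 + 1/2) * (frob_norm K)\<^sup>2"
    using hess_map_bounds[OF K] unfolding hess_counterexample[OF M K K] abs_le_iff by (simp_all add: algebra_simps)
qed auto

lemma hess_map_zero: "hess_map (0\<^sub>m (2 * r) (2 * r)) = 0\<^sub>m (2 * r) (2 * r)"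
proof (rule eq_matI)
  fix i j assume "i < dim_row (0\<^sub>m (2 * r) (2 * r) :: real mat)" "j < dim_col (0\<^sub>m (2 * r) (2 * r) :: real mat)"
  then have ij: "i < 2 * r" "j < 2 * r" by auto
  obtain a b where "swap_entry (i, j) = (a, b)" by (cases "swap_entry (i, j)")
  then show "hess_map (0\<^sub>m (2 * r) (2 * r)) $$ (i, j) = 0\<^sub>m (2 * r) (2 * r) $$ (i, j)"
    using ij swap_entry_in[of "(i, j)"] by (simp add: hess_map_def swap_blocks_index)
qed (auto simp: hess_map_def)

lemma self_product_psd:
  assumes A: "A \<in> carrier_mat n k"
  shows "psd_form n (A * (A :: real mat)\<^sup>T)"
  unfolding psd_form_def
proof
  fix v :: "real vec" assume v: "v \<in> carrier_vec n"
  have "v \<bullet> (A * A\<^sup>T *\<^sub>v v) = v \<bullet> (A *\<^sub>v (A\<^sup>T *\<^sub>v v))"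
    using A v by (simp add: assoc_mult_mat_vec[of _ n k _ n])
  also have "\<dots> = (A\<^sup>T *\<^sub>v v) \<bullet> (A\<^sup>T *\<^sub>v v)"
    using transpose_vec_mult_scalar[of A n k "A\<^sup>T *\<^sub>v v" v] A v by simp
  also have "\<dots> \<ge> 0" by (simp add: scalar_prod_def sum_nonneg)
  finally show "0 \<le> v \<bullet> (A * A\<^sup>T *\<^sub>v v)" .
qed

lemma ground_truth_counterexample: "ground_truth (2 * r) r counterexample gt_mat"
  unfolding ground_truth_def
proof (intro conjI)
  have "gt_mat - gt_mat = 0\<^sub>m (2 * r) (2 * r)" using gt_mat_carrier by (intro eq_matI) auto
  then show "grad (2 * r) (2 * r) counterexample gt_mat = 0\<^sub>m (2 * r) (2 * r)"
    by (simp add: grad_counterexample[OF gt_mat_carrier] hess_map_zero)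
  show "symmetric_matrix gt_mat" by (simp add: symmetric_matrix_def gt_mat_def self_transpose_symmetric)
  show "psd_form (2 * r) gt_mat" unfolding gt_mat_def by (rule self_product_psd) (rule gt_carrier)
  show "mat_rank (2 * r) gt_mat \<le> r"
    unfolding gt_mat_def using vec_space.rank_mult_le[OF gt_carrier, of "gt_factor\<^sup>T" "2 * r"] by simp
qed (rule gt_mat_carrier)

section \<open>The spurious critical point\<close>

lemma spurious_mat_carrier: "spurious_mat \<in> carrier_mat (2 * r) (2 * r)"
  unfolding spurious_mat_def by (intro mult_carrier_mat[of _ "2 * r" r]) auto

lemma gt_mat_index: "i < 2 * r \<Longrightarrow> j < 2 * r \<Longrightarrow> gt_mat $$ (i, j) = (if i = j \<and> r \<le> i then 2 else 0)"
proof -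
  assume ij: "i < 2 * r" "j < 2 * r"
  have "gt_mat $$ (i, j) = (\<Sum>k<r. (if i = k + r then sqrt 2 else 0) * (if j = k + r then sqrt 2 else 0))"
    using ij by (simp add: gt_mat_def gt_factor_def scalar_prod_def atLeast0LessThan)
  also have "\<dots> = (\<Sum>k<r. if k = i - r then (if i = j \<and> r \<le> i then 2 else 0) else 0)"
    by (intro sum.cong refl) auto
  also have "\<dots> = (if i = j \<and> r \<le> i then 2 else 0)" using ij by (auto simp: sum.delta)
  finally show ?thesis .
qed

lemma spurious_mat_index: "i < 2 * r \<Longrightarrow> j < 2 * r \<Longrightarrow> spurious_mat $$ (i, j) = (if i = j \<and> i < r then 1 else 0)"
proof -
  assume ij: "i < 2 * r" "j < 2 * r"
  have "spurious_mat $$ (i, j) = (\<Sum>k<r. (if i = k then 1 else 0) * (if j = k then 1 else 0))"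
    using ij by (simp add: spurious_mat_def spurious_factor_def scalar_prod_def atLeast0LessThan)
  also have "\<dots> = (\<Sum>k<r. if k = i then (if i = j then 1 else 0) else 0)"
    by (intro sum.cong refl) auto
  also have "\<dots> = (if i = j \<and> i < r then 1 else 0)" using ij by (auto simp: sum.delta)
  finally show ?thesis .
qed

text \<open>In the first block the coupling contributes 1/2 times -2, which cancels the entry 1; the
  second block keeps -2 + 1/2.\<close>

lemma grad_at_spurious:
  "hess_map (spurious_mat - gt_mat) = mat (2 * r) (2 * r) (\<lambda>(i, j). if i = j \<and> r \<le> i then - 3/2 else 0)"
proof (rule eq_matI)
  fix i j assume "i < dim_row (mat (2 * r) (2 * r) (\<lambda>(i, j). if i = j \<and> r \<le> i then - 3/2 else 0) :: real mat)"
    "j < dim_col (mat (2 * r) (2 * r) (\<lambda>(i, j). if i = j \<and> r \<le> i then - 3/2 else 0) :: real mat)"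
  then have ij: "i < 2 * r" "j < 2 * r" by auto
  have D: "(spurious_mat - gt_mat) $$ (a, b) = (if a = b then (if a < r then 1 else - 2) else 0)" if "a < 2 * r" "b < 2 * r" for a b
    using that spurious_mat_carrier gt_mat_carrier spurious_mat_index[OF that] gt_mat_index[OF that]
    by simp
  have Dc: "spurious_mat - gt_mat \<in> carrier_mat (2 * r) (2 * r)" using gt_mat_carrier by (simp add: minus_carrier_mat)
  have sw: "(spurious_mat - gt_mat) $$ swap_entry (i, j) = (if i = j then (if i < r then - 2 else 1) else 0)"
    using ij by (auto simp: swap_entry_def swap_index_def D)
  show "hess_map (spurious_mat - gt_mat) $$ (i, j) = mat (2 * r) (2 * r) (\<lambda>(i, j). if i = j \<and> r \<le> i then - 3/2 else 0) $$ (i, j)"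
    using ij D[OF ij] sw Dc by (simp add: hess_map_def swap_blocks_index)
qed (use gt_mat_carrier in \<open>auto simp: hess_map_def\<close>)

text \<open>N collects the entries of V in the lower half, the escape directions. The gradient term
  contributes -3 N and each off-diagonal block of S contributes 3/2 N, an exact balance; the rest is
  a sum of squares.\<close>

lemma spurious_curvature:
  assumes V: "V \<in> carrier_mat (2 * r) r"
  defines "S \<equiv> outer_sym spurious_factor V"
  shows "0 \<le> mat_inner (hess_map S) S + 2 * mat_inner (hess_map (spurious_mat - gt_mat)) (V * V\<^sup>T)"
proof -
  have S: "S \<in> carrier_mat (2 * r) (2 * r)" unfolding S_def by (rule outer_sym_carrier[OF spurious_carrier V])
  define v where "v i j = V $$ (i, j)" for i j
  have S_index: "S $$ (i, j) = (if i < r then v j i else 0) + (if j < r then v i j else 0)"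
    if ij: "i < 2 * r" "j < 2 * r" for i j
  proof -
    have "S $$ (i, j) = (\<Sum>k<r. (if i = k then 1 else 0) * v j k) + (\<Sum>k<r. v i k * (if j = k then 1 else 0))"
      using ij V by (simp add: S_def outer_sym_def spurious_factor_def scalar_prod_def atLeast0LessThan v_def)
    also have "(\<Sum>k<r. (if i = k then 1 else 0) * v j k) = (\<Sum>k<r. if k = i then v j i else 0)"
      by (intro sum.cong refl) auto
    also have "(\<Sum>k<r. v i k * (if j = k then 1 else 0)) = (\<Sum>k<r. if k = j then v i j else 0)"
      by (intro sum.cong refl) auto
    finally have "S $$ (i, j) = (\<Sum>k<r. if k = i then v j i else 0) + (\<Sum>k<r. if k = j then v i j else 0)" .
    then show ?thesis by (auto simp: sum.delta)
  qed
  define N where "N = (\<Sum>k<r. \<Sum>i\<in>{r..<2 * r}. (v i k)\<^sup>2)"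
  have un: "{..<2 * r} = {..<r} \<union> {r..<2 * r}" by auto
  have G: "mat_inner (hess_map (spurious_mat - gt_mat)) (V * V\<^sup>T) = - (3/2) * N"
  proof -
    have "mat_inner (hess_map (spurious_mat - gt_mat)) (V * V\<^sup>T) = (\<Sum>j<2*r. \<Sum>i<2*r.
        if i = j then (if r \<le> j then - (3/2) * (\<Sum>k<r. (v j k)\<^sup>2) else 0) else 0)"
    proof -
      have "mat_inner (hess_map (spurious_mat - gt_mat)) (V * V\<^sup>T)
          = (\<Sum>j<2*r. \<Sum>i<2*r. hess_map (spurious_mat - gt_mat) $$ (i, j) * (V * V\<^sup>T) $$ (i, j))"
        unfolding grad_at_spurious using V by (intro mat_inner_eq_sum) auto
      also have "\<dots> = (\<Sum>j<2*r. \<Sum>i<2*r.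
          if i = j then (if r \<le> j then - (3/2) * (\<Sum>k<r. (v j k)\<^sup>2) else 0) else 0)"
        unfolding grad_at_spurious using V
        by (intro sum.cong refl) (auto simp: scalar_prod_def atLeast0LessThan v_def power2_eq_square)
      finally show ?thesis .
    qed
    also have "\<dots> = (\<Sum>j<2*r. if r \<le> j then - (3/2) * (\<Sum>k<r. (v j k)\<^sup>2) else 0)"
      by (intro sum.cong refl) (simp add: sum.delta)
    also have "\<dots> = (\<Sum>j\<in>{r..<2 * r}. - (3/2) * (\<Sum>k<r. (v j k)\<^sup>2))"
      by (intro sum.mono_neutral_cong_right) auto
    also have "\<dots> = - (3/2) * N" unfolding N_def by (subst sum.swap) (simp add: sum_distrib_left)
    finally show ?thesis .
  qed
  define h where "h p = S $$ p * S $$ p + (1/2) * (S $$ swap_entry p * S $$ p)" for p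
  have "mat_inner (hess_map S) S = (\<Sum>p\<in>{..<2*r} \<times> {..<2*r}. h p)"
    unfolding inner_hess_map(1)[OF S S] h_def using S
    by (simp add: inner_sum_pairs[of _ "2 * r" "2 * r"] swap_blocks_index sum.distrib sum_distrib_left)
  also have "\<dots> = (\<Sum>i<2*r. \<Sum>j<2*r. h (i, j))" by (simp add: sum.cartesian_product)
  also have "\<dots> = ((\<Sum>i<r. \<Sum>j<r. h (i, j)) + (\<Sum>i<r. \<Sum>j\<in>{r..<2*r}. h (i, j)))
      + ((\<Sum>i\<in>{r..<2*r}. \<Sum>j<r. h (i, j)) + (\<Sum>i\<in>{r..<2*r}. \<Sum>j\<in>{r..<2*r}. h (i, j)))"
    unfolding un by (subst sum.union_disjoint, auto)+
  also have "(\<Sum>i<r. \<Sum>j\<in>{r..<2*r}. h (i, j)) = (3/2) * N"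
  proof -
    have "h (i, j) = (3/2) * (v j i)\<^sup>2" if "i < r" "r \<le> j" "j < 2 * r" for i j
      using that by (simp add: h_def swap_entry_def S_index power2_eq_square)
    then show ?thesis unfolding N_def sum_distrib_left by (intro sum.cong refl) auto
  qed
  also have "(\<Sum>i\<in>{r..<2*r}. \<Sum>j<r. h (i, j)) = (3/2) * N"
  proof -
    have "h (i, j) = (3/2) * (v i j)\<^sup>2" if "j < r" "r \<le> i" "i < 2 * r" for i j
      using that by (simp add: h_def swap_entry_def S_index power2_eq_square)
    then show ?thesis
      unfolding N_def sum_distrib_left by (subst sum.swap) (intro sum.cong refl, auto)
  qed
  also have "(\<Sum>i\<in>{r..<2*r}. \<Sum>j\<in>{r..<2*r}. h (i, j)) = 0"
    by (intro sum.neutral ballI) (simp add: h_def S_index)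
  finally have "mat_inner (hess_map S) S = (\<Sum>i<r. \<Sum>j<r. h (i, j)) + 3 * N" by simp
  \<comment> \<open>The lower right block of S is zero, so the coupling vanishes on the upper left
    block and h is a square there.\<close>
  moreover have "0 \<le> (\<Sum>i<r. \<Sum>j<r. h (i, j))"
    by (intro sum_nonneg) (simp add: h_def swap_entry_def swap_index_def S_index)
  ultimately show ?thesis using G by simp
qed

lemma spurious_counterexample:
  assumes r: "r \<ge> 1"
  shows "spurious (2 * r) r (factored counterexample) spurious_factor"
proof -
  let ?U = spurious_factor
  have G0: "hess_map (spurious_mat - gt_mat) * ?U = 0\<^sub>m (2 * r) r"
    unfolding grad_at_spurious
    by (intro eq_matI) (auto simp: spurious_factor_def scalar_prod_def intro!: sum.neutral)
  have "second_order_critical (2 * r) r (factored counterexample) ?U"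
    unfolding second_order_critical_def
  proof (intro conjI ballI)
    have "2 \<cdot>\<^sub>m (0\<^sub>m (2 * r) r :: real mat) = 0\<^sub>m (2 * r) r" by (intro eq_matI) auto
    then show "grad (2 * r) r (factored counterexample) ?U = 0\<^sub>m (2 * r) r"
      by (simp add: grad_factored[OF admissible_counterexample] spurious_mat_def[symmetric] grad_counterexample[OF spurious_mat_carrier] G0)
    fix V :: "real mat" assume V: "V \<in> carrier_mat (2 * r) r"
    show "0 \<le> hess (2 * r) r (factored counterexample) ?U V V"
      using spurious_curvature[OF V] V
      by (simp add: hess_factored[OF admissible_counterexample _ V] spurious_mat_def[symmetric] grad_counterexample[OF spurious_mat_carrier]
          hess_counterexample[OF spurious_mat_carrier] outer_sym_carrier[OF spurious_carrier V])
  qed simp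
  moreover have "factored counterexample gt_factor < factored counterexample ?U"
  proof -
    define D where "D = spurious_mat - gt_mat"
    have D: "D \<in> carrier_mat (2 * r) (2 * r)" using gt_mat_carrier by (simp add: D_def minus_carrier_mat)
    \<comment> \<open>One nonzero entry suffices: the Hessian form is at least half the squared norm
      of D, so the objective is positive at the spurious point, while it is 0 at the ground
      truth.\<close>
    have "D $$ (0, 0) = 1"
      using r spurious_mat_carrier gt_mat_carrier spurious_mat_index[of 0 0] gt_mat_index[of 0 0]
      by (simp add: D_def)
    then have "1 \<le> frob_norm D" using abs_entry_le_norm[of 0 D 0] D r by simp
    then have "0 < (frob_norm D)\<^sup>2" by simp
    then have "0 < mat_inner (hess_map D) D" using hess_map_bounds[OF D] by linarith
    moreover have "gt_mat - gt_mat = 0\<^sub>m (2 * r) (2 * r)" using gt_mat_carrier by (intro eq_matI) auto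
    ultimately show ?thesis
      by (simp add: factored_def counterexample_def D_def hess_map_zero gt_mat_def[symmetric] spurious_mat_def[symmetric])
  qed
  ultimately show ?thesis
    unfolding spurious_def using gt_carrier by (meson not_le)
qed

end

theorem corollary3:
  shows
    "(\<forall>r\<ge>1. \<forall>n\<ge>1. \<forall>f Ms \<delta>.
        admissible_objective n f \<longrightarrow> ground_truth n r f Ms \<longrightarrow>
        RIP n (2 * r) (2 * r) \<delta> f \<longrightarrow> \<delta> \<le> 1/3 \<longrightarrow>
        \<not> (\<exists>U. spurious n r (factored f) U))
   \<and> (\<exists>C :: real \<Rightarrow> real. (\<forall>\<delta>. 0 \<le> \<delta> \<longrightarrow> \<delta> < 1/2 \<longrightarrow> 0 < C \<delta> \<and> C \<delta> \<le> 1) \<and>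
        (\<forall>r\<ge>1. \<forall>n\<ge>1. \<forall>f Ms \<delta> U.
          admissible_objective n f \<longrightarrow> ground_truth n r f Ms \<longrightarrow>
          RIP n (2 * r) (2 * r) \<delta> f \<longrightarrow> \<delta> < 1/2 \<longrightarrow>
          second_order_critical n r (factored f) U \<longrightarrow>
          C \<delta> * frob_norm (U * U\<^sup>T) * frob_norm Ms \<le> mat_inner (U * U\<^sup>T) Ms))
   \<and> (\<forall>r\<ge>1. \<exists>n\<ge>1. \<exists>f Ms.
        admissible_objective n f \<and> ground_truth n r f Ms \<and>
        RIP n (2 * r) (2 * r) (1/2) f \<and>
        (\<exists>U. spurious n r (factored f) U))
   \<and> (\<forall>n\<ge>1. \<forall>f Ms \<delta>.
        admissible_objective n f \<longrightarrow> ground_truth n 1 f Ms \<longrightarrow>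
        RIP n 2 2 \<delta> f \<longrightarrow> \<delta> < 1/2 \<longrightarrow>
        \<not> (\<exists>U. spurious n 1 (factored f) U))"
proof -
  have factor: "\<exists>Z\<in>carrier_mat n r. Ms = Z * Z\<^sup>T" if "ground_truth n r f Ms" for n r f Ms
    using that psd_factorization by (simp add: ground_truth_def symmetric_matrix_def)
  have part1: "\<not> spurious n r (factored f) U"
    if r: "r \<ge> 1" and adm: "admissible_objective n f" and gt: "ground_truth n r f Ms"
      and rip: "RIP n (2 * r) (2 * r) \<delta> f" and d: "\<delta> \<le> 1/3" for n r f Ms \<delta> U
  proof
    assume sp: "spurious n r (factored f) U"
    then have soc: "second_order_critical n r (factored f) U" by (simp add: spurious_def)
    obtain Z where Z: "Z \<in> carrier_mat n r" "Ms = Z * Z\<^sup>T" using factor[OF gt] by blast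
    have gr: "grad n n f (Z * Z\<^sup>T) = 0\<^sub>m n n" using gt Z by (simp add: ground_truth_def)
    interpret P: critical_pair n r f Z U \<delta>
      by (unfold_locales) (rule adm Z gr rip soc)+
    show False
    proof (cases "P.sig2 = 0")
      case True
      then have "P.S = 0" using P.S_pos_imp P.g_le_of_sig2_zero[OF r] by blast
      then show False using P.not_spurious_if_eq[OF P.S_zeroD] sp by simp
    next
      case False
      then have s: "P.sig2 > 0" using P.sig2_nonneg[OF r] by simp
      obtain E L Li where E: "E \<in> carrier_mat n r" "E\<^sup>T * E = 1\<^sub>m r" and L: "L \<in> carrier_mat r r" "U = E * L\<^sup>T"
        and Li: "Li \<in> carrier_mat r r" "L * Li = 1\<^sub>m r" "Li * L = 1\<^sub>m r"
        by (rule P.orthonormal_factor[OF s])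
      have "E\<^sup>T * Z \<in> carrier_mat r r" using E(1) Z(1) by simp
      then obtain Q where Q: "Q \<in> carrier_mat r r" "Q * Q\<^sup>T = 1\<^sub>m r" "(E\<^sup>T * Z * Q)\<^sup>T = E\<^sup>T * Z * Q"
        by (rule symmetric_after_rotation)
      \<comment> \<open>Z Q is another factor of the same ground truth, now with E^T Z Q symmetric;
        the facts about critical pairs are instantiated with it.\<close>
      have ZQ: "Z * Q \<in> carrier_mat n r" using Z Q by simp
      have "Z * Q * (Z * Q)\<^sup>T = Z * (Q * Q\<^sup>T * Z\<^sup>T)"
        using Z(1) Q(1) by (simp add: transpose_mult_dim mult_assoc_dim)
      then have Ms: "Z * Q * (Z * Q)\<^sup>T = Z * Z\<^sup>T" using Z(1) Q(2) by simp
      interpret R: critical_pair n r f "Z * Q" U \<delta>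
        by (unfold_locales) (simp_all add: adm ZQ Ms gr rip soc)
      have "E\<^sup>T * (Z * Q) = E\<^sup>T * Z * Q" using E(1) Z(1) Q(1) by (simp add: mult_assoc_dim)
      then have sym: "(E\<^sup>T * (Z * Q))\<^sup>T = E\<^sup>T * (Z * Q)" using Q(3) by simp
      have "R.sig2 > 0" using s by (simp add: R.sig2_def P.sig2_def)
      then have "R.M = R.Ms" by (rule R.aligned_recovery[OF r d _ E L Li sym])
      then show False using R.not_spurious_if_eq sp by simp
    qed
  qed
  have part2: "(1 - 2 * \<delta>) / 3 * frob_norm (U * U\<^sup>T) * frob_norm Ms \<le> mat_inner (U * U\<^sup>T) Ms"
    if r: "r \<ge> 1" and adm: "admissible_objective n f" and gt: "ground_truth n r f Ms"
      and rip: "RIP n (2 * r) (2 * r) \<delta> f" and d: "\<delta> < 1/2"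
      and soc: "second_order_critical n r (factored f) U" for n r f Ms \<delta> U
  proof -
    obtain Z where Z: "Z \<in> carrier_mat n r" "Ms = Z * Z\<^sup>T" using factor[OF gt] by blast
    have gr: "grad n n f (Z * Z\<^sup>T) = 0\<^sub>m n n" using gt Z by (simp add: ground_truth_def)
    interpret P: critical_pair n r f Z U \<delta>
      by (unfold_locales) (rule adm Z gr rip soc)+
    show ?thesis using P.correlation[OF r d] by (simp add: P.M_def P.Ms_def Z(2))
  qed
  have part4: "\<not> spurious n 1 (factored f) U"
    if adm: "admissible_objective n f" and gt: "ground_truth n 1 f Ms"
      and rip: "RIP n 2 2 \<delta> f" and d: "\<delta> < 1/2" for n f Ms \<delta> U
  proof
    assume sp: "spurious n 1 (factored f) U"
    then have soc: "second_order_critical n 1 (factored f) U" by (simp add: spurious_def)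
    obtain Z where Z: "Z \<in> carrier_mat n 1" "Ms = Z * Z\<^sup>T" using factor[OF gt] by blast
    have gr: "grad n n f (Z * Z\<^sup>T) = 0\<^sub>m n n" using gt Z by (simp add: ground_truth_def)
    have rip': "RIP n (2 * 1) (2 * 1) \<delta> f" using rip by simp
    interpret P: critical_pair n 1 f Z U \<delta>
      by (unfold_locales) (rule adm Z gr rip' soc)+
    show False using P.not_spurious_if_eq[OF P.rank_one_recovery[OF refl d]] sp by simp
  qed
  show ?thesis
  proof (intro conjI)
    show "\<exists>C :: real \<Rightarrow> real. (\<forall>\<delta>. 0 \<le> \<delta> \<longrightarrow> \<delta> < 1/2 \<longrightarrow> 0 < C \<delta> \<and> C \<delta> \<le> 1) \<and>
        (\<forall>r\<ge>1. \<forall>n\<ge>1. \<forall>f Ms \<delta> U.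
          admissible_objective n f \<longrightarrow> ground_truth n r f Ms \<longrightarrow>
          RIP n (2 * r) (2 * r) \<delta> f \<longrightarrow> \<delta> < 1/2 \<longrightarrow>
          second_order_critical n r (factored f) U \<longrightarrow>
          C \<delta> * frob_norm (U * U\<^sup>T) * frob_norm Ms \<le> mat_inner (U * U\<^sup>T) Ms)"
      \<comment> \<open>The constant of \<open>correlation_arithmetic\<close>; for these \<delta> it
        lies between 0 and 1/3.\<close>
      using part2 by (intro exI[of _ "\<lambda>\<delta>. (1 - 2 * \<delta>) / 3"]) auto
    show "\<forall>r\<ge>1. \<exists>n\<ge>1. \<exists>f Ms.
        admissible_objective n f \<and> ground_truth n r f Ms \<and>
        RIP n (2 * r) (2 * r) (1/2) f \<and>
        (\<exists>U. spurious n r (factored f) U)"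
    proof (intro allI impI)
      fix r :: nat assume r: "r \<ge> 1"
      then have "2 * r \<ge> 1" by simp
      then show "\<exists>n\<ge>1. \<exists>f Ms. admissible_objective n f \<and> ground_truth n r f Ms \<and>
          RIP n (2 * r) (2 * r) (1/2) f \<and> (\<exists>U. spurious n r (factored f) U)"
        using admissible_counterexample[of r] ground_truth_counterexample[of r]
          RIP_counterexample[of r] spurious_counterexample[OF r] by blast
    qed
  qed (use part1 part4 in blast)+
qed

end
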